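(* Let $(M,g)$ be a Riemannian manifold, $f:M\to ]0,+\infty[$ a smooth function, and let $g^{f}$ be the Mus-Gradient metric on $TM$. Let $\nabla$ and $\nabla^{f}$ denote the Levi-Civita connections of $(M,g)$ and $(TM,g^{f})$ respectively, and let $R$ be the curvature tensor of $(M,g)$. Then for all vector fields $X,Y\in\Gamma(TM)$ and all $p=(x,u)\in TM$: 1) $(\nabla^{f}_{X^{H}}Y^{H})_{p}=(\nabla_{X}Y)^{H}_{p}-\frac12\big(R_{x}(X,Y)u\big)^{V}$; 2) $(\nabla^{f}_{X^{H}}Y^{V})_{p}=\frac12\big(R_{x}(u,Y)X\big)^{H}+\frac12Y_{x}(f)\big(R_{x}(u,\operatorname{grad}f)X\big)^{H}+\frac12Y_{x}(f)\big(\nabla_{X}\operatorname{grad}f\big)^{V}_{p}+(\nabla_{X}Y)^{V}_{p}+\frac{1}{2\alpha}\big[g_{x}(Y,\nabla_{X}\operatorname{grad}f)-\frac12X_{x}(\alpha)Y_{x}(f)\big](\operatorname{grad}f)^{V}_{p}$; 3) $(\nabla^{f}_{X^{V}}Y^{H})_{p}=\frac12\big(R_{x}(u,X)Y\big)^{H}+\frac12X_{x}(f)\big(R_{x}(u,\operatorname{grad}f)Y\big)^{H}+\frac12X_{x}(f)\big(\nabla_{Y}\operatorname{grad}f\big)^{V}_{p}+\frac{1}{2\alpha}\big[g_{x}(X,\nabla_{Y}\operatorname{grad}f)-\frac12Y_{x}(\alpha)X_{x}(f)\big](\operatorname{grad}f)^{V}_{p}$; 4) $(\nabla^{f}_{X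^{V}}Y^{V})_{p}=-\frac12X_{x}(f)\big(\nabla_{Y}\operatorname{grad}f\big)^{H}_{p}-\frac12Y_{x}(f)\big(\nabla_{X}\operatorname{grad}f\big)^{H}_{p}$.
   Context: A point of $TM$ is written $p=(x,u)$, $x\in M$, $u\in T_xM$. In induced local coordinates $(x^i,y^i)$ on $TM$, the vertical and horizontal lifts of $X=X^i\frac{\partial}{\partial x^i}$ are $X^V=X^i\frac{\partial}{\partial y^i}$ and $X^H=X^i\big(\frac{\partial}{\partial x^i}-y^j\Gamma_{ij}^k\frac{\partial}{\partial y^k}\big)$, where $\Gamma_{ij}^k$ are the Christoffel symbols of $g$; the same formulas lift a tangent vector in $T_xM$ (such as $R_x(X,Y)u$) to $T_{(x,u)}TM$. The Mus-Gradient metric $g^{f}$ on $TM$ is defined, for $X,Y\in\Gamma(TM)$ and $(x,u)\in TM$, by $g^{f}(X^H,Y^H)_{(x,u)}=g_x(X,Y)$, $g^{f}(X^H,Y^V)_{(x,u)}=0$, $g^{f}(X^V,Y^V)_{(x,u)}=g_x(X,Y)+X_x(f)Y_x(f)$. Put $\alpha=1+\|\operatorname{grad}f\|^2$, with gradient and norm taken with respect to $g$. Curvature convention: $R(X,Y)Z=\nabla_X\nabla_YZ-\nabla_Y\nabla_XZ-\nabla_{[X,Y]}Z$. Scalar coefficients are evaluated at $x$. *)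

theory Defs
  imports "HOL-Analysis.Analysis" "HOL-Library.Function_Algebras"
begin

text \<open>Real-valued scaling of functions, complementing the pointwise addition of
  \<^theory>\<open>HOL-Library.Function_Algebras\<close>; tangent vectors and vector fields are functions below.\<close>

instantiation "fun" :: (type, real_vector) real_vector
begin

definition scaleR_fun :: "real \<Rightarrow> ('a \<Rightarrow> 'b) \<Rightarrow> 'a \<Rightarrow> 'b"
  where "scaleR_fun r F = (\<lambda>x. r *\<^sub>R F x)"

instance
  by standard (simp_all add: scaleR_fun_def fun_eq_iff scaleR_add_right scaleR_add_left)

end

subsection \<open>Smooth maps between Euclidean spaces\<close>

text \<open>\<open>Ck_on k S F\<close> is used only for open \<open>S\<close> in a finite-dimensional space, where continuity of
  all iterated directional derivatives up to order \<open>k\<close> is the usual notion of class \<open>C\<^sup>k\<close>.\<close>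

primrec Ck_on :: "nat \<Rightarrow> 'e::euclidean_space set \<Rightarrow> ('e \<Rightarrow> 'b::real_normed_vector) \<Rightarrow> bool"
  where
    "Ck_on 0 S F \<longleftrightarrow> continuous_on S F"
  | "Ck_on (Suc k) S F \<longleftrightarrow> (\<forall>z\<in>S. F differentiable (at z)) \<and>
       (\<forall>v. Ck_on k S (\<lambda>z. frechet_derivative F (at z) v))"

definition smooth_on :: "'e::euclidean_space set \<Rightarrow> ('e \<Rightarrow> 'b::real_normed_vector) \<Rightarrow> bool"
  where "smooth_on S F \<longleftrightarrow> (\<forall>k. Ck_on k S F)"

subsection \<open>Manifolds\<close>

text \<open>A chart is its domain together with its coordinate map; values of the map outside the domain
  are irrelevant.\<close>

type_synonym ('a, 'e) chart = "'a set \<times> ('a \<Rightarrow> 'e)"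
type_synonym ('a, 'e) atlas = "('a, 'e) chart set"

abbreviation cinv :: "('a, 'e) chart \<Rightarrow> 'e \<Rightarrow> 'a"
  where "cinv c \<equiv> inv_into (fst c) (snd c)"

definition carrier :: "('a, 'e) atlas \<Rightarrow> 'a set"
  where "carrier A = (\<Union>c\<in>A. fst c)"

definition charts_at :: "('a, 'e) atlas \<Rightarrow> 'a \<Rightarrow> ('a, 'e) chart set"
  where "charts_at A x = {c \<in> A. x \<in> fst c}"

definition smooth_manifold :: "'a topology \<Rightarrow> ('a, 'e::euclidean_space) atlas \<Rightarrow> bool"
  where "smooth_manifold T A \<longleftrightarrow>
    Hausdorff_space T \<and> second_countable T \<and> topspace T = carrier A \<and>
    (\<forall>c\<in>A. openin T (fst c) \<and> open (snd c ` fst c) \<and>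
       homeomorphic_map (subtopology T (fst c)) (top_of_set (snd c ` fst c)) (snd c)) \<and>
    (\<forall>c\<in>A. \<forall>d\<in>A. smooth_on (snd c ` (fst c \<inter> fst d)) (snd d \<circ> cinv c))"

definition smooth_function :: "('a, 'e::euclidean_space) atlas \<Rightarrow> ('a \<Rightarrow> real) \<Rightarrow> bool"
  where "smooth_function A h \<longleftrightarrow> (\<forall>c\<in>A. smooth_on (snd c ` fst c) (h \<circ> cinv c))"

subsection \<open>Tangent vectors and vector fields\<close>

text \<open>A tangent vector at \<open>x\<close> is a family of component vectors, one for each chart around \<open>x\<close>,
  related by the Jacobians of the coordinate changes. It is \<open>0\<close> at all other charts, which makes
  equality of tangent vectors equality of functions.\<close>

type_synonym ('a, 'e) tvec = "('a, 'e) chart \<Rightarrow> 'e"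

definition tangent_space :: "('a, 'e::euclidean_space) atlas \<Rightarrow> 'a \<Rightarrow> ('a, 'e) tvec set"
  where "tangent_space A x =
    {v. (\<forall>c\<in>charts_at A x. \<forall>d\<in>charts_at A x.
           v d = frechet_derivative (snd d \<circ> cinv c) (at (snd c x)) (v c)) \<and>
        (\<forall>c. c \<notin> charts_at A x \<longrightarrow> v c = 0)}"

text \<open>\<open>coord_vec A c x w\<close> is the tangent vector at \<open>x\<close> with components \<open>w\<close> in the chart \<open>c\<close>; for
  \<open>w = i \<in> Basis\<close> this is the coordinate vector \<open>\<partial>/\<partial>x\<^sup>i\<close>.\<close>

definition coord_vec ::
    "('a, 'e::euclidean_space) atlas \<Rightarrow> ('a, 'e) chart \<Rightarrow> 'a \<Rightarrow> 'e \<Rightarrow> ('a, 'e) tvec"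
  where "coord_vec A c x w =
    (\<lambda>d. if d \<in> charts_at A x
         then frechet_derivative (snd d \<circ> cinv c) (at (snd c x)) w else 0)"

text \<open>The derivative \<open>v(h)\<close> of a function \<open>h\<close> along \<open>v \<in> T\<^sub>xM\<close>.\<close>

definition tderiv ::
    "('a, 'e::euclidean_space) atlas \<Rightarrow> ('a \<Rightarrow> real) \<Rightarrow> 'a \<Rightarrow> ('a, 'e) tvec \<Rightarrow> real"
  where "tderiv A h x v =
    (let c = (SOME c. c \<in> charts_at A x)
     in frechet_derivative (h \<circ> cinv c) (at (snd c x)) (v c))"

definition vector_fields :: "('a, 'e::euclidean_space) atlas \<Rightarrow> ('a \<Rightarrow> ('a, 'e) tvec) set"
  where "vector_fields A =
    {X. (\<forall>x\<in>carrier A. X x \<in> tangent_space A x) \<and> (\<forall>x. x \<notin> carrier A \<longrightarrow> X x = 0) \<and>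
        (\<forall>c\<in>A. smooth_on (snd c ` fst c) (\<lambda>z. X (cinv c z) c))}"

text \<open>In coordinates, \<open>[X,Y] = DY(X) - DX(Y)\<close>.\<close>

definition lie_bracket ::
    "('a, 'e::euclidean_space) atlas \<Rightarrow> ('a \<Rightarrow> ('a, 'e) tvec) \<Rightarrow> ('a \<Rightarrow> ('a, 'e) tvec)
      \<Rightarrow> 'a \<Rightarrow> ('a, 'e) tvec"
  where "lie_bracket A X Y x =
    (\<lambda>c. if c \<in> charts_at A x
         then frechet_derivative (\<lambda>z. Y (cinv c z) c) (at (snd c x)) (X x c)
            - frechet_derivative (\<lambda>z. X (cinv c z) c) (at (snd c x)) (Y x c)
         else 0)"

subsection \<open>Riemannian metrics and the Levi-Civita connection\<close>

type_synonym ('a, 'e) metric = "'a \<Rightarrow> ('a, 'e) tvec \<Rightarrow> ('a, 'e) tvec \<Rightarrow> real"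
type_synonym ('a, 'e) connection =
  "('a \<Rightarrow> ('a, 'e) tvec) \<Rightarrow> ('a \<Rightarrow> ('a, 'e) tvec) \<Rightarrow> 'a \<Rightarrow> ('a, 'e) tvec"

text \<open>The components \<open>g\<^sub>i\<^sub>j\<close> in the chart \<open>c\<close>, as functions of the coordinates.\<close>

definition metric_coeff ::
    "('a, 'e::euclidean_space) atlas \<Rightarrow> ('a, 'e) metric \<Rightarrow> ('a, 'e) chart
      \<Rightarrow> 'e \<Rightarrow> 'e \<Rightarrow> 'e \<Rightarrow> real"
  where "metric_coeff A g c i j z =
    g (cinv c z) (coord_vec A c (cinv c z) i) (coord_vec A c (cinv c z) j)"

definition riemannian_metric :: "('a, 'e::euclidean_space) atlas \<Rightarrow> ('a, 'e) metric \<Rightarrow> bool"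
  where "riemannian_metric A g \<longleftrightarrow>
    (\<forall>x\<in>carrier A. \<forall>u\<in>tangent_space A x. \<forall>v\<in>tangent_space A x. \<forall>w\<in>tangent_space A x. \<forall>r.
       g x u v = g x v u \<and> g x (u + v) w = g x u w + g x v w \<and> g x (r *\<^sub>R u) w = r * g x u w \<and>
       (u \<noteq> 0 \<longrightarrow> g x u u > 0)) \<and>
    (\<forall>c\<in>A. \<forall>i\<in>Basis. \<forall>j\<in>Basis. smooth_on (snd c ` fst c) (metric_coeff A g c i j))"

definition riemannian_manifold ::
    "'a topology \<Rightarrow> ('a, 'e::euclidean_space) atlas \<Rightarrow> ('a, 'e) metric \<Rightarrow> bool"
  where "riemannian_manifold T A g \<longleftrightarrow> smooth_manifold T A \<and> riemannian_metric A g"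

definition affine_connection :: "('a, 'e::euclidean_space) atlas \<Rightarrow> ('a, 'e) connection \<Rightarrow> bool"
  where "affine_connection A D \<longleftrightarrow>
    (\<forall>X\<in>vector_fields A. \<forall>Y\<in>vector_fields A. D X Y \<in> vector_fields A) \<and>
    (\<forall>X\<in>vector_fields A. \<forall>X'\<in>vector_fields A. \<forall>Y\<in>vector_fields A.
       D (X + X') Y = D X Y + D X' Y \<and> D Y (X + X') = D Y X + D Y X') \<and>
    (\<forall>h. smooth_function A h \<longrightarrow> (\<forall>X\<in>vector_fields A. \<forall>Y\<in>vector_fields A. \<forall>x\<in>carrier A.
       D (\<lambda>y. h y *\<^sub>R X y) Y x = h x *\<^sub>R D X Y x \<and>
       D X (\<lambda>y. h y *\<^sub>R Y y) x = tderiv A h x (X x) *\<^sub>R Y x + h x *\<^sub>R D X Y x))"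

definition levi_civita ::
    "('a, 'e::euclidean_space) atlas \<Rightarrow> ('a, 'e) metric \<Rightarrow> ('a, 'e) connection \<Rightarrow> bool"
  where "levi_civita A g D \<longleftrightarrow>
    affine_connection A D \<and>
    (\<forall>X\<in>vector_fields A. \<forall>Y\<in>vector_fields A. \<forall>x\<in>carrier A.
       D X Y x - D Y X x = lie_bracket A X Y x) \<and>
    (\<forall>X\<in>vector_fields A. \<forall>Y\<in>vector_fields A. \<forall>Z\<in>vector_fields A. \<forall>x\<in>carrier A.
       tderiv A (\<lambda>y. g y (Y y) (Z y)) x (X x) = g x (D X Y x) (Z x) + g x (Y x) (D X Z x))"

definition curvature ::
    "('a, 'e::euclidean_space) atlas \<Rightarrow> ('a, 'e) connection \<Rightarrow> ('a \<Rightarrow> ('a, 'e) tvec)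
      \<Rightarrow> ('a \<Rightarrow> ('a, 'e) tvec) \<Rightarrow> ('a \<Rightarrow> ('a, 'e) tvec) \<Rightarrow> 'a \<Rightarrow> ('a, 'e) tvec"
  where "curvature A D X Y Z = D X (D Y Z) - D Y (D X Z) - D (lie_bracket A X Y) Z"

text \<open>\<open>R\<^sub>x(a,b)c\<close> for tangent vectors at \<open>x\<close>: extend them to vector fields. By tensoriality of the
  curvature the value does not depend on the extensions.\<close>

definition curvature_at ::
    "('a, 'e::euclidean_space) atlas \<Rightarrow> ('a, 'e) connection \<Rightarrow> 'a
      \<Rightarrow> ('a, 'e) tvec \<Rightarrow> ('a, 'e) tvec \<Rightarrow> ('a, 'e) tvec \<Rightarrow> ('a, 'e) tvec"
  where "curvature_at A D x a b c =
    (THE r. \<exists>X\<in>vector_fields A. \<exists>Y\<in>vector_fields A. \<exists>Z\<in>vector_fields A.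
       X x = a \<and> Y x = b \<and> Z x = c \<and> r = curvature A D X Y Z x)"

definition gradient ::
    "('a, 'e::euclidean_space) atlas \<Rightarrow> ('a, 'e) metric \<Rightarrow> ('a \<Rightarrow> real) \<Rightarrow> 'a \<Rightarrow> ('a, 'e) tvec"
  where "gradient A g f x =
    (if x \<in> carrier A
     then THE v. v \<in> tangent_space A x \<and> (\<forall>w\<in>tangent_space A x. g x v w = tderiv A f x w)
     else 0)"

text \<open>Christoffel symbols \<open>\<Gamma>\<^sub>i\<^sub>j\<^sup>k\<close> of \<open>g\<close> in the chart \<open>c\<close>, as functions of the coordinates; indices
  are elements of \<open>Basis\<close>. Values of the inverse matrix outside \<open>Basis\<close> are irrelevant.\<close>

definition inverse_metric_coeff ::
    "('a, 'e::euclidean_space) atlas \<Rightarrow> ('a, 'e) metric \<Rightarrow> ('a, 'e) chart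
      \<Rightarrow> 'e \<Rightarrow> 'e \<Rightarrow> 'e \<Rightarrow> real"
  where "inverse_metric_coeff A g c k l z =
    (SOME h. \<forall>a\<in>Basis. \<forall>b\<in>Basis.
       (\<Sum>m\<in>Basis. h a m * metric_coeff A g c m b z) = (if a = b then 1 else 0)) k l"

definition christoffel ::
    "('a, 'e::euclidean_space) atlas \<Rightarrow> ('a, 'e) metric \<Rightarrow> ('a, 'e) chart
      \<Rightarrow> 'e \<Rightarrow> 'e \<Rightarrow> 'e \<Rightarrow> 'e \<Rightarrow> real"
  where "christoffel A g c i j k z =
    (\<Sum>l\<in>Basis. 1/2 * inverse_metric_coeff A g c k l z *
       (frechet_derivative (metric_coeff A g c j l) (at z) i
      + frechet_derivative (metric_coeff A g c i l) (at z) j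
      - frechet_derivative (metric_coeff A g c i j) (at z) l))"

subsection \<open>The tangent bundle\<close>

text \<open>Points of \<open>TM\<close> are pairs \<open>(x, u)\<close> with \<open>u \<in> T\<^sub>xM\<close>; a chart \<open>(x\<^sup>i)\<close> of \<open>M\<close> induces the chart
  \<open>(x\<^sup>i, y\<^sup>i)\<close>. The map \<open>tangent_chart A\<close> is injective, so a tangent vector of \<open>TM\<close> may be described by
  prescribing its components in the induced chart of each chart of \<open>M\<close>.\<close>

definition tangent_chart ::
    "('a, 'e::euclidean_space) atlas \<Rightarrow> ('a, 'e) chart \<Rightarrow> ('a \<times> ('a, 'e) tvec, 'e \<times> 'e) chart"
  where "tangent_chart A c =
    ({(x, u). x \<in> fst c \<and> u \<in> tangent_space A x}, \<lambda>(x, u). (snd c x, u c))"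

definition tangent_atlas ::
    "('a, 'e::euclidean_space) atlas \<Rightarrow> ('a \<times> ('a, 'e) tvec, 'e \<times> 'e) atlas"
  where "tangent_atlas A = tangent_chart A ` A"

text \<open>Lifts to \<open>T\<^sub>pTM\<close>, \<open>p = (x, u)\<close>, of a tangent vector \<open>v \<in> T\<^sub>xM\<close>.\<close>

definition vlift ::
    "('a, 'e::euclidean_space) atlas \<Rightarrow> 'a \<times> ('a, 'e) tvec \<Rightarrow> ('a, 'e) tvec
      \<Rightarrow> ('a \<times> ('a, 'e) tvec, 'e \<times> 'e) tvec"
  where "vlift A p v =
    (THE \<xi>. \<xi> \<in> tangent_space (tangent_atlas A) p \<and>
       (\<forall>c\<in>charts_at A (fst p). \<xi> (tangent_chart A c) = (0, v c)))"

definition hlift ::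
    "('a, 'e::euclidean_space) atlas \<Rightarrow> ('a, 'e) metric \<Rightarrow> 'a \<times> ('a, 'e) tvec \<Rightarrow> ('a, 'e) tvec
      \<Rightarrow> ('a \<times> ('a, 'e) tvec, 'e \<times> 'e) tvec"
  where "hlift A g p v =
    (THE \<xi>. \<xi> \<in> tangent_space (tangent_atlas A) p \<and>
       (\<forall>c\<in>charts_at A (fst p). \<xi> (tangent_chart A c) =
          (v c, - (\<Sum>i\<in>Basis. \<Sum>j\<in>Basis. \<Sum>k\<in>Basis.
             ((v c \<bullet> i) * (snd p c \<bullet> j) * christoffel A g c i j k (snd c (fst p))) *\<^sub>R k))))"

definition vlift_field ::
    "('a, 'e::euclidean_space) atlas \<Rightarrow> ('a \<Rightarrow> ('a, 'e) tvec)
      \<Rightarrow> 'a \<times> ('a, 'e) tvec \<Rightarrow> ('a \<times> ('a, 'e) tvec, 'e \<times> 'e) tvec"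
  where "vlift_field A X p = (if p \<in> carrier (tangent_atlas A) then vlift A p (X (fst p)) else 0)"

definition hlift_field ::
    "('a, 'e::euclidean_space) atlas \<Rightarrow> ('a, 'e) metric \<Rightarrow> ('a \<Rightarrow> ('a, 'e) tvec)
      \<Rightarrow> 'a \<times> ('a, 'e) tvec \<Rightarrow> ('a \<times> ('a, 'e) tvec, 'e \<times> 'e) tvec"
  where "hlift_field A g X p =
    (if p \<in> carrier (tangent_atlas A) then hlift A g p (X (fst p)) else 0)"

text \<open>Vertical and horizontal lifts span each \<open>T\<^sub>pTM\<close>, so on \<open>TM\<close> this determines \<open>G\<close> uniquely.\<close>

definition mus_gradient_metric ::
    "('a, 'e::euclidean_space) atlas \<Rightarrow> ('a, 'e) metric \<Rightarrow> ('a \<Rightarrow> real)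
      \<Rightarrow> ('a \<times> ('a, 'e) tvec, 'e \<times> 'e) metric \<Rightarrow> bool"
  where "mus_gradient_metric A g f G \<longleftrightarrow>
    riemannian_metric (tangent_atlas A) G \<and>
    (\<forall>X\<in>vector_fields A. \<forall>Y\<in>vector_fields A. \<forall>(x, u)\<in>carrier (tangent_atlas A).
       G (x, u) (hlift_field A g X (x, u)) (hlift_field A g Y (x, u)) = g x (X x) (Y x) \<and>
       G (x, u) (hlift_field A g X (x, u)) (vlift_field A Y (x, u)) = 0 \<and>
       G (x, u) (vlift_field A X (x, u)) (vlift_field A Y (x, u)) =
         g x (X x) (Y x) + tderiv A f x (X x) * tderiv A f x (Y x))"

end

theory Submission
  imports Defs
begin

text \<open>Fix a point \<open>p = (x, u)\<close> of the tangent bundle. Every tangent vector of \<open>TM\<close> at \<open>p\<close> is the sum of a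
  horizontal and a vertical lift, and every tangent vector at \<open>x\<close> extends to a vector field, so
  \<open>\<nabla>\<^sup>f\<close> is known at \<open>p\<close> once its products with \<open>Z\<^sup>H\<close> and \<open>Z\<^sup>V\<close> are known for all vector fields \<open>Z\<close> on
  \<open>M\<close> (\<open>bundle_vector_eqI\<close>). These products are given by the Koszul formula (\<open>koszul\<close>), into
  which two computations enter.

  The first is the bracket of lifts: \<open>[X\<^sup>H, Y\<^sup>H] = [X, Y]\<^sup>H - (R(X, Y)u)\<^sup>V\<close>,
  \<open>[X\<^sup>H, Y\<^sup>V] = (\<nabla>\<^sub>X Y)\<^sup>V\<close> and \<open>[X\<^sup>V, Y\<^sup>V] = 0\<close> (\<open>lie_bracket_lifts\<close>). The second is the derivative
  of the products of lifts under \<open>g\<^sup>f\<close>. They are functions on the base, which vertical lifts annihilate and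
  on which \<open>X\<^sup>H\<close> acts as \<open>X\<close> (\<open>tderiv_gf_lifts\<close>). For two vertical lifts the extra
  term \<open>Y(f) Z(f)\<close> brings in the Hessian \<open>g(\<nabla>\<^sub>X grad f, Y)\<close>, because
  \<open>X(Y f) = g(\<nabla>\<^sub>X grad f, Y) + (\<nabla>\<^sub>X Y) f\<close>. Two symmetries turn the results into the stated form:
  \<open>g(R(X, Z)u, Y) = g(R(u, Y)X, Z)\<close>, and the symmetry of the Hessian. The scalar \<open>\<alpha>\<close> appears because the
  vertical part is determined through \<open>g + df \<otimes> df\<close>, and \<open>(g + df \<otimes> df)(grad f, Z) = \<alpha> Z(f)\<close>.

  The rest makes these computations available. A connection acts on global vector
  fields only. Testing it against extensions of single tangent vectors shows that in a chart
  \<open>\<nabla>\<^sub>X Y\<close> is \<open>DY(X) + \<Gamma>(X, Y)\<close> (\<open>D_chart\<close>). This yields the transformation law of \<open>\<Gamma>\<close>, hence the existence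
  of horizontal lifts, and a coordinate expression for the curvature, hence its
  tensoriality and its symmetries. That \<open>\<Gamma>\<close> and \<open>grad f\<close> are smooth is a statement about linear systems
  with smooth positive definite coefficients (\<open>smooth_positive_definite_solution\<close>).\<close>

section \<open>Smooth maps\<close>

abbreviation FD :: "('e::euclidean_space \<Rightarrow> 'b::real_normed_vector) \<Rightarrow> 'e \<Rightarrow> 'e \<Rightarrow> 'b"
  where "FD F z \<equiv> frechet_derivative F (at z)"

lemma FD_eqI: "(F has_derivative F') (at z) \<Longrightarrow> FD F z = F'"
  by (metis frechet_derivative_at)

lemma has_FD: "F differentiable (at z) \<Longrightarrow> (F has_derivative FD F z) (at z)"
  by (simp add: frechet_derivative_works)

lemma FD_cong:
  assumes "open S" "z \<in> S" "\<And>y. y \<in> S \<Longrightarrow> F y = G y"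
  shows "FD F z = FD G z"
proof -
  have "(F has_derivative F') (at z) \<longleftrightarrow> (G has_derivative F') (at z)" for F'
    using assms by (metis has_derivative_transform_within_open)
  then show ?thesis by (simp add: frechet_derivative_def)
qed

lemma differentiable_cong_open:
  assumes "open S" "z \<in> S" "\<And>y. y \<in> S \<Longrightarrow> F y = G y" "F differentiable (at z)"
  shows "G differentiable (at z)"
  using assms by (metis differentiable_def has_derivative_transform_within_open)

lemma FD_expand:
  assumes "F differentiable (at z)"
  shows "FD F z v = (\<Sum>i\<in>Basis. (v \<bullet> i) *\<^sub>R FD F z i)"
proof -
  interpret linear "FD F z" using assms by (rule linear_frechet_derivative)
  have "FD F z v = FD F z (\<Sum>i\<in>Basis. (v \<bullet> i) *\<^sub>R i)" by (simp add: euclidean_representation)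
  also have "\<dots> = (\<Sum>i\<in>Basis. (v \<bullet> i) *\<^sub>R FD F z i)" by (simp add: sum scale)
  finally show ?thesis .
qed

lemma Ck_on_cong:
  assumes "open S" "\<And>z. z \<in> S \<Longrightarrow> F z = G z" "Ck_on k S F"
  shows "Ck_on k S G"
  using assms(2,3)
proof (induction k arbitrary: F G)
  case 0
  then show ?case by (simp cong: continuous_on_cong)
next
  case (Suc k)
  have "Ck_on k S (\<lambda>z. FD G z v)" for v
    by (rule Suc.IH[of "\<lambda>z. FD F z v"]) (use Suc.prems FD_cong[OF assms(1)] in \<open>auto, metis\<close>)
  then show ?case
    using Suc.prems differentiable_cong_open[OF assms(1), of _ F G] by auto
qed

lemma Ck_on_Suc_imp: "Ck_on (Suc k) S F \<Longrightarrow> Ck_on k S F"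
proof (induction k arbitrary: F)
  case 0
  then show ?case
    by (simp add: continuous_at_imp_continuous_on differentiable_imp_continuous_within)
next
  case (Suc k)
  then show ?case by (metis Ck_on.simps(2))
qed

lemma Ck_on_local:
  assumes "\<And>z. z \<in> S \<Longrightarrow> \<exists>U. open U \<and> z \<in> U \<and> Ck_on k U F"
  shows "Ck_on k S F"
  using assms
proof (induction k arbitrary: F)
  case 0
  then show ?case
    by (metis Ck_on.simps(1) continuous_at_imp_continuous_on continuous_on_eq_continuous_at)
next
  case (Suc k)
  then show ?case by (fastforce simp: Ck_on.simps)
qed

lemma Ck_on_const: "Ck_on k S (\<lambda>z. c)"
  by (induction k arbitrary: c) auto

lemma Ck_on_linear_image:
  assumes L: "bounded_linear L" and "open S"
  shows "Ck_on k S F \<Longrightarrow> Ck_on k S (\<lambda>z. L (F z))"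
proof (induction k arbitrary: F)
  case 0
  then show ?case by (simp add: bounded_linear.continuous_on[OF L])
next
  case (Suc k)
  have d: "((\<lambda>z. L (F z)) has_derivative (\<lambda>v. L (FD F z v))) (at z)" if "z \<in> S" for z
    using Suc.prems that by (intro bounded_linear.has_derivative[OF L] has_FD) simp
  have "Ck_on k S (\<lambda>z. FD (\<lambda>z. L (F z)) z v)" for v
    by (rule Ck_on_cong[OF assms(2) _ Suc.IH[of "\<lambda>z. FD F z v"]])
       (use Suc.prems FD_eqI[OF d] in auto)
  with d show ?case by (auto simp: differentiable_def)
qed

lemma Ck_on_add:
  assumes "open S"
  shows "Ck_on k S F \<Longrightarrow> Ck_on k S G \<Longrightarrow> Ck_on k S (\<lambda>z. F z + G z)"
proof (induction k arbitrary: F G)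
  case 0
  then show ?case by (simp add: continuous_on_add)
next
  case (Suc k)
  have d: "((\<lambda>z. F z + G z) has_derivative (\<lambda>v. FD F z v + FD G z v)) (at z)" if "z \<in> S" for z
    using Suc.prems that by (intro has_derivative_add has_FD) simp_all
  have "Ck_on k S (\<lambda>z. FD (\<lambda>z. F z + G z) z v)" for v
    by (rule Ck_on_cong[OF assms _ Suc.IH[of "\<lambda>z. FD F z v" "\<lambda>z. FD G z v"]])
       (use Suc.prems FD_eqI[OF d] in auto)
  with d show ?case by (auto simp: differentiable_def)
qed

lemma Ck_on_sum:
  assumes "open S" "finite I" "\<And>i. i \<in> I \<Longrightarrow> Ck_on k S (F i)"
  shows "Ck_on k S (\<lambda>z. \<Sum>i\<in>I. F i z)"
  using assms(2,3)
  by (induction I rule: finite_induct) (auto simp: Ck_on_const intro!: Ck_on_add[OF assms(1)])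

lemma Ck_on_bilinear:
  assumes B: "bounded_bilinear B" and "open S"
  shows "Ck_on k S F \<Longrightarrow> Ck_on k S G \<Longrightarrow> Ck_on k S (\<lambda>z. B (F z) (G z))"
proof (induction k arbitrary: F G)
  case 0
  then show ?case by (simp add: bounded_bilinear.continuous_on[OF B])
next
  case (Suc k)
  have d: "((\<lambda>z. B (F z) (G z)) has_derivative (\<lambda>v. B (F z) (FD G z v) + B (FD F z v) (G z))) (at z)"
    if "z \<in> S" for z
    using Suc.prems that by (intro bounded_bilinear.FDERIV[OF B] has_FD) simp_all
  have "Ck_on k S (\<lambda>z. FD (\<lambda>z. B (F z) (G z)) z v)" for v
    by (rule Ck_on_cong[OF assms(2) _ Ck_on_add[OF assms(2) Suc.IH[of F "\<lambda>z. FD G z v"]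
            Suc.IH[of "\<lambda>z. FD F z v" G]]])
       (use Suc.prems FD_eqI[OF d] Ck_on_Suc_imp in auto)
  with d show ?case by (auto simp: differentiable_def)
qed

text \<open>By the chain rule the derivative of \<open>F \<circ> G\<close> is a sum of products of components of \<open>DG\<close> with \<open>D\<^sub>iF \<circ> G\<close>;
  the latter are compositions again, of one order less, so the induction runs over all \<open>F\<close> at once.\<close>

lemma Ck_on_compose:
  fixes F :: "'d::euclidean_space \<Rightarrow> 'b::real_normed_vector" and G :: "'e::euclidean_space \<Rightarrow> 'd"
  assumes "open S" "open U"
  shows "Ck_on k U F \<Longrightarrow> Ck_on k S G \<Longrightarrow> G ` S \<subseteq> U \<Longrightarrow> Ck_on k S (\<lambda>z. F (G z))"
proof (induction k arbitrary: F)
  case 0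
  then show ?case by (simp add: continuous_on_compose2)
next
  case (Suc k)
  have dF: "F differentiable (at (G z))" if "z \<in> S" for z
    using Suc.prems that by auto
  have d: "((\<lambda>z. F (G z)) has_derivative (\<lambda>v. FD F (G z) (FD G z v))) (at z)" if "z \<in> S" for z
    using diff_chain_at[OF has_FD has_FD, of G z F] Suc.prems that by (auto simp: o_def)
  have "Ck_on k S (\<lambda>z. FD (\<lambda>z. F (G z)) z v)" for v
  proof (rule Ck_on_cong[OF assms(1)])
    show "Ck_on k S (\<lambda>z. \<Sum>i\<in>Basis. (FD G z v \<bullet> i) *\<^sub>R FD F (G z) i)"
    proof (intro Ck_on_sum Ck_on_bilinear[OF bounded_bilinear_scaleR] assms(1) finite_Basis)
      fix i :: 'd
      show "Ck_on k S (\<lambda>z. FD G z v \<bullet> i)"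
        using Ck_on_linear_image[OF bounded_linear_inner_left assms(1), of k "\<lambda>z. FD G z v" i] Suc.prems
        by auto
      show "Ck_on k S (\<lambda>z. FD F (G z) i)"
        using Suc.IH[of "\<lambda>y. FD F y i"] Suc.prems(1,3) Ck_on_Suc_imp[OF Suc.prems(2)] by auto
    qed
    show "(\<Sum>i\<in>Basis. (FD G z v \<bullet> i) *\<^sub>R FD F (G z) i) = FD (\<lambda>z. F (G z)) z v" if "z \<in> S" for z
      using FD_expand[OF dF[OF that], of "FD G z v"] FD_eqI[OF d[OF that]] by simp
  qed
  with d show ?case by (auto simp: differentiable_def)
qed

lemma Ck_on_bounded_linear: "bounded_linear L \<Longrightarrow> Ck_on k S L"
  for L :: "'e::euclidean_space \<Rightarrow> 'b::real_normed_vector"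
proof (cases k)
  case 0
  then show "bounded_linear L \<Longrightarrow> ?thesis" by (simp add: linear_continuous_on)
next
  case (Suc m)
  assume L: "bounded_linear L"
  have "FD L z = L" for z using bounded_linear_imp_has_derivative[OF L] by (rule FD_eqI)
  then show ?thesis
    using Suc L by (auto simp: Ck_on_const differentiable_def dest: bounded_linear_imp_has_derivative)
qed

lemma smooth_on_differentiable: "smooth_on S F \<Longrightarrow> z \<in> S \<Longrightarrow> F differentiable (at z)"
  unfolding smooth_on_def by (metis Ck_on.simps(2))

lemma smooth_on_FD: "smooth_on S F \<Longrightarrow> smooth_on S (\<lambda>z. FD F z v)"
  unfolding smooth_on_def by (metis Ck_on.simps(2))

lemma smooth_on_continuous: "smooth_on S F \<Longrightarrow> continuous_on S F"
  unfolding smooth_on_def by (metis Ck_on.simps(1))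

lemma smooth_on_cong:
  "open S \<Longrightarrow> smooth_on S F \<Longrightarrow> (\<And>z. z \<in> S \<Longrightarrow> F z = G z) \<Longrightarrow> smooth_on S G"
  unfolding smooth_on_def using Ck_on_cong by blast

lemma smooth_on_local:
  assumes "\<And>z. z \<in> S \<Longrightarrow> \<exists>U. open U \<and> z \<in> U \<and> smooth_on U F"
  shows "smooth_on S F"
  unfolding smooth_on_def by (meson Ck_on_local assms smooth_on_def)

lemma smooth_on_const: "smooth_on S (\<lambda>z. c)"
  by (simp add: smooth_on_def Ck_on_const)

lemma smooth_on_linear_image:
  "bounded_linear L \<Longrightarrow> open S \<Longrightarrow> smooth_on S F \<Longrightarrow> smooth_on S (\<lambda>z. L (F z))"
  by (simp add: smooth_on_def Ck_on_linear_image)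

lemma smooth_on_add:
  "open S \<Longrightarrow> smooth_on S F \<Longrightarrow> smooth_on S G \<Longrightarrow> smooth_on S (\<lambda>z. F z + G z)"
  by (simp add: smooth_on_def Ck_on_add)

lemma smooth_on_minus: "open S \<Longrightarrow> smooth_on S F \<Longrightarrow> smooth_on S (\<lambda>z. - F z)"
  by (rule smooth_on_linear_image[OF bounded_linear_minus[OF bounded_linear_ident]])

lemma smooth_on_diff:
  "open S \<Longrightarrow> smooth_on S F \<Longrightarrow> smooth_on S G \<Longrightarrow> smooth_on S (\<lambda>z. F z - G z)"
  using smooth_on_add[of S F "\<lambda>z. - G z"] smooth_on_minus[of S G] by simp

lemma smooth_on_sum:
  "open S \<Longrightarrow> (\<And>i. i \<in> I \<Longrightarrow> smooth_on S (F i)) \<Longrightarrow> smooth_on S (\<lambda>z. \<Sum>i\<in>I. F i z)"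
  by (cases "finite I") (simp_all add: smooth_on_def Ck_on_sum Ck_on_const)

lemma smooth_on_scaleR:
  "open S \<Longrightarrow> smooth_on S F \<Longrightarrow> smooth_on S G \<Longrightarrow> smooth_on S (\<lambda>z. F z *\<^sub>R G z)"
  by (simp add: smooth_on_def Ck_on_bilinear[OF bounded_bilinear_scaleR])

lemma smooth_on_mult:
  "open S \<Longrightarrow> smooth_on S F \<Longrightarrow> smooth_on S G \<Longrightarrow> smooth_on S (\<lambda>z. F z * G z :: real)"
  by (simp add: smooth_on_def Ck_on_bilinear[OF bounded_bilinear_mult])

lemma smooth_on_inner:
  "open S \<Longrightarrow> smooth_on S F \<Longrightarrow> smooth_on S G \<Longrightarrow> smooth_on S (\<lambda>z. F z \<bullet> G z)"
  by (simp add: smooth_on_def Ck_on_bilinear[OF bounded_bilinear_inner])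

lemma smooth_on_compose:
  "open S \<Longrightarrow> open U \<Longrightarrow> smooth_on U F \<Longrightarrow> smooth_on S G \<Longrightarrow> G ` S \<subseteq> U \<Longrightarrow> smooth_on S (\<lambda>z. F (G z))"
  for F :: "'d::euclidean_space \<Rightarrow> 'b::real_normed_vector"
  by (simp add: smooth_on_def Ck_on_compose)

lemma smooth_on_bounded_linear: "bounded_linear L \<Longrightarrow> smooth_on S L"
  for L :: "'e::euclidean_space \<Rightarrow> 'b::real_normed_vector"
  by (simp add: smooth_on_def Ck_on_bounded_linear)

lemma smooth_on_Pair:
  fixes F :: "'e::euclidean_space \<Rightarrow> 'b::real_normed_vector" and G :: "'e \<Rightarrow> 'c::real_normed_vector"
  assumes "open S" "smooth_on S F" "smooth_on S G"
  shows "smooth_on S (\<lambda>z. (F z, G z))"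
proof -
  have L: "bounded_linear (\<lambda>a. (a, 0) :: 'b \<times> 'c)" "bounded_linear (\<lambda>a. (0, a) :: 'b \<times> 'c)"
    by (auto intro!: bounded_linear_Pair bounded_linear_ident bounded_linear_zero)
  show ?thesis
    using smooth_on_add[OF assms(1) smooth_on_linear_image[OF L(1) assms(1,2)]
        smooth_on_linear_image[OF L(2) assms(1,3)]] by simp
qed

lemma smooth_on_FD_apply:
  assumes "open S" "smooth_on S F" "smooth_on S V"
  shows "smooth_on S (\<lambda>z. FD F z (V z))"
proof (rule smooth_on_cong[OF assms(1)])
  show "smooth_on S (\<lambda>z. \<Sum>i\<in>Basis. (V z \<bullet> i) *\<^sub>R FD F z i)"
    by (intro smooth_on_sum smooth_on_scaleR smooth_on_inner smooth_on_FD smooth_on_const assms)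
  show "(\<Sum>i\<in>Basis. (V z \<bullet> i) *\<^sub>R FD F z i) = FD F z (V z)" if "z \<in> S" for z
    using FD_expand[OF smooth_on_differentiable[OF assms(2) that], of "V z"] by simp
qed

text \<open>The derivative of \<open>1/F\<close> is a polynomial in \<open>1/F\<close> and \<open>DF\<close>, so that the order of
  differentiability of \<open>1/F\<close> can be raised one by one.\<close>

lemma smooth_on_inverse:
  fixes F :: "'e::euclidean_space \<Rightarrow> real"
  assumes "open S" "smooth_on S F" "\<And>z. z \<in> S \<Longrightarrow> F z \<noteq> 0"
  shows "smooth_on S (\<lambda>z. inverse (F z))"
proof -
  have d: "((\<lambda>z. inverse (F z)) has_derivative (\<lambda>v. - (inverse (F z) * FD F z v * inverse (F z)))) (at z)"
    if "z \<in> S" for z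
    by (intro Deriv.has_derivative_inverse has_FD smooth_on_differentiable[OF assms(2)] that assms(3))
  have "Ck_on k S (\<lambda>z. inverse (F z))" for k
  proof (induction k)
    case 0
    then show ?case
      using assms smooth_on_continuous by (auto intro!: continuous_on_inverse)
  next
    case (Suc k)
    have "Ck_on k S (\<lambda>z. FD (\<lambda>z. inverse (F z)) z v)" for v
    proof (rule Ck_on_cong[OF assms(1)])
      show "Ck_on k S (\<lambda>z. - (inverse (F z) * FD F z v * inverse (F z)))"
        using smooth_on_FD[OF assms(2), of v]
        by (intro Ck_on_linear_image[OF bounded_linear_minus[OF bounded_linear_ident]]
            Ck_on_bilinear[OF bounded_bilinear_mult] assms(1) Suc) (auto simp: smooth_on_def)
    qed (use FD_eqI[OF d] in simp)
    with d show ?case by (auto simp: differentiable_def)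
  qed
  then show ?thesis by (simp add: smooth_on_def)
qed

section \<open>Bump functions\<close>

text \<open>The functions \<open>t\<^sup>-\<^sup>n exp (-1/t)\<close>, continued by \<open>0\<close> to \<open>t \<le> 0\<close>. The one that matters is \<open>n = 0\<close>;
  its derivatives are linear combinations of functions of the same family, which makes smoothness an easy
  induction over the whole family.\<close>

definition flat :: "nat \<Rightarrow> real \<Rightarrow> real"
  where "flat n t = (if t > 0 then (1/t) ^ n * exp (- (1/t)) else 0)"

lemma has_derivative_flat:
  "(flat n has_derivative (\<lambda>v. v * (flat (n+2) t - real n * flat (n+1) t))) (at t)"
proof -
  consider "t > 0" | "t < 0" | "t = 0" by linarith
  then have "(flat n has_real_derivative (flat (n+2) t - real n * flat (n+1) t)) (at t)"
  proof cases
    case 1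
    have "((\<lambda>t. (1/t) ^ n * exp (- (1/t))) has_real_derivative
        (flat (n+2) t - real n * flat (n+1) t)) (at t)"
    proof (cases n)
      case (Suc m)
      have "((\<lambda>t. 1/t) has_real_derivative - (1/t)\<^sup>2) (at t)"
        using 1 by (auto intro!: derivative_eq_intros simp: power2_eq_square)
      note * = DERIV_mult[OF DERIV_power_Suc[OF this, of m] DERIV_fun_exp[OF DERIV_minus[OF this]]]
      show ?thesis unfolding Suc
        by (rule DERIV_cong[OF *])
           (use 1 in \<open>auto simp: flat_def power2_eq_square algebra_simps\<close>)
    qed (use 1 in \<open>auto intro!: derivative_eq_intros simp: flat_def field_simps power2_eq_square\<close>)
    then show ?thesis
      by (rule has_field_derivative_transform_within_open[of _ _ _ "{0<..}"])
         (use 1 in \<open>auto simp: flat_def\<close>)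
  next
    case 2
    have "((\<lambda>t. 0) has_real_derivative (flat (n+2) t - real n * flat (n+1) t)) (at t)"
      using 2 by (simp add: flat_def)
    then show ?thesis
      by (rule has_field_derivative_transform_within_open[of _ _ _ "{..<0}"])
         (use 2 in \<open>auto simp: flat_def\<close>)
  next
    case 3
    have L: "((\<lambda>s::real. s ^ (n+1) / exp s) \<longlongrightarrow> 0) at_top"
      by (rule tendsto_power_div_exp_0)
    have r: "((\<lambda>h. (flat n (0 + h) - flat n 0) / h) \<longlongrightarrow> 0) (at_right 0)"
    proof (rule Lim_transform_eventually)
      show "((\<lambda>h. (inverse h) ^ (n+1) / exp (inverse h)) \<longlongrightarrow> (0::real)) (at_right 0)"
        by (rule filterlim_compose[OF L filterlim_inverse_at_top_right])
      show "\<forall>\<^sub>F h in at_right 0. inverse h ^ (n+1) / exp (inverse h) = (flat n (0 + h) - flat n 0) / h"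
        using eventually_at_right_less[of "0::real"]
        by eventually_elim (simp add: flat_def field_simps exp_minus)
    qed
    have l: "((\<lambda>h. (flat n (0 + h) - flat n 0) / h) \<longlongrightarrow> 0) (at_left 0)"
    proof (rule Lim_transform_eventually)
      show "((\<lambda>h. 0) \<longlongrightarrow> (0::real)) (at_left 0)" by simp
      show "\<forall>\<^sub>F h in at_left 0. 0 = (flat n (0 + h) - flat n 0) / h"
        using eventually_at_left_real[of "-1" 0, simplified]
        by eventually_elim (simp add: flat_def)
    qed
    show ?thesis
      unfolding DERIV_def using 3 filterlim_split_at_real[OF l r] by (simp add: flat_def)
  qed
  then show ?thesis by (simp add: has_field_derivative_def mult_commute_abs mult.commute)
qed

lemma smooth_flat: "smooth_on UNIV (flat n)"
proof -
  have "Ck_on k UNIV (flat n)" for k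
  proof (induction k arbitrary: n)
    case 0
    then show ?case
      by (auto intro!: continuous_at_imp_continuous_on has_derivative_continuous[OF has_derivative_flat])
  next
    case (Suc k)
    have "Ck_on k UNIV (\<lambda>t. v * (flat (n+2) t + (- real n) * flat (n+1) t))" for v
      by (intro Ck_on_bilinear[OF bounded_bilinear_mult] Ck_on_add Ck_on_const Suc open_UNIV)
    moreover have "FD (flat n) t v = v * (flat (n+2) t + (- real n) * flat (n+1) t)" for t v
      by (simp add: FD_eqI[OF has_derivative_flat])
    moreover have "flat n differentiable (at t)" for t
      using has_derivative_flat by (rule differentiableI)
    ultimately show ?case by simp
  qed
  then show ?thesis by (simp add: smooth_on_def)
qed

definition bump :: "'e::euclidean_space \<Rightarrow> real \<Rightarrow> 'e \<Rightarrow> real"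
  where "bump a r z = flat 0 (r\<^sup>2 - (z - a) \<bullet> (z - a))"

lemma smooth_bump: "open S \<Longrightarrow> smooth_on S (bump a r)"
proof -
  assume S: "open S"
  have "smooth_on S (\<lambda>z. z - a)"
    by (rule smooth_on_diff[OF S smooth_on_bounded_linear[OF bounded_linear_ident] smooth_on_const])
  then have "smooth_on S (\<lambda>z. r\<^sup>2 - (z - a) \<bullet> (z - a))"
    by (intro smooth_on_diff[OF S smooth_on_const] smooth_on_inner[OF S])
  from smooth_on_compose[OF S open_UNIV smooth_flat[of 0] this] show ?thesis
    unfolding bump_def by simp
qed

lemma bump_centre: "r > 0 \<Longrightarrow> bump a r a > 0"
  by (simp add: bump_def flat_def)

lemma bump_outside:
  assumes "r > 0" "z \<notin> cball a r"
  shows "bump a r z = 0"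
proof -
  have "r \<le> norm (z - a)" using assms by (simp add: dist_norm norm_minus_commute)
  then have "r\<^sup>2 \<le> (z - a) \<bullet> (z - a)"
    using assms by (simp add: power2_norm_eq_inner[symmetric] power_mono)
  then show ?thesis by (simp add: bump_def flat_def)
qed

section \<open>Symmetry of second derivatives\<close>

text \<open>By the mean value theorem, applied twice, the second difference quotient of \<open>F\<close> in the
  directions \<open>a\<close> and \<open>b\<close> is a value of either mixed derivative at a point close to \<open>z\<close>. The mixed
  derivatives are continuous, so they agree at \<open>z\<close>.\<close>

lemma symmetric_second_derivative_real:
  fixes F :: "'e::euclidean_space \<Rightarrow> real"
  assumes "open S" "smooth_on S F" "z \<in> S"
  shows "FD (\<lambda>y. FD F y a) z b = FD (\<lambda>y. FD F y b) z a"
proof -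
  define C where "C = (\<lambda>a b y. FD (\<lambda>y. FD F y a) y b)"
  have contC: "continuous (at z) (C a b)" for a b
    using smooth_on_continuous[OF smooth_on_FD[OF smooth_on_FD[OF assms(2)]]] assms
    by (simp add: C_def continuous_on_eq_continuous_at)
  obtain r where r: "r > 0" "ball z r \<subseteq> S" using assms openE by blast
  define N where "N = norm a + norm b + 1"
  have N: "N > 0" by (simp add: N_def add_nonneg_pos)
  define \<Delta> where "\<Delta> = (\<lambda>t a b. F (z + t *\<^sub>R a + t *\<^sub>R b) - F (z + t *\<^sub>R a) - F (z + t *\<^sub>R b) + F z)"
  have inS: "z + s *\<^sub>R a' + s' *\<^sub>R b' \<in> S \<and> dist (z + s *\<^sub>R a' + s' *\<^sub>R b') z \<le> t * N"
    if "0 \<le> s" "s \<le> t" "0 \<le> s'" "s' \<le> t" "t * N < r" "norm a' + norm b' \<le> norm a + norm b"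
    for s s' t and a' b' :: 'e
  proof -
    have "norm (s *\<^sub>R a' + s' *\<^sub>R b') \<le> s * norm a' + s' * norm b'"
      using norm_triangle_ineq[of "s *\<^sub>R a'" "s' *\<^sub>R b'"] that by simp
    also have "\<dots> \<le> t * norm a' + t * norm b'"
      using that by (intro add_mono mult_right_mono) auto
    also have "\<dots> = t * (norm a' + norm b')" by (simp add: algebra_simps)
    also have "\<dots> \<le> t * N" unfolding N_def using that by (intro mult_left_mono) auto
    finally have *: "norm (s *\<^sub>R a' + s' *\<^sub>R b') \<le> t * N" .
    then have "dist (z + s *\<^sub>R a' + s' *\<^sub>R b') z \<le> t * N" by (simp add: dist_norm add.assoc)
    moreover from this have "z + s *\<^sub>R a' + s' *\<^sub>R b' \<in> ball z r"
      using that by (simp add: dist_commute)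
    ultimately show ?thesis using r by blast
  qed
  have key: "\<exists>p. dist p z \<le> t * N \<and> \<Delta> t a' b' = t\<^sup>2 * C a' b' p"
    if t: "t > 0" "t * N < r" and nab: "norm a' + norm b' \<le> norm a + norm b" for t and a' b' :: 'e
  proof -
    have dF: "(F has_derivative FD F y) (at y)" if "y \<in> S" for y
      using smooth_on_differentiable[OF assms(2) that] by (rule has_FD)
    have dF2: "((\<lambda>y. FD F y a') has_derivative FD (\<lambda>y. FD F y a') y) (at y)" if "y \<in> S" for y
      using smooth_on_differentiable[OF smooth_on_FD[OF assms(2)] that] by (rule has_FD)
    have lin: "FD F y (h *\<^sub>R v) = h * FD F y v" if "y \<in> S" for y h v
      using linear_frechet_derivative[OF smooth_on_differentiable[OF assms(2) that]]
      by (simp add: linear_scale)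
    have lin2: "FD (\<lambda>y. FD F y a') y (h *\<^sub>R v) = h * FD (\<lambda>y. FD F y a') y v" if "y \<in> S" for y h v
      using linear_frechet_derivative[OF smooth_on_differentiable[OF smooth_on_FD[OF assms(2)] that]]
      by (simp add: linear_scale)
    have line: "((\<lambda>s. K (y + s *\<^sub>R v + y')) has_derivative (\<lambda>h. h * K' v)) (at s)"
      if "(K has_derivative K') (at (y + s *\<^sub>R v + y'))" "\<And>h. K' (h *\<^sub>R v) = h * K' v"
      for K :: "'e \<Rightarrow> real" and K' y s v y'
    proof -
      have "((\<lambda>s. y + s *\<^sub>R v + y') has_derivative (\<lambda>h. h *\<^sub>R v)) (at s)"
        by (auto intro!: derivative_eq_intros)
      from has_derivative_compose[OF this that(1)] that(2) show ?thesis by simp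
    qed
    \<comment> \<open>First the mean value theorem in the direction \<open>a'\<close>, for the difference in the direction \<open>b'\<close>.\<close>
    define \<phi> where "\<phi> = (\<lambda>s. F (z + s *\<^sub>R a' + t *\<^sub>R b') - F (z + s *\<^sub>R a' + 0 *\<^sub>R b'))"
    have "(\<phi> has_derivative (\<lambda>h. h * (FD F (z + s *\<^sub>R a' + t *\<^sub>R b') a' - FD F (z + s *\<^sub>R a' + 0 *\<^sub>R b') a')))
        (at s)" if "0 \<le> s" "s \<le> t" for s
    proof -
      have s1: "z + s *\<^sub>R a' + t *\<^sub>R b' \<in> S" and s2: "z + s *\<^sub>R a' + 0 *\<^sub>R b' \<in> S"
        using inS[of s t t a' b'] inS[of s t 0 a' b'] that t nab by simp_all
      show ?thesis unfolding \<phi>_def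
        using has_derivative_diff[OF line[OF dF[OF s1] lin[OF s1]] line[OF dF[OF s2] lin[OF s2]]]
        by (simp add: algebra_simps)
    qed
    then obtain s where s: "0 < s" "s < t"
      "\<phi> t - \<phi> 0 = t * (FD F (z + s *\<^sub>R a' + t *\<^sub>R b') a' - FD F (z + s *\<^sub>R a' + 0 *\<^sub>R b') a')"
      using mvt[of 0 t \<phi> "\<lambda>s h. h * (FD F (z + s *\<^sub>R a' + t *\<^sub>R b') a' - FD F (z + s *\<^sub>R a' + 0 *\<^sub>R b') a')"]
        t by (metis (no_types, lifting) atLeastAtMost_iff continuous_at_imp_continuous_on
          diff_zero greaterThanLessThan_iff has_derivative_continuous has_derivative_at_withinI less_imp_le)
    \<comment> \<open>Then the mean value theorem in the direction \<open>b'\<close>, for the derivative in the direction \<open>a'\<close>.\<close>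
    define \<psi> where "\<psi> = (\<lambda>s'. FD F (z + s *\<^sub>R a' + s' *\<^sub>R b') a')"
    have "(\<psi> has_derivative (\<lambda>h. h * C a' b' (z + s *\<^sub>R a' + s' *\<^sub>R b'))) (at s')"
      if "0 \<le> s'" "s' \<le> t" for s'
    proof -
      have s1: "z + s *\<^sub>R a' + s' *\<^sub>R b' \<in> S"
        using inS[of s t s' a' b'] that t s nab by auto
      show ?thesis unfolding \<psi>_def
        using line[of "\<lambda>y. FD F y a'" "FD (\<lambda>y. FD F y a') (z + s *\<^sub>R a' + s' *\<^sub>R b')" "z + s *\<^sub>R a'" s' b' 0]
          dF2[OF s1] lin2[OF s1] by (simp add: C_def)
    qed
    then obtain s' where s': "0 < s'" "s' < t" "\<psi> t - \<psi> 0 = t * C a' b' (z + s *\<^sub>R a' + s' *\<^sub>R b')"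
      using mvt[of 0 t \<psi> "\<lambda>s' h. h * C a' b' (z + s *\<^sub>R a' + s' *\<^sub>R b')"]
        t by (metis (no_types, lifting) atLeastAtMost_iff continuous_at_imp_continuous_on
          diff_zero greaterThanLessThan_iff has_derivative_continuous has_derivative_at_withinI less_imp_le)
    have "\<Delta> t a' b' = \<phi> t - \<phi> 0" by (simp add: \<Delta>_def \<phi>_def)
    also have "\<dots> = t * (\<psi> t - \<psi> 0)" using s by (simp add: \<psi>_def)
    also have "\<dots> = t\<^sup>2 * C a' b' (z + s *\<^sub>R a' + s' *\<^sub>R b')" using s' by (simp add: power2_eq_square)
    finally show ?thesis
      using inS[of s t s' a' b'] s s' t nab by (metis less_imp_le)
  qed
  have "C a b z = C b a z"
  proof (rule ccontr)
    assume ne: "C a b z \<noteq> C b a z"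
    define e where "e = \<bar>C a b z - C b a z\<bar> / 2"
    have e: "e > 0" using ne by (simp add: e_def)
    obtain d1 where d1: "d1 > 0" "\<And>p. dist p z < d1 \<Longrightarrow> dist (C a b p) (C a b z) < e"
      using contC[of a b] e unfolding continuous_at by (metis continuous_at continuous_at_eps_delta contC)
    obtain d2 where d2: "d2 > 0" "\<And>p. dist p z < d2 \<Longrightarrow> dist (C b a p) (C b a z) < e"
      using contC[of b a] e unfolding continuous_at by (metis continuous_at continuous_at_eps_delta contC)
    define t where "t = min r (min d1 d2) / (2 * N)"
    have t: "t > 0" "t * N < r" "t * N < d1" "t * N < d2"
      using r d1 d2 N by (auto simp: t_def)
    obtain p q where p: "dist p z \<le> t * N" "\<Delta> t a b = t\<^sup>2 * C a b p"
      and q: "dist q z \<le> t * N" "\<Delta> t b a = t\<^sup>2 * C b a q"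
      using key[of t a b] key[of t b a] t by auto
    have "\<Delta> t a b = \<Delta> t b a" by (simp add: \<Delta>_def algebra_simps)
    then have "C a b p = C b a q" using p q t by simp
    moreover have "dist (C a b p) (C a b z) < e" "dist (C b a q) (C b a z) < e"
      using d1 d2 p q t by auto
    ultimately show False unfolding e_def by (auto simp: dist_real_def abs_if split: if_splits)
  qed
  then show ?thesis by (simp add: C_def)
qed

lemma symmetric_second_derivative:
  fixes F :: "'e::euclidean_space \<Rightarrow> 'd::euclidean_space"
  assumes "open S" "smooth_on S F" "z \<in> S"
  shows "FD (\<lambda>y. FD F y a) z b = FD (\<lambda>y. FD F y b) z a"
proof (rule euclidean_eqI)
  fix i :: 'd
  have F1: "FD (\<lambda>y. F y \<bullet> i) y v = FD F y v \<bullet> i" if "y \<in> S" for y v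
    using FD_eqI[OF has_derivative_inner_left[OF has_FD[OF smooth_on_differentiable[OF assms(2) that]]], of i]
    by simp
  have F2: "FD (\<lambda>y. FD (\<lambda>y. F y \<bullet> i) y v) z w = FD (\<lambda>y. FD F y v) z w \<bullet> i" for v w
  proof -
    have "FD (\<lambda>y. FD (\<lambda>y. F y \<bullet> i) y v) z = FD (\<lambda>y. FD F y v \<bullet> i) z"
      by (rule FD_cong[OF assms(1,3)]) (rule F1)
    also have "\<dots> = (\<lambda>w. FD (\<lambda>y. FD F y v) z w \<bullet> i)"
      by (intro FD_eqI has_derivative_inner_left has_FD smooth_on_differentiable[OF smooth_on_FD[OF assms(2)] assms(3)])
    finally show ?thesis by simp
  qed
  have "smooth_on S (\<lambda>y. F y \<bullet> i)"
    by (rule smooth_on_inner[OF assms(1,2) smooth_on_const])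
  from symmetric_second_derivative_real[OF assms(1) this assms(3), of a b]
  show "FD (\<lambda>y. FD F y a) z b \<bullet> i = FD (\<lambda>y. FD F y b) z a \<bullet> i" by (simp add: F2)
qed

section \<open>Positive definite systems with smooth coefficients\<close>

text \<open>Induction over the index set, as in the Gram-Schmidt process: if \<open>w\<close> is the \<open>G\<close>-orthogonal
  projection of \<open>k\<close> to the span of \<open>J\<close>, then \<open>k - w\<close> serves to correct the solution for \<open>J\<close> in the
  equation of index \<open>k\<close>. Only divisions by the positive numbers \<open>G (k - w) (k - w)\<close> occur, which
  preserves smoothness.\<close>

lemma smooth_positive_definite_solution_aux:
  fixes G :: "'e::euclidean_space \<Rightarrow> 'e \<Rightarrow> 'e \<Rightarrow> real"
  assumes S: "open S" and sm: "\<And>i j. i \<in> Basis \<Longrightarrow> j \<in> Basis \<Longrightarrow> smooth_on S (\<lambda>z. G z i j)"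
    and lin: "\<And>z w. z \<in> S \<Longrightarrow> linear (\<lambda>v. G z v w)"
    and sym: "\<And>z v w. z \<in> S \<Longrightarrow> G z v w = G z w v"
    and pos: "\<And>z v. z \<in> S \<Longrightarrow> v \<noteq> 0 \<Longrightarrow> G z v v > 0"
    and "finite J" "J \<subseteq> Basis"
  shows "(\<And>j. j \<in> J \<Longrightarrow> smooth_on S (b j)) \<Longrightarrow>
    \<exists>v. smooth_on S v \<and> (\<forall>z\<in>S. v z \<in> span J \<and> (\<forall>j\<in>J. G z (v z) j = b j z))"
  using assms(6,7)
proof (induction J arbitrary: b rule: finite_induct)
  case empty
  then show ?case by (intro exI[of _ "\<lambda>z. 0"]) (simp add: smooth_on_const)
next
  case (insert k J)
  have kB: "k \<in> Basis" "J \<subseteq> Basis" using insert.prems by auto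
  have linr: "linear (\<lambda>y. G z y' y)" if "z \<in> S" for z y'
  proof -
    have "(\<lambda>y. G z y y') = (\<lambda>y. G z y' y)" by (rule ext) (rule sym[OF that])
    with lin[OF that, of y'] show ?thesis by (rule subst[rotated])
  qed
  have smG: "smooth_on S (\<lambda>z. G z (v z) j)" if "smooth_on S v" "j \<in> Basis" for v j
  proof (rule smooth_on_cong[OF S])
    show "smooth_on S (\<lambda>z. \<Sum>i\<in>Basis. (v z \<bullet> i) * G z i j)"
      by (intro smooth_on_sum smooth_on_mult smooth_on_inner smooth_on_const sm that S)
    show "(\<Sum>i\<in>Basis. (v z \<bullet> i) * G z i j) = G z (v z) j" if "z \<in> S" for z
    proof -
      interpret linear "\<lambda>v. G z v j" by (rule lin[OF that])
      have "G z (v z) j = G z (\<Sum>i\<in>Basis. (v z \<bullet> i) *\<^sub>R i) j" by (simp add: euclidean_representation)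
      then show ?thesis by (simp add: sum scale)
    qed
  qed
  obtain w where w: "smooth_on S w" "\<And>z. z \<in> S \<Longrightarrow> w z \<in> span J"
    "\<And>z j. z \<in> S \<Longrightarrow> j \<in> J \<Longrightarrow> G z (w z) j = G z k j"
    using insert.IH[of "\<lambda>j z. G z k j"] kB sm by blast
  obtain v where v: "smooth_on S v" "\<And>z. z \<in> S \<Longrightarrow> v z \<in> span J"
    "\<And>z j. z \<in> S \<Longrightarrow> j \<in> J \<Longrightarrow> G z (v z) j = b j z"
    using insert.IH[of b] insert.prems kB by (metis insertI2)
  define E where "E = (\<lambda>z. k - w z)"
  have smE: "smooth_on S E" unfolding E_def by (intro smooth_on_diff S smooth_on_const w)
  have "k \<notin> span J"
    using independent_insert[of k J] independent_mono[OF independent_Basis, of "insert k J"] kB insert.hyps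
    by auto
  then have Ene: "E z \<noteq> 0" if "z \<in> S" for z using w(2)[OF that] by (auto simp: E_def)
  have EJ: "G z (E z) j = 0" if "z \<in> S" "j \<in> J" for z j
    using linear_diff[OF lin[OF that(1), of j], of k "w z"] w(3)[OF that] by (simp add: E_def)
  have Espan: "G z (E z) y = 0" if z: "z \<in> S" and y: "y \<in> span J" for z y
    using y
  proof (induction rule: span_induct)
    case base
    have "linear (\<lambda>y. G z (E z) y)" by (rule linr[OF z])
    then show ?case by (rule linear_subspace_kernel)
  next
    case (step y)
    then show ?case using EJ[OF z] by blast
  qed
  have Ek: "G z (E z) k = G z (E z) (E z)" if "z \<in> S" for z
  proof -
    have "k - w z = E z" by (simp add: E_def)
    then have "G z (E z) (E z) = G z (E z) k - G z (E z) (w z)"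
      using linear_diff[OF linr[OF that, of "E z"], of k "w z"] by simp
    then show ?thesis using Espan[OF that w(2)[OF that]] by simp
  qed
  define t where "t = (\<lambda>z. (b k z - G z (v z) k) * inverse (G z (E z) k))"
  have smt: "smooth_on S t" unfolding t_def
    by (intro smooth_on_mult smooth_on_diff smooth_on_inverse smG S v w smE kB)
       (use insert.prems Ek Ene pos in \<open>auto, fastforce\<close>)
  show ?case
  proof (intro exI[of _ "\<lambda>z. v z + t z *\<^sub>R E z"] conjI ballI)
    show "smooth_on S (\<lambda>z. v z + t z *\<^sub>R E z)"
      by (intro smooth_on_add smooth_on_scaleR S v smt smE)
    fix z assume z: "z \<in> S"
    have "E z \<in> span (insert k J)" unfolding E_def
      using w(2)[OF z] span_mono[of J "insert k J"] by (intro span_diff) (auto simp: span_base)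
    then show "v z + t z *\<^sub>R E z \<in> span (insert k J)"
      using v(2)[OF z] span_mono[of J "insert k J"] by (intro span_add span_scale) auto
    fix j assume j: "j \<in> insert k J"
    have G: "G z (v z + t z *\<^sub>R E z) j = G z (v z) j + t z * G z (E z) j"
      using linear_add[OF lin[OF z, of j], of "v z" "t z *\<^sub>R E z"]
        linear_scale[OF lin[OF z, of j], of "t z" "E z"] by simp
    have "G z (E z) k > 0" using Ek[OF z] pos[OF z Ene[OF z]] by simp
    then show "G z (v z + t z *\<^sub>R E z) j = b j z"
      using j v(3)[OF z] EJ[OF z] unfolding G by (cases "j = k") (auto simp: t_def field_simps)
  qed
qed

lemma smooth_positive_definite_solution:
  fixes G :: "'e::euclidean_space \<Rightarrow> 'e \<Rightarrow> 'e \<Rightarrow> real"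
  assumes S: "open S" and sm: "\<And>i j. i \<in> Basis \<Longrightarrow> j \<in> Basis \<Longrightarrow> smooth_on S (\<lambda>z. G z i j)"
    and lin: "\<And>z w. z \<in> S \<Longrightarrow> linear (\<lambda>v. G z v w)"
    and sym: "\<And>z v w. z \<in> S \<Longrightarrow> G z v w = G z w v"
    and pos: "\<And>z v. z \<in> S \<Longrightarrow> v \<noteq> 0 \<Longrightarrow> G z v v > 0"
    and b: "\<And>j. j \<in> Basis \<Longrightarrow> smooth_on S (b j)"
  obtains v where "smooth_on S v" "\<And>z j. z \<in> S \<Longrightarrow> j \<in> Basis \<Longrightarrow> G z (v z) j = b j z"
  using smooth_positive_definite_solution_aux[of S G Basis b] assms by auto

section \<open>Derivatives applied to varying vectors\<close>

lemma smooth_on_FD_pair: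
  fixes F :: "'v::euclidean_space \<Rightarrow> 'w::real_normed_vector"
  assumes "open S" "smooth_on S F"
  shows "smooth_on (S \<times> UNIV) (\<lambda>p. FD F (fst p) (snd p))"
proof -
  have o: "open (S \<times> (UNIV :: 'v set))" using assms by (simp add: open_Times)
  have f: "smooth_on (S \<times> (UNIV :: 'v set)) (\<lambda>p. K (fst p))" if "smooth_on S K" for K :: "'v \<Rightarrow> 'w"
    by (rule smooth_on_compose[OF o assms(1) that smooth_on_bounded_linear[OF bounded_linear_fst]]) auto
  show ?thesis
  proof (rule smooth_on_cong[OF o])
    show "smooth_on (S \<times> UNIV) (\<lambda>p. \<Sum>i\<in>Basis. (snd p \<bullet> i) *\<^sub>R FD F (fst p) i)"
      by (intro smooth_on_sum smooth_on_scaleR smooth_on_inner smooth_on_const o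
          smooth_on_bounded_linear[OF bounded_linear_snd] f[of "\<lambda>z. FD F z _"] smooth_on_FD assms)
    show "(\<Sum>i\<in>Basis. (snd p \<bullet> i) *\<^sub>R FD F (fst p) i) = FD F (fst p) (snd p)" if "p \<in> S \<times> UNIV" for p
      using that FD_expand[OF smooth_on_differentiable[OF assms(2)], of "fst p" "snd p"] by auto
  qed
qed

text \<open>Differentiating \<open>DF(z) w\<close> in both variables. It is linear in \<open>w\<close>, hence a finite sum of products
  of components of \<open>w\<close> with the smooth functions \<open>D\<^sub>iF\<close>.\<close>

lemma has_derivative_FD_pair:
  fixes F :: "'v::euclidean_space \<Rightarrow> 'w::real_normed_vector"
  assumes S: "open S" and F: "smooth_on S F" and z: "z \<in> S"
  shows "((\<lambda>p. FD F (fst p) (snd p)) has_derivative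
    (\<lambda>q. FD (\<lambda>y. FD F y w) z (fst q) + FD F z (snd q))) (at (z, w))"
proof -
  have d2: "((\<lambda>y. FD F y i) has_derivative FD (\<lambda>y. FD F y i) z) (at z)" for i
    using smooth_on_FD[OF F] z by (intro has_FD smooth_on_differentiable)
  have d3: "((\<lambda>p::'v\<times>'v. FD F (fst p) i) has_derivative (\<lambda>q. FD (\<lambda>y. FD F y i) z (fst q))) (at (z, w))"
    for i
    by (rule has_derivative_compose[of fst fst _ _ "\<lambda>y. FD F y i"])
       (use d2[of i] has_derivative_fst[OF has_derivative_ident] in auto)
  have d4: "((\<lambda>p::'v\<times>'v. snd p \<bullet> i) has_derivative (\<lambda>q. snd q \<bullet> i)) (at p)" for i p
    by (auto intro!: derivative_eq_intros)
  have e: "FD F y v = (\<Sum>i\<in>Basis. (v \<bullet> i) *\<^sub>R FD F y i)" if "y \<in> S" for y v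
    using F that by (intro FD_expand smooth_on_differentiable)
  have d: "((\<lambda>p::'v\<times>'v. \<Sum>i\<in>Basis. (snd p \<bullet> i) *\<^sub>R FD F (fst p) i) has_derivative
      (\<lambda>q. \<Sum>i\<in>Basis. (w \<bullet> i) *\<^sub>R FD (\<lambda>y. FD F y i) z (fst q) + (snd q \<bullet> i) *\<^sub>R FD F z i))
      (at (z, w))"
    using has_derivative_scaleR[OF d4[of _ "(z, w)"] d3] by (intro has_derivative_sum) simp
  have w: "(\<Sum>i\<in>Basis. (w \<bullet> i) *\<^sub>R FD (\<lambda>y. FD F y i) z a) = FD (\<lambda>y. FD F y w) z a" for a
  proof -
    have "FD (\<lambda>y. FD F y w) z = FD (\<lambda>y. \<Sum>i\<in>Basis. (w \<bullet> i) *\<^sub>R FD F y i) z"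
      by (rule FD_cong[OF S z]) (rule e)
    also have "\<dots> = (\<lambda>a. \<Sum>i\<in>Basis. (w \<bullet> i) *\<^sub>R FD (\<lambda>y. FD F y i) z a)"
      by (intro FD_eqI has_derivative_sum has_derivative_scaleR_right d2)
    finally show ?thesis by simp
  qed
  have "((\<lambda>p::'v\<times>'v. \<Sum>i\<in>Basis. (snd p \<bullet> i) *\<^sub>R FD F (fst p) i) has_derivative
      (\<lambda>q. FD (\<lambda>y. FD F y w) z (fst q) + FD F z (snd q))) (at (z, w))"
    using d by (simp only: sum.distrib w e[OF z, symmetric])
  then show ?thesis
    by (rule has_derivative_transform_within_open[of _ _ _ _ "S \<times> UNIV"])
       (use S z e in \<open>auto simp: open_Times\<close>)
qed

lemma has_derivative_FD_apply:
  fixes F :: "'v::euclidean_space \<Rightarrow> 'w::real_normed_vector"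
  assumes "open S" "smooth_on S F" "z \<in> S" "V differentiable (at z)"
  shows "((\<lambda>y. FD F y (V y)) has_derivative
    (\<lambda>a. FD (\<lambda>y. FD F y (V z)) z a + FD F z (FD V z a))) (at z)"
  using has_derivative_compose[OF has_derivative_Pair[OF has_derivative_ident has_FD[OF assms(4)]]
      has_derivative_FD_pair[OF assms(1-3)]] by simp

section \<open>Smooth atlases and tangent vectors\<close>

text \<open>The part of the notion of a smooth manifold that does not mention the topology. It is what the
  induced atlas of the tangent bundle inherits from \<open>A\<close>, and it suffices for the calculus of tangent
  vectors on both.\<close>

locale smooth_atlas =
  fixes A :: "('a, 'e::euclidean_space) atlas"
  assumes chart_inj: "c \<in> A \<Longrightarrow> inj_on (snd c) (fst c)"
    and overlap_open: "c \<in> A \<Longrightarrow> d \<in> A \<Longrightarrow> open (snd c ` (fst c \<inter> fst d))"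
    and transition_smooth:
      "c \<in> A \<Longrightarrow> d \<in> A \<Longrightarrow> smooth_on (snd c ` (fst c \<inter> fst d)) (snd d \<circ> cinv c)"
begin

abbreviation jac :: "('a, 'e) chart \<Rightarrow> ('a, 'e) chart \<Rightarrow> 'a \<Rightarrow> 'e \<Rightarrow> 'e"
  where "jac c d x \<equiv> FD (snd d \<circ> cinv c) (snd c x)"

lemma charts_at_iff: "c \<in> charts_at A x \<longleftrightarrow> c \<in> A \<and> x \<in> fst c"
  by (simp add: charts_at_def)

lemma carrier_iff: "x \<in> carrier A \<longleftrightarrow> (\<exists>c. c \<in> charts_at A x)"
  unfolding carrier_def charts_at_def by blast

lemma charts_at_carrier: "c \<in> charts_at A x \<Longrightarrow> x \<in> carrier A"
  using carrier_iff by blast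

lemma chart_image_open: "c \<in> A \<Longrightarrow> open (snd c ` fst c)"
  using overlap_open[of c c] by simp

lemma cinv_chart [simp]: "c \<in> A \<Longrightarrow> y \<in> fst c \<Longrightarrow> cinv c (snd c y) = y"
  by (simp add: chart_inj inv_into_f_f)

lemma transition_differentiable:
  assumes "c \<in> charts_at A x" "d \<in> charts_at A x"
  shows "(snd d \<circ> cinv c) differentiable (at (snd c x))"
  using assms by (intro smooth_on_differentiable[OF transition_smooth]) (auto simp: charts_at_iff)

lemma linear_jac:
  assumes "c \<in> charts_at A x" "d \<in> charts_at A x"
  shows "linear (jac c d x)"
  using transition_differentiable[OF assms] by (rule linear_frechet_derivative)

lemma FD_change_chart:
  assumes "c \<in> charts_at A x" "d \<in> charts_at A x"
    and "(h \<circ> cinv d) differentiable (at (snd d x))"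
  shows "FD (h \<circ> cinv c) (snd c x) w = FD (h \<circ> cinv d) (snd d x) (jac c d x w)"
proof -
  have c: "c \<in> A" "x \<in> fst c" and d: "d \<in> A" "x \<in> fst d"
    using assms by (auto simp: charts_at_iff)
  have "FD (h \<circ> cinv c) (snd c x) = FD ((h \<circ> cinv d) \<circ> (snd d \<circ> cinv c)) (snd c x)"
    by (rule FD_cong[OF overlap_open[OF c(1) d(1)]]) (use c d in auto)
  also have "\<dots> = FD (h \<circ> cinv d) ((snd d \<circ> cinv c) (snd c x)) \<circ> jac c d x"
    using assms(3) c transition_differentiable[OF assms(1,2)]
    by (intro FD_eqI diff_chain_at has_FD) simp_all
  finally show ?thesis using c by simp
qed

lemma jac_self:
  assumes "c \<in> charts_at A x"
  shows "jac c c x w = w"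
proof -
  have c: "c \<in> A" "x \<in> fst c" using assms by (auto simp: charts_at_iff)
  have "jac c c x = FD (\<lambda>z. z) (snd c x)"
    by (rule FD_cong[OF chart_image_open[OF c(1)]]) (use c in auto)
  then show ?thesis by simp
qed

lemma jac_cocycle:
  assumes "c \<in> charts_at A x" "d \<in> charts_at A x" "e \<in> charts_at A x"
  shows "jac c e x w = jac d e x (jac c d x w)"
  using FD_change_chart[OF assms(1,2), of "snd e"] transition_differentiable[OF assms(2,3)] by simp

lemma tangent_spaceI:
  assumes "\<And>c d. c \<in> charts_at A x \<Longrightarrow> d \<in> charts_at A x \<Longrightarrow> v d = jac c d x (v c)"
    and "\<And>c. c \<notin> charts_at A x \<Longrightarrow> v c = 0"
  shows "v \<in> tangent_space A x"
  unfolding tangent_space_def using assms by blast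

lemma tangent_space_jac:
  "v \<in> tangent_space A x \<Longrightarrow> c \<in> charts_at A x \<Longrightarrow> d \<in> charts_at A x \<Longrightarrow> v d = jac c d x (v c)"
  unfolding tangent_space_def by blast

lemma tangent_space_off: "v \<in> tangent_space A x \<Longrightarrow> c \<notin> charts_at A x \<Longrightarrow> v c = 0"
  unfolding tangent_space_def by blast

lemma coord_vec_in_tangent_space:
  assumes "c \<in> charts_at A x"
  shows "coord_vec A c x w \<in> tangent_space A x"
proof (rule tangent_spaceI)
  fix d e assume "d \<in> charts_at A x" "e \<in> charts_at A x"
  then show "coord_vec A c x w e = jac d e x (coord_vec A c x w d)"
    using jac_cocycle[OF assms, of d e w] by (simp only: coord_vec_def if_True)
qed (simp add: coord_vec_def)

lemma coord_vec_self [simp]: "c \<in> charts_at A x \<Longrightarrow> coord_vec A c x w c = w"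
  by (simp add: coord_vec_def jac_self)

lemma tangent_vector_eqI:
  assumes "v \<in> tangent_space A x" "w \<in> tangent_space A x" "c \<in> charts_at A x" "v c = w c"
  shows "v = w"
proof
  fix d show "v d = w d"
  proof (cases "d \<in> charts_at A x")
    case True
    then show ?thesis 
      using tangent_space_jac[OF assms(1,3) True] tangent_space_jac[OF assms(2,3) True] assms(4) by simp
  next
    case False
    then show ?thesis using assms(1,2) by (simp add: tangent_space_off)
  qed
qed

lemma coord_vec_component:
  "v \<in> tangent_space A x \<Longrightarrow> c \<in> charts_at A x \<Longrightarrow> coord_vec A c x (v c) = v"
  by (rule tangent_vector_eqI) (auto simp: coord_vec_in_tangent_space)

lemma zero_in_tangent_space: "0 \<in> tangent_space A x"
  by (rule tangent_spaceI) (simp_all add: linear_0[OF linear_jac])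

lemma add_in_tangent_space:
  assumes "v \<in> tangent_space A x" "w \<in> tangent_space A x"
  shows "v + w \<in> tangent_space A x"
proof (rule tangent_spaceI)
  fix c d assume "c \<in> charts_at A x" "d \<in> charts_at A x"
  then show "(v + w) d = jac c d x ((v + w) c)"
    using tangent_space_jac[OF assms(1), of c d] tangent_space_jac[OF assms(2), of c d]
    by (simp add: linear_add[OF linear_jac])
qed (simp add: tangent_space_off[OF assms(1)] tangent_space_off[OF assms(2)])

lemma scaleR_in_tangent_space:
  assumes "v \<in> tangent_space A x"
  shows "r *\<^sub>R v \<in> tangent_space A x"
proof (rule tangent_spaceI)
  fix c d assume "c \<in> charts_at A x" "d \<in> charts_at A x"
  then show "(r *\<^sub>R v) d = jac c d x ((r *\<^sub>R v) c)"
    using tangent_space_jac[OF assms, of c d] by (simp add: scaleR_fun_def linear_scale[OF linear_jac])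
qed (simp add: tangent_space_off[OF assms] scaleR_fun_def)

lemma minus_in_tangent_space: "v \<in> tangent_space A x \<Longrightarrow> - v \<in> tangent_space A x"
  using scaleR_in_tangent_space[of v x "-1"] by simp

lemma diff_in_tangent_space:
  "v \<in> tangent_space A x \<Longrightarrow> w \<in> tangent_space A x \<Longrightarrow> v - w \<in> tangent_space A x"
  using add_in_tangent_space[of v x "- w"] minus_in_tangent_space[of w x] by simp

text \<open>The derivative along a tangent vector is defined through an arbitrary chart; by the chain rule the
  Jacobian in the change of the function cancels that in the change of the components.\<close>

lemma tderiv_chart:
  assumes c: "c \<in> charts_at A x" and v: "v \<in> tangent_space A x"
    and h: "(h \<circ> cinv c) differentiable (at (snd c x))"
  shows "tderiv A h x v = FD (h \<circ> cinv c) (snd c x) (v c)"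
proof -
  define c0 where "c0 = (SOME c. c \<in> charts_at A x)"
  have c0: "c0 \<in> charts_at A x" unfolding c0_def using c by (rule someI)
  have "tderiv A h x v = FD (h \<circ> cinv c0) (snd c0 x) (v c0)"
    by (simp add: tderiv_def Let_def c0_def)
  also have "\<dots> = FD (h \<circ> cinv c) (snd c x) (jac c0 c x (v c0))"
    by (rule FD_change_chart[OF c0 c h])
  finally show ?thesis using tangent_space_jac[OF v c0 c] by simp
qed

lemma vector_fieldsD:
  assumes "X \<in> vector_fields A"
  shows "x \<in> carrier A \<Longrightarrow> X x \<in> tangent_space A x" "x \<notin> carrier A \<Longrightarrow> X x = 0"
    "c \<in> A \<Longrightarrow> smooth_on (snd c ` fst c) (\<lambda>z. X (cinv c z) c)"
    "c \<in> charts_at A x \<Longrightarrow> X x \<in> tangent_space A x"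
proof -
  show X: "x \<in> carrier A \<Longrightarrow> X x \<in> tangent_space A x" for x
    using assms by (simp add: vector_fields_def)
  show "c \<in> charts_at A x \<Longrightarrow> X x \<in> tangent_space A x"
    by (rule X[OF charts_at_carrier])
qed (use assms in \<open>simp_all add: vector_fields_def\<close>)

lemma field_differentiable:
  assumes "X \<in> vector_fields A" "c \<in> charts_at A x"
  shows "(\<lambda>z. X (cinv c z) c) differentiable (at (snd c x))"
  using assms by (intro smooth_on_differentiable[OF vector_fieldsD(3)]) (auto simp: charts_at_iff)

section \<open>The tangent bundle\<close>

lemma fst_tangent_chart: "(x, u) \<in> fst (tangent_chart A c) \<longleftrightarrow> x \<in> fst c \<and> u \<in> tangent_space A x"
  by (simp add: tangent_chart_def)

lemma snd_tangent_chart [simp]: "snd (tangent_chart A c) (x, u) = (snd c x, u c)"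
  by (simp add: tangent_chart_def)

lemma charts_at_tangent_atlas:
  assumes "u \<in> tangent_space A x"
  shows "charts_at (tangent_atlas A) (x, u) = tangent_chart A ` charts_at A x"
  using assms by (auto simp: charts_at_def tangent_atlas_def fst_tangent_chart)

lemma carrier_tangent_atlas:
  "(x, u) \<in> carrier (tangent_atlas A) \<longleftrightarrow> x \<in> carrier A \<and> u \<in> tangent_space A x"
  by (auto simp: carrier_def tangent_atlas_def fst_tangent_chart)

lemma tangent_chart_overlap:
  assumes "c \<in> A" "d \<in> A"
  shows "snd (tangent_chart A c) ` (fst (tangent_chart A c) \<inter> fst (tangent_chart A d))
    = (snd c ` (fst c \<inter> fst d)) \<times> UNIV"
proof (intro equalityI subsetI)
  fix q assume "q \<in> (snd c ` (fst c \<inter> fst d)) \<times> (UNIV :: 'e set)"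
  then obtain y w where y: "y \<in> fst c" "y \<in> fst d" "q = (snd c y, w)" by auto
  have cy: "c \<in> charts_at A y" using assms y by (simp add: charts_at_iff)
  let ?p = "(y, coord_vec A c y w)"
  have "q = snd (tangent_chart A c) ?p" using y cy by simp
  moreover have "?p \<in> fst (tangent_chart A c) \<inter> fst (tangent_chart A d)"
    using y coord_vec_in_tangent_space[OF cy] by (simp add: fst_tangent_chart)
  ultimately show "q \<in> snd (tangent_chart A c) ` (fst (tangent_chart A c) \<inter> fst (tangent_chart A d))"
    by (rule image_eqI)
qed (auto simp: fst_tangent_chart)

lemma tangent_chart_image:
  "c \<in> A \<Longrightarrow> snd (tangent_chart A c) ` fst (tangent_chart A c) = (snd c ` fst c) \<times> UNIV"
  using tangent_chart_overlap[of c c] by simp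

lemma inj_on_tangent_chart:
  assumes "c \<in> A"
  shows "inj_on (snd (tangent_chart A c)) (fst (tangent_chart A c))"
proof (rule inj_onI, clarify)
  fix x u y v
  assume *: "(x, u) \<in> fst (tangent_chart A c)" "(y, v) \<in> fst (tangent_chart A c)"
    "snd (tangent_chart A c) (x, u) = snd (tangent_chart A c) (y, v)"
  then have xy: "x = y" using inj_onD[OF chart_inj[OF assms]] by (simp add: fst_tangent_chart)
  moreover have "u = v"
    using * assms xy by (intro tangent_vector_eqI[of u x v c]) (auto simp: fst_tangent_chart charts_at_iff)
  ultimately show "x = y \<and> u = v" by simp
qed

lemma cinv_tangent_chart:
  assumes "c \<in> A" "y \<in> fst c"
  shows "cinv (tangent_chart A c) (snd c y, w) = (y, coord_vec A c y w)"
proof -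
  have cy: "c \<in> charts_at A y" using assms by (simp add: charts_at_iff)
  have "cinv (tangent_chart A c) (snd (tangent_chart A c) (y, coord_vec A c y w)) = (y, coord_vec A c y w)"
    using coord_vec_in_tangent_space[OF cy] assms
    by (intro inv_into_f_f inj_on_tangent_chart) (auto simp: fst_tangent_chart)
  then show ?thesis using cy by simp
qed

text \<open>The fibre coordinate of a point of \<open>TM\<close> is the component of a tangent vector, so it transforms
  by the Jacobian of the coordinate change.\<close>

lemma tangent_transition:
  assumes "c \<in> A" "d \<in> A" "z \<in> snd c ` (fst c \<inter> fst d)"
  shows "(snd (tangent_chart A d) \<circ> cinv (tangent_chart A c)) (z, w)
    = ((snd d \<circ> cinv c) z, FD (snd d \<circ> cinv c) z w)"
  using assms by (auto simp: cinv_tangent_chart coord_vec_def charts_at_iff)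

lemma tangent_atlas_smooth_atlas: "smooth_atlas (tangent_atlas A)"
proof
  fix C D assume "C \<in> tangent_atlas A" "D \<in> tangent_atlas A"
  then obtain c d where c: "c \<in> A" "C = tangent_chart A c" and d: "d \<in> A" "D = tangent_chart A d"
    by (auto simp: tangent_atlas_def)
  let ?S = "snd c ` (fst c \<inter> fst d)"
  have S: "open ?S" by (rule overlap_open[OF c(1) d(1)])
  have o: "open (?S \<times> (UNIV :: 'e set))" using S by (simp add: open_Times)
  show "inj_on (snd C) (fst C)" using c inj_on_tangent_chart by simp
  show "open (snd C ` (fst C \<inter> fst D))" using o c d by (simp add: tangent_chart_overlap)
  have 1: "smooth_on (?S \<times> UNIV) (\<lambda>p::'e\<times>'e. (snd d \<circ> cinv c) (fst p))"
    by (rule smooth_on_compose[OF o S transition_smooth[OF c(1) d(1)]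
          smooth_on_bounded_linear[OF bounded_linear_fst]]) auto
  show "smooth_on (snd C ` (fst C \<inter> fst D)) (snd D \<circ> cinv C)"
    unfolding c d tangent_chart_overlap[OF c(1) d(1)]
    by (rule smooth_on_cong[OF o smooth_on_Pair[OF o 1 smooth_on_FD_pair[OF S transition_smooth[OF c(1) d(1)]]]])
       (auto simp: tangent_transition[OF c(1) d(1)] simp del: o_apply)
qed

text \<open>In the charts of \<open>TM\<close> the coordinate change is \<open>(z, w) \<mapsto> (\<tau>(z), D\<tau>(z) w)\<close>; moving the base point in
  the second component gives the second-order term.\<close>

lemma tangent_jacobian:
  assumes c: "c \<in> charts_at A x" and d: "d \<in> charts_at A x" and u: "u \<in> tangent_space A x"
  shows "FD (snd (tangent_chart A d) \<circ> cinv (tangent_chart A c)) (snd (tangent_chart A c) (x, u)) (a, b)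
    = (jac c d x a, FD (\<lambda>z. FD (snd d \<circ> cinv c) z (u c)) (snd c x) a + jac c d x b)"
proof -
  let ?S = "snd c ` (fst c \<inter> fst d)" and ?F = "snd d \<circ> cinv c"
  have cA: "c \<in> A" "d \<in> A" "x \<in> fst c" "x \<in> fst d" using c d by (auto simp: charts_at_iff)
  have S: "open ?S" by (rule overlap_open[OF cA(1,2)])
  have o: "open (?S \<times> (UNIV :: 'e set))" using S by (simp add: open_Times)
  have xS: "snd c x \<in> ?S" using cA by auto
  have dF: "(?F has_derivative FD ?F z) (at z)" if "z \<in> ?S" for z
    using transition_smooth[OF cA(1,2)] that by (intro has_FD smooth_on_differentiable)
  have d1: "((\<lambda>p::'e\<times>'e. ?F (fst p)) has_derivative (\<lambda>q. jac c d x (fst q))) (at (snd c x, u c))"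
    by (rule has_derivative_compose[of fst fst _ _ ?F])
       (use dF[OF xS] has_derivative_fst[OF has_derivative_ident] in \<open>auto simp del: o_apply\<close>)
  note d5 = has_derivative_FD_pair[OF S transition_smooth[OF cA(1,2)] xS, of "u c"]
  have "FD (snd (tangent_chart A d) \<circ> cinv (tangent_chart A c)) (snd c x, u c)
      = FD (\<lambda>p. (?F (fst p), FD ?F (fst p) (snd p))) (snd c x, u c)"
    by (rule FD_cong[OF o]) (use xS tangent_transition[OF cA(1,2)] in \<open>auto simp del: o_apply\<close>)
  also have "\<dots> = (\<lambda>q. (jac c d x (fst q), FD (\<lambda>z. FD ?F z (u c)) (snd c x) (fst q) + jac c d x (snd q)))"
    by (rule FD_eqI[OF has_derivative_Pair[OF d1 d5]])
  finally show ?thesis by simp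
qed

text \<open>Lifts are introduced by definite descriptions of their components in the induced charts. Such a
  description is legitimate as soon as the prescribed components transform by the Jacobians of \<open>TM\<close>: the
  vector with the right components in one chart then has them in all others.\<close>

lemma bundle_vector_THE:
  assumes x: "x \<in> carrier A" and u: "u \<in> tangent_space A x"
    and \<eta>: "\<And>c d. c \<in> charts_at A x \<Longrightarrow> d \<in> charts_at A x \<Longrightarrow>
      \<eta> d = (jac c d x (fst (\<eta> c)),
             FD (\<lambda>z. FD (snd d \<circ> cinv c) z (u c)) (snd c x) (fst (\<eta> c)) + jac c d x (snd (\<eta> c)))"
  defines "\<xi> \<equiv> THE \<xi>. \<xi> \<in> tangent_space (tangent_atlas A) (x, u) \<and>
    (\<forall>c\<in>charts_at A x. \<xi> (tangent_chart A c) = \<eta> c)"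
  shows "\<xi> \<in> tangent_space (tangent_atlas A) (x, u)"
    and "\<And>c. c \<in> charts_at A x \<Longrightarrow> \<xi> (tangent_chart A c) = \<eta> c"
proof -
  interpret TM: smooth_atlas "tangent_atlas A" by (rule tangent_atlas_smooth_atlas)
  let ?P = "\<lambda>\<xi>. \<xi> \<in> tangent_space (tangent_atlas A) (x, u) \<and>
    (\<forall>c\<in>charts_at A x. \<xi> (tangent_chart A c) = \<eta> c)"
  obtain c where c: "c \<in> charts_at A x" using x by (auto simp: carrier_iff)
  have ch: "tangent_chart A d \<in> charts_at (tangent_atlas A) (x, u)" if "d \<in> charts_at A x" for d
    using that u by (simp add: charts_at_tangent_atlas)
  let ?\<xi> = "coord_vec (tangent_atlas A) (tangent_chart A c) (x, u) (\<eta> c)"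
  have "?\<xi> (tangent_chart A d) = \<eta> d" if d: "d \<in> charts_at A x" for d
    using \<eta>[OF c d] tangent_jacobian[OF c d u, of "fst (\<eta> c)" "snd (\<eta> c)"] ch[OF d]
    by (simp add: coord_vec_def)
  then have P: "?P ?\<xi>" using TM.coord_vec_in_tangent_space[OF ch[OF c]] by blast
  have "\<xi>' = ?\<xi>" if "?P \<xi>'" for \<xi>'
    using that P TM.tangent_vector_eqI[OF _ _ ch[OF c]] c by metis
  with P have "?P \<xi>" unfolding \<xi>_def by (rule theI)
  then show "\<xi> \<in> tangent_space (tangent_atlas A) (x, u)"
    and "\<And>c. c \<in> charts_at A x \<Longrightarrow> \<xi> (tangent_chart A c) = \<eta> c" by auto
qed

text \<open>In an induced chart the function does not depend on the fibre coordinates, so that only the base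
  component of \<open>\<xi>\<close> can contribute.\<close>

lemma tderiv_pullback:
  assumes u: "u \<in> tangent_space A x" and c: "c \<in> charts_at A x"
    and \<xi>: "\<xi> \<in> tangent_space (tangent_atlas A) (x, u)"
    and k: "\<And>y v. (y, v) \<in> carrier (tangent_atlas A) \<Longrightarrow> k (y, v) = h y"
    and h: "(h \<circ> cinv c) differentiable (at (snd c x))"
  shows "tderiv (tangent_atlas A) k (x, u) \<xi> = FD (h \<circ> cinv c) (snd c x) (fst (\<xi> (tangent_chart A c)))"
proof -
  interpret TM: smooth_atlas "tangent_atlas A" by (rule tangent_atlas_smooth_atlas)
  let ?C = "tangent_chart A c" and ?S = "(snd c ` fst c) \<times> (UNIV :: 'e set)"
  have cA: "c \<in> A" "x \<in> fst c" using c by (auto simp: charts_at_iff)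
  have ch: "?C \<in> charts_at (tangent_atlas A) (x, u)"
    using c u by (simp add: charts_at_tangent_atlas)
  have o: "open ?S" using chart_image_open[OF cA(1)] by (simp add: open_Times)
  have "((\<lambda>p::'e\<times>'e. (h \<circ> cinv c) (fst p)) has_derivative (\<lambda>q. FD (h \<circ> cinv c) (snd c x) (fst q)))
      (at (snd c x, u c))"
    by (rule has_derivative_compose[of fst fst _ _ "h \<circ> cinv c"])
       (use has_FD[OF h] has_derivative_fst[OF has_derivative_ident] in \<open>auto simp del: o_apply\<close>)
  then have D: "((k \<circ> cinv ?C) has_derivative (\<lambda>q. FD (h \<circ> cinv c) (snd c x) (fst q))) (at (snd c x, u c))"
  proof (rule has_derivative_transform_within_open[OF _ o])
    fix p assume "p \<in> ?S"
    then obtain y w where p: "y \<in> fst c" "p = (snd c y, w)" by auto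
    have cy: "c \<in> charts_at A y" using p cA by (simp add: charts_at_iff)
    have "(y, coord_vec A c y w) \<in> carrier (tangent_atlas A)"
      using coord_vec_in_tangent_space[OF cy] charts_at_carrier[OF cy] by (simp add: carrier_tangent_atlas)
    then show "(h \<circ> cinv c) (fst p) = (k \<circ> cinv ?C) p"
      using p cA by (simp add: cinv_tangent_chart k)
  qed (use cA in auto)
  then have "(k \<circ> cinv ?C) differentiable (at (snd ?C (x, u)))" by (auto intro: differentiableI)
  from TM.tderiv_chart[OF ch \<xi> this] FD_eqI[OF D] show ?thesis by simp
qed

end

section \<open>Extending tangent vectors to vector fields\<close>

locale smooth_mfd =
  fixes T :: "'a topology" and A :: "('a, 'e::euclidean_space) atlas"
  assumes mfd: "smooth_manifold T A"
begin

lemma chart_homeo: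
  assumes "c \<in> A"
  shows "openin T (fst c)" "open (snd c ` fst c)"
    "homeomorphic_map (subtopology T (fst c)) (top_of_set (snd c ` fst c)) (snd c)"
    "topspace (subtopology T (fst c)) = fst c"
  using mfd assms by (auto simp: smooth_manifold_def topspace_subtopology_subset dest: openin_subset)

lemma chart_open_image:
  assumes "c \<in> A" "openin T U"
  shows "open (snd c ` (fst c \<inter> U))"
proof -
  have "openin (subtopology T (fst c)) (fst c \<inter> U)"
    using assms by (metis inf_commute openin_subtopology_Int)
  then have "openin (top_of_set (snd c ` fst c)) (snd c ` (fst c \<inter> U))"
    using homeomorphic_map_openness_eq[OF chart_homeo(3)[OF assms(1)]] by blast
  then show ?thesis using chart_homeo(2)[OF assms(1)] by (simp add: openin_open_eq)
qed

sublocale smooth_atlas A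
proof
  show "inj_on (snd c) (fst c)" if "c \<in> A" for c
    using homeomorphic_imp_injective_map[OF chart_homeo(3)[OF that]] chart_homeo(4)[OF that] by simp
  show "open (snd c ` (fst c \<inter> fst d))" if "c \<in> A" "d \<in> A" for c d
    by (rule chart_open_image[OF that(1) chart_homeo(1)[OF that(2)]])
  show "smooth_on (snd c ` (fst c \<inter> fst d)) (snd d \<circ> cinv c)" if "c \<in> A" "d \<in> A" for c d
    using mfd that by (simp add: smooth_manifold_def)
qed

text \<open>A bump function times a coordinate field, continued by zero. The support is compact in the chart,
  hence compact in \<open>M\<close>, hence closed because \<open>M\<close> is Hausdorff; so the field vanishes near every point
  outside the chart.\<close>

lemma extend_tangent_vector:
  assumes x: "x \<in> carrier A" and v: "v \<in> tangent_space A x"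
  obtains X where "X \<in> vector_fields A" "X x = v"
proof -
  obtain c where c: "c \<in> charts_at A x" using x by (auto simp: carrier_iff)
  then have cA: "c \<in> A" "x \<in> fst c" by (auto simp: charts_at_iff)
  obtain r where r: "r > 0" "cball (snd c x) r \<subseteq> snd c ` fst c"
    using open_contains_cball chart_image_open[OF cA(1)] cA(2) by (metis imageI)
  define K where "K = fst c \<inter> snd c -` cball (snd c x) r"
  have "snd c ` K = cball (snd c x) r" using r by (auto simp: K_def)
  then have "compactin (top_of_set (snd c ` fst c)) (snd c ` K)"
    using r by (simp add: compactin_subtopology)
  then have "compactin (subtopology T (fst c)) K"
    using homeomorphic_map_compactness[OF chart_homeo(3)[OF cA(1)], of K]
    unfolding chart_homeo(4)[OF cA(1)] by (simp add: K_def)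
  then have "compactin T K" by (simp add: compactin_subtopology)
  then have K: "closedin T K"
    using mfd by (intro compactin_imp_closedin) (auto simp: smooth_manifold_def)
  then have oK: "openin T (topspace T - K)" by blast
  have topT: "topspace T = carrier A" using mfd by (simp add: smooth_manifold_def)
  \<comment> \<open>Normalised so that \<open>\<psi>\<close> is \<open>1\<close> at the given point.\<close>
  define \<psi> where "\<psi> = (\<lambda>z. bump (snd c x) r z / bump (snd c x) r (snd c x))"
  define X where "X = (\<lambda>y. if y \<in> fst c then coord_vec A c y (\<psi> (snd c y) *\<^sub>R v c) else 0)"
  have \<psi>x: "\<psi> (snd c x) = 1" using bump_centre[OF r(1), of "snd c x"] by (simp add: \<psi>_def)
  have \<psi>0: "\<psi> (snd c y) = 0" if "y \<in> fst c" "y \<notin> K" for y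
    using that bump_outside[OF r(1), of "snd c y" "snd c x"] by (simp add: K_def \<psi>_def)
  have \<psi>s: "smooth_on S \<psi>" if "open S" for S
    unfolding \<psi>_def divide_inverse
    by (intro smooth_on_mult smooth_bump smooth_on_const that)
  have X0: "X y = 0" if "y \<notin> K" for y
  proof (cases "y \<in> fst c")
    case True
    then have "X y = coord_vec A c y 0" using \<psi>0[OF True that] by (simp add: X_def)
    also have "\<dots> = 0"
      using coord_vec_component[OF zero_in_tangent_space, of c y] cA True by (simp add: charts_at_iff)
    finally show ?thesis .
  qed (simp add: X_def)
  have "X \<in> vector_fields A"
    unfolding vector_fields_def
  proof (intro CollectI conjI ballI allI impI)
    fix y show "X y \<in> tangent_space A y"
      using coord_vec_in_tangent_space zero_in_tangent_space cA by (auto simp: X_def charts_at_iff)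
  next
    fix y assume "y \<notin> carrier A"
    then show "X y = 0" using cA by (auto simp: X_def carrier_def)
  next
    fix d assume d: "d \<in> A"
    show "smooth_on (snd d ` fst d) (\<lambda>z. X (cinv d z) d)"
    proof (rule smooth_on_local)
      fix z assume "z \<in> snd d ` fst d"
      then obtain y where y: "y \<in> fst d" "z = snd d y" by auto
      show "\<exists>U. open U \<and> z \<in> U \<and> smooth_on U (\<lambda>z. X (cinv d z) d)"
      proof (cases "y \<in> fst c")
        case True
        let ?U = "snd d ` (fst d \<inter> fst c)" and ?V = "snd c ` (fst c \<inter> fst d)"
        have U: "open ?U" and V: "open ?V" using overlap_open d cA by auto
        have s: "smooth_on ?U (snd c \<circ> cinv d)" by (rule transition_smooth[OF d cA(1)])
        have "smooth_on ?V (\<lambda>z. FD (snd d \<circ> cinv c) z (\<psi> z *\<^sub>R v c))"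
          by (intro smooth_on_FD_apply transition_smooth smooth_on_scaleR smooth_on_const V \<psi>s d cA)
        then have "smooth_on ?U (\<lambda>z. FD (snd d \<circ> cinv c) ((snd c \<circ> cinv d) z) (\<psi> ((snd c \<circ> cinv d) z) *\<^sub>R v c))"
          by (rule smooth_on_compose[OF U V _ s]) (use d cA in auto)
        then have "smooth_on ?U (\<lambda>z. X (cinv d z) d)"
          by (rule smooth_on_cong[OF U]) (use d cA in \<open>auto simp: X_def coord_vec_def charts_at_iff\<close>)
        then show ?thesis using U y True by blast
      next
        case False
        let ?U = "snd d ` (fst d \<inter> (topspace T - K))"
        have U: "open ?U" by (rule chart_open_image[OF d oK])
        have "smooth_on ?U (\<lambda>z. X (cinv d z) d)"
          by (rule smooth_on_cong[OF U smooth_on_const[of _ 0]]) (use d X0 in auto)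
        moreover have "z \<in> ?U" using y d False by (auto simp: K_def topT carrier_def)
        ultimately show ?thesis using U by blast
      qed
    qed
  qed
  moreover have "X x = v" using cA \<psi>x coord_vec_component[OF v c] by (simp add: X_def)
  ultimately show thesis by (rule that)
qed

end

section \<open>Bilinear forms with smooth coefficients\<close>

text \<open>In a chart the metric and the Christoffel symbols are of this kind; the form is allowed to depend on
  a parameter from a different space than its arguments, because the horizontal lift involves the
  Christoffel symbols as functions of the base and the fibre coordinates.\<close>

locale smooth_bilinear =
  fixes S :: "'p::euclidean_space set" and B :: "'p \<Rightarrow> 'v::euclidean_space \<Rightarrow> 'v \<Rightarrow> 'w::real_normed_vector"
  assumes dom: "open S"
    and lin1: "z \<in> S \<Longrightarrow> linear (\<lambda>a. B z a b)"
    and lin2: "z \<in> S \<Longrightarrow> linear (\<lambda>b. B z a b)"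
    and smooth_basis: "i \<in> Basis \<Longrightarrow> j \<in> Basis \<Longrightarrow> smooth_on S (\<lambda>z. B z i j)"
begin

lemma expand1: "z \<in> S \<Longrightarrow> B z a b = (\<Sum>i\<in>Basis. (a \<bullet> i) *\<^sub>R B z i b)"
  using linear_sum[OF lin1, of z "\<lambda>i. (a \<bullet> i) *\<^sub>R i" Basis b] linear_scale[OF lin1, of z]
  by (simp add: euclidean_representation)

lemma expand2: "z \<in> S \<Longrightarrow> B z a b = (\<Sum>j\<in>Basis. (b \<bullet> j) *\<^sub>R B z a j)"
  using linear_sum[OF lin2, of z a "\<lambda>i. (b \<bullet> i) *\<^sub>R i" Basis] linear_scale[OF lin2, of z a]
  by (simp add: euclidean_representation)

lemma smooth:
  assumes "smooth_on S a" "smooth_on S b"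
  shows "smooth_on S (\<lambda>z. B z (a z) (b z))"
proof (rule smooth_on_cong[OF dom])
  show "smooth_on S (\<lambda>z. \<Sum>i\<in>Basis. (a z \<bullet> i) *\<^sub>R (\<Sum>j\<in>Basis. (b z \<bullet> j) *\<^sub>R B z i j))"
    by (intro smooth_on_sum smooth_on_scaleR smooth_on_inner smooth_on_const smooth_basis dom assms)
  show "(\<Sum>i\<in>Basis. (a z \<bullet> i) *\<^sub>R (\<Sum>j\<in>Basis. (b z \<bullet> j) *\<^sub>R B z i j)) = B z (a z) (b z)"
    if "z \<in> S" for z
    by (simp only: expand2[OF that, symmetric] expand1[OF that, symmetric])
qed

lemmas smooth_const = smooth[OF smooth_on_const smooth_on_const]

lemma has_FD_const: "z \<in> S \<Longrightarrow> ((\<lambda>z. B z a b) has_derivative FD (\<lambda>z. B z a b) z) (at z)"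
  by (intro has_FD smooth_on_differentiable[OF smooth_const])

lemma FD_expand1: "z \<in> S \<Longrightarrow> FD (\<lambda>z. B z a b) z v = (\<Sum>i\<in>Basis. (a \<bullet> i) *\<^sub>R FD (\<lambda>z. B z i b) z v)"
proof -
  assume z: "z \<in> S"
  have "FD (\<lambda>z. B z a b) z = FD (\<lambda>z. \<Sum>i\<in>Basis. (a \<bullet> i) *\<^sub>R B z i b) z"
    by (rule FD_cong[OF dom z]) (rule expand1)
  also have "\<dots> = (\<lambda>v. \<Sum>i\<in>Basis. (a \<bullet> i) *\<^sub>R FD (\<lambda>z. B z i b) z v)"
    by (intro FD_eqI has_derivative_sum has_derivative_scaleR_right has_FD_const z)
  finally show ?thesis by simp
qed

lemma FD_expand2: "z \<in> S \<Longrightarrow> FD (\<lambda>z. B z a b) z v = (\<Sum>j\<in>Basis. (b \<bullet> j) *\<^sub>R FD (\<lambda>z. B z a j) z v)"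
proof -
  assume z: "z \<in> S"
  have "FD (\<lambda>z. B z a b) z = FD (\<lambda>z. \<Sum>j\<in>Basis. (b \<bullet> j) *\<^sub>R B z a j) z"
    by (rule FD_cong[OF dom z]) (rule expand2)
  also have "\<dots> = (\<lambda>v. \<Sum>j\<in>Basis. (b \<bullet> j) *\<^sub>R FD (\<lambda>z. B z a j) z v)"
    by (intro FD_eqI has_derivative_sum has_derivative_scaleR_right has_FD_const z)
  finally show ?thesis by simp
qed

lemma linear_FD0: "z \<in> S \<Longrightarrow> linear (FD (\<lambda>z. B z a b) z)"
  by (rule has_derivative_linear[OF has_FD_const])

lemma linear_FD1: "z \<in> S \<Longrightarrow> linear (\<lambda>a. FD (\<lambda>z. B z a b) z v)"
proof -
  assume z: "z \<in> S"
  have "linear (\<lambda>a. \<Sum>i\<in>Basis. (a \<bullet> i) *\<^sub>R FD (\<lambda>z. B z i b) z v)"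
    by (intro linearI) (simp_all add: inner_add_left scaleR_add_left sum.distrib scaleR_sum_right)
  then show ?thesis by (simp only: FD_expand1[OF z, symmetric])
qed

lemma linear_FD2: "z \<in> S \<Longrightarrow> linear (\<lambda>b. FD (\<lambda>z. B z a b) z v)"
proof -
  assume z: "z \<in> S"
  have "linear (\<lambda>b. \<Sum>j\<in>Basis. (b \<bullet> j) *\<^sub>R FD (\<lambda>z. B z a j) z v)"
    by (intro linearI) (simp_all add: inner_add_left scaleR_add_left sum.distrib scaleR_sum_right)
  then show ?thesis by (simp only: FD_expand2[OF z, symmetric])
qed

lemma has_derivative:
  assumes z: "z \<in> S" and a: "(a has_derivative a') (at z)" and b: "(b has_derivative b') (at z)"
  shows "((\<lambda>y. B y (a y) (b y)) has_derivative
    (\<lambda>v. FD (\<lambda>y. B y (a z) (b z)) z v + B z (a' v) (b z) + B z (a z) (b' v))) (at z)"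
proof -
  have i: "((\<lambda>y. c y \<bullet> i) has_derivative (\<lambda>v. c' v \<bullet> i)) (at z)"
    if "(c has_derivative c') (at z)" for c c' and i :: 'v
    using that by (rule has_derivative_inner_left)
  have "((\<lambda>y. \<Sum>i\<in>Basis. (a y \<bullet> i) *\<^sub>R (\<Sum>j\<in>Basis. (b y \<bullet> j) *\<^sub>R B y i j)) has_derivative
      (\<lambda>v. \<Sum>i\<in>Basis. (a z \<bullet> i) *\<^sub>R (\<Sum>j\<in>Basis. (b z \<bullet> j) *\<^sub>R FD (\<lambda>y. B y i j) z v + (b' v \<bullet> j) *\<^sub>R B z i j)
        + (a' v \<bullet> i) *\<^sub>R (\<Sum>j\<in>Basis. (b z \<bullet> j) *\<^sub>R B z i j))) (at z)"
    by (intro has_derivative_sum has_derivative_scaleR i[OF a] i[OF b] has_FD_const z)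
  then have "((\<lambda>y. \<Sum>i\<in>Basis. (a y \<bullet> i) *\<^sub>R (\<Sum>j\<in>Basis. (b y \<bullet> j) *\<^sub>R B y i j)) has_derivative
      (\<lambda>v. FD (\<lambda>y. B y (a z) (b z)) z v + B z (a z) (b' v) + B z (a' v) (b z))) (at z)"
    by (simp only: sum.distrib scaleR_add_right expand2[OF z, symmetric] FD_expand2[OF z, symmetric]
        expand1[OF z, symmetric] FD_expand1[OF z, symmetric])
  then have "((\<lambda>y. B y (a y) (b y)) has_derivative
      (\<lambda>v. FD (\<lambda>y. B y (a z) (b z)) z v + B z (a z) (b' v) + B z (a' v) (b z))) (at z)"
    by (rule has_derivative_transform_within_open[OF _ dom z])
       (simp only: expand2[symmetric] expand1[symmetric])
  then show ?thesis by (simp add: add.assoc add.commute add.left_commute)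
qed

lemma smooth_bilinear_fst:
  "smooth_bilinear (S \<times> (UNIV :: 'q::euclidean_space set)) (\<lambda>p. B (fst p))"
proof (rule smooth_bilinear.intro)
  show o: "open (S \<times> (UNIV :: 'q set))" using dom by (simp add: open_Times)
  fix i j :: 'v assume "i \<in> Basis" "j \<in> Basis"
  then show "smooth_on (S \<times> (UNIV :: 'q set)) (\<lambda>p. B (fst p) i j)"
    by (intro smooth_on_compose[OF o dom smooth_basis smooth_on_bounded_linear[OF bounded_linear_fst]]) auto
qed (auto intro: lin1 lin2)

lemma FD_fst:
  assumes "z \<in> S"
  shows "FD (\<lambda>p. B (fst p) a b) (z, w :: 'q::euclidean_space) q = FD (\<lambda>z. B z a b) z (fst q)"
proof -
  have "((\<lambda>p. B (fst p) a b) has_derivative (\<lambda>q. FD (\<lambda>z. B z a b) z (fst q))) (at (z, w))"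
    by (rule has_derivative_compose[of fst fst _ _ "\<lambda>y. B y a b"])
       (use has_FD_const[OF assms] has_derivative_fst[OF has_derivative_ident] in auto)
  then show ?thesis by (simp add: FD_eqI)
qed

end

section \<open>The Levi-Civita connection in coordinates\<close>

text \<open>Contracting the Christoffel symbols with vectors gives a bilinear map with values in vectors, which can be
  differentiated and composed without indices.\<close>

definition christoffel_map ::
    "('a, 'e::euclidean_space) atlas \<Rightarrow> ('a, 'e) metric \<Rightarrow> ('a, 'e) chart \<Rightarrow> 'e \<Rightarrow> 'e \<Rightarrow> 'e \<Rightarrow> 'e"
  where "christoffel_map A g c z a b = (\<Sum>i\<in>Basis. \<Sum>j\<in>Basis. \<Sum>k\<in>Basis.
    ((a \<bullet> i) * (b \<bullet> j) * christoffel A g c i j k z) *\<^sub>R k)"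

context smooth_atlas
begin

lemma linear_coord_vec:
  assumes "c \<in> charts_at A x"
  shows "coord_vec A c x (a + b) = coord_vec A c x a + coord_vec A c x b"
    and "coord_vec A c x (r *\<^sub>R a) = r *\<^sub>R coord_vec A c x a"
    and "a \<noteq> 0 \<Longrightarrow> coord_vec A c x a \<noteq> 0"
proof -
  show "coord_vec A c x (a + b) = coord_vec A c x a + coord_vec A c x b"
    by (rule tangent_vector_eqI[OF _ _ assms])
       (use assms in \<open>auto intro: add_in_tangent_space coord_vec_in_tangent_space\<close>)
  show "coord_vec A c x (r *\<^sub>R a) = r *\<^sub>R coord_vec A c x a"
    by (rule tangent_vector_eqI[OF _ _ assms])
       (use assms in \<open>auto intro: scaleR_in_tangent_space coord_vec_in_tangent_space\<close>, simp add: scaleR_fun_def)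
  show "coord_vec A c x a \<noteq> 0" if "a \<noteq> 0"
    using that coord_vec_self[OF assms, of a] by (metis zero_fun_apply)
qed

context
  fixes g :: "('a, 'e) metric" and x :: 'a
  assumes metric: "riemannian_metric A g" and x: "x \<in> carrier A"
begin

lemma metric_sym: "u \<in> tangent_space A x \<Longrightarrow> v \<in> tangent_space A x \<Longrightarrow> g x u v = g x v u"
  using metric x unfolding riemannian_metric_def by blast

lemma metric_pos: "u \<in> tangent_space A x \<Longrightarrow> u \<noteq> 0 \<Longrightarrow> g x u u > 0"
  using metric x unfolding riemannian_metric_def by blast

lemma metric_add:
  assumes "u \<in> tangent_space A x" "v \<in> tangent_space A x" "w \<in> tangent_space A x"
  shows "g x (u + v) w = g x u w + g x v w" "g x w (u + v) = g x w u + g x w v"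
proof -
  show *: "g x (u + v) w = g x u w + g x v w"
    using metric x assms unfolding riemannian_metric_def by blast
  show "g x w (u + v) = g x w u + g x w v"
    using * assms metric_sym add_in_tangent_space by metis
qed

lemma metric_scaleR:
  assumes "u \<in> tangent_space A x" "w \<in> tangent_space A x"
  shows "g x (r *\<^sub>R u) w = r * g x u w" "g x w (r *\<^sub>R u) = r * g x w u"
proof -
  show *: "g x (r *\<^sub>R u) w = r * g x u w"
    using metric x assms unfolding riemannian_metric_def by blast
  show "g x w (r *\<^sub>R u) = r * g x w u"
    using * assms metric_sym scaleR_in_tangent_space by metis
qed

lemma metric_diff:
  assumes "u \<in> tangent_space A x" "v \<in> tangent_space A x" "w \<in> tangent_space A x"
  shows "g x (u - v) w = g x u w - g x v w" "g x w (u - v) = g x w u - g x w v"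
  using metric_add[of "u - v" v w] diff_in_tangent_space[OF assms(1,2)] assms by simp_all

lemma metric_minus:
  "u \<in> tangent_space A x \<Longrightarrow> w \<in> tangent_space A x \<Longrightarrow> g x (- u) w = - g x u w"
  using metric_scaleR(1)[of u w "-1"] by simp

end

end

text \<open>Extends identities between Christoffel symbols and derivatives of metric coefficients from basis
  vectors to all vectors.\<close>

lemma linear3_eqI:
  fixes F G :: "'v::euclidean_space \<Rightarrow> 'v \<Rightarrow> 'v \<Rightarrow> real"
  assumes "\<And>b w. linear (\<lambda>a. F a b w)" "\<And>a w. linear (\<lambda>b. F a b w)" "\<And>a b. linear (\<lambda>w. F a b w)"
    and "\<And>b w. linear (\<lambda>a. G a b w)" "\<And>a w. linear (\<lambda>b. G a b w)" "\<And>a b. linear (\<lambda>w. G a b w)"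
    and eq: "\<And>i j l. i \<in> Basis \<Longrightarrow> j \<in> Basis \<Longrightarrow> l \<in> Basis \<Longrightarrow> F i j l = G i j l"
  shows "F a b w = G a b w"
proof -
  have 1: "F i j w = G i j w" if "i \<in> Basis" "j \<in> Basis" for i j w
    using linear_eq_stdbasis[OF assms(3,6)] eq that by (metis (no_types, lifting))
  have 2: "F i b w = G i b w" if "i \<in> Basis" for i b w
    using fun_cong[OF linear_eq_stdbasis[OF assms(2,5)], of i w i w b] 1[OF that] by blast
  show ?thesis
    using fun_cong[OF linear_eq_stdbasis[OF assms(1,4)], of b w b w a] 2 by blast
qed

locale riemannian = smooth_mfd T A for T :: "'a topology" and A :: "('a, 'e::euclidean_space) atlas" +
  fixes g :: "('a, 'e) metric"
  assumes metric: "riemannian_metric A g"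
begin

abbreviation gc :: "('a, 'e) chart \<Rightarrow> 'e \<Rightarrow> 'e \<Rightarrow> 'e \<Rightarrow> real"
  where "gc c z a b \<equiv> metric_coeff A g c a b z"

abbreviation \<Gamma> :: "('a, 'e) chart \<Rightarrow> 'e \<Rightarrow> 'e \<Rightarrow> 'e \<Rightarrow> 'e"
  where "\<Gamma> \<equiv> christoffel_map A g"

lemma gc_eq:
  assumes "c \<in> charts_at A x" "v \<in> tangent_space A x" "w \<in> tangent_space A x"
  shows "g x v w = gc c (snd c x) (v c) (w c)"
  using assms by (simp add: metric_coeff_def charts_at_iff coord_vec_component)

lemma gc_rules:
  assumes c: "c \<in> A" and z: "z \<in> snd c ` fst c"
  shows "gc c z a b = gc c z b a" "linear (\<lambda>a. gc c z a b)" "linear (\<lambda>b. gc c z a b)"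
    "a \<noteq> 0 \<Longrightarrow> gc c z a a > 0"
proof -
  obtain x where x: "x \<in> fst c" "z = snd c x" using z by auto
  then have cx: "c \<in> charts_at A x" using c by (simp add: charts_at_iff)
  note cv = coord_vec_in_tangent_space[OF cx] and xA = charts_at_carrier[OF cx]
  have e: "gc c z a b = g x (coord_vec A c x a) (coord_vec A c x b)" for a b
    using x c by (simp add: metric_coeff_def)
  show sym: "gc c z a b = gc c z b a" for a b
    unfolding e by (rule metric_sym[OF metric xA cv cv])
  show lin: "linear (\<lambda>a. gc c z a b)" for b
    by (rule linearI)
       (simp_all add: e linear_coord_vec[OF cx] metric_add(1)[OF metric xA cv cv cv] metric_scaleR(1)[OF metric xA cv cv])
  show "linear (\<lambda>b. gc c z a b)" using lin[of a] by (subst sym)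
  show "gc c z a a > 0" if "a \<noteq> 0"
    unfolding e by (rule metric_pos[OF metric xA cv linear_coord_vec(3)[OF cx that]])
qed

lemma gc_smooth_bilinear:
  assumes "c \<in> A"
  shows "smooth_bilinear (snd c ` fst c) (gc c)"
proof (rule smooth_bilinear.intro)
  fix i j :: 'e assume "i \<in> Basis" "j \<in> Basis"
  then have "smooth_on (snd c ` fst c) (metric_coeff A g c i j)"
    using conjunct2[OF metric[unfolded riemannian_metric_def]] assms by blast
  then show "smooth_on (snd c ` fst c) (\<lambda>z. gc c z i j)" by simp
qed (use assms in \<open>auto intro: chart_image_open gc_rules(2,3)\<close>)

lemma gc_nondegenerate:
  assumes c: "c \<in> A" and z: "z \<in> snd c ` fst c" and eq: "\<And>j. j \<in> Basis \<Longrightarrow> gc c z a j = gc c z b j"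
  shows "a = b"
proof -
  have "(\<lambda>w. gc c z a w) = (\<lambda>w. gc c z b w)"
    by (rule linear_eq_stdbasis[OF gc_rules(3)[OF c z] gc_rules(3)[OF c z] eq])
  then have "gc c z (a - b) (a - b) = 0"
    using linear_diff[OF gc_rules(2)[OF c z], of a b "a - b"] by (metis diff_self)
  then show ?thesis using gc_rules(4)[OF c z, of "a - b"] by force
qed

text \<open>A linear system whose matrix is the metric: raising an index of smooth covector components yields
  smooth components.\<close>

lemma gc_solution:
  assumes c: "c \<in> A" and b: "\<And>j. j \<in> Basis \<Longrightarrow> smooth_on (snd c ` fst c) (b j)"
  obtains v where "smooth_on (snd c ` fst c) v"
    "\<And>z j. z \<in> snd c ` fst c \<Longrightarrow> j \<in> Basis \<Longrightarrow> gc c z (v z) j = b j z"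
proof -
  interpret gb: smooth_bilinear "snd c ` fst c" "gc c" by (rule gc_smooth_bilinear[OF c])
  show thesis
    by (rule smooth_positive_definite_solution[where S = "snd c ` fst c" and G = "gc c" and b = b])
       (use gb.dom gb.smooth_basis gc_rules[OF c] b that in auto)
qed

text \<open>Left inverses of the matrix of the metric exist because the rows of an inverse are the solutions
  for the unit vectors on the right-hand side.\<close>

lemma inverse_metric:
  assumes c: "c \<in> A" and z: "z \<in> snd c ` fst c" and "a \<in> Basis" "b \<in> Basis"
  shows "(\<Sum>m\<in>Basis. inverse_metric_coeff A g c a m z * gc c z m b) = (if a = b then 1 else 0)"
proof -
  interpret gb: smooth_bilinear "snd c ` fst c" "gc c" by (rule gc_smooth_bilinear[OF c])
  have "\<exists>v. \<forall>j\<in>Basis. gc c z v j = (if k = j then 1 else 0)" for k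
    using gc_solution[OF c smooth_on_const, of "\<lambda>j. if k = j then 1 else 0"] z by metis
  then obtain v where v: "\<And>k j. j \<in> Basis \<Longrightarrow> gc c z (v k) j = (if k = j then 1 else 0)" by metis
  have "\<exists>h. \<forall>a\<in>Basis. \<forall>b\<in>Basis. (\<Sum>m\<in>Basis. h a m * gc c z m b) = (if a = b then 1 else 0)"
    by (intro exI[of _ "\<lambda>a m. v a \<bullet> m"]) (use gb.expand1[OF z, of "v _"] v in simp)
  from someI_ex[OF this] assms(3,4) show ?thesis unfolding inverse_metric_coeff_def by blast
qed

text \<open>Raising the last index of the Christoffel symbols of the first kind: any \<open>v\<close> whose lowered
  components are these symbols has the Christoffel symbols of the second kind as its components.
  This replaces the inverse matrix in their definition by an equation for \<open>v\<close>.\<close>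

lemma christoffel_solution:
  assumes c: "c \<in> A" and z: "z \<in> snd c ` fst c" and k: "k \<in> Basis"
    and v: "\<And>l. l \<in> Basis \<Longrightarrow> gc c z v l = 1/2 *
       (FD (metric_coeff A g c j l) z i + FD (metric_coeff A g c i l) z j - FD (metric_coeff A g c i j) z l)"
  shows "christoffel A g c i j k z = v \<bullet> k"
proof -
  interpret gb: smooth_bilinear "snd c ` fst c" "gc c" by (rule gc_smooth_bilinear[OF c])
  let ?h = "\<lambda>l. inverse_metric_coeff A g c k l z"
  have "christoffel A g c i j k z = (\<Sum>l\<in>Basis. ?h l * gc c z v l)"
    unfolding christoffel_def by (rule sum.cong) (simp_all add: v)
  also have "\<dots> = (\<Sum>l\<in>Basis. \<Sum>m\<in>Basis. (v \<bullet> m) * (?h l * gc c z l m))"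
  proof (rule sum.cong[OF refl])
    fix l
    have "gc c z v l = (\<Sum>m\<in>Basis. (v \<bullet> m) * gc c z m l)" using gb.expand1[OF z, of v l] by simp
    also have "\<dots> = (\<Sum>m\<in>Basis. (v \<bullet> m) * gc c z l m)"
      by (rule sum.cong[OF refl]) (simp only: gc_rules(1)[OF c z, of _ l])
    finally show "?h l * gc c z v l = (\<Sum>m\<in>Basis. (v \<bullet> m) * (?h l * gc c z l m))"
      by (simp add: sum_distrib_left mult.left_commute)
  qed
  also have "\<dots> = (\<Sum>m\<in>Basis. (v \<bullet> m) * (\<Sum>l\<in>Basis. ?h l * gc c z l m))"
    by (subst sum.swap) (simp add: sum_distrib_left)
  also have "\<dots> = (\<Sum>m\<in>Basis. (v \<bullet> m) * (if k = m then 1 else 0))"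
    by (rule sum.cong) (simp_all add: inverse_metric[OF c z k])
  also have "\<dots> = v \<bullet> k" using k by (simp add: if_distrib cong: if_cong)
  finally show ?thesis .
qed

lemma christoffel_linear: "linear (\<lambda>a. \<Gamma> c z a b)" "linear (\<lambda>b. \<Gamma> c z a b)"
  unfolding christoffel_map_def
  by (rule linearI; simp add: inner_add_left algebra_simps sum.distrib scaleR_sum_right)+

lemma christoffel_basis:
  assumes "i \<in> Basis" "j \<in> Basis"
  shows "\<Gamma> c z i j = (\<Sum>k\<in>Basis. christoffel A g c i j k z *\<^sub>R k)"
proof -
  have "\<Gamma> c z i j = (\<Sum>i'\<in>Basis. \<Sum>j'\<in>Basis. if j' = j then (if i' = i then
      (\<Sum>k\<in>Basis. christoffel A g c i j k z *\<^sub>R k) else 0) else 0)"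
    unfolding christoffel_map_def
    by (intro sum.cong refl) (use assms in \<open>auto simp: inner_Basis\<close>)
  then show ?thesis using assms by simp
qed

text \<open>The Christoffel symbols are the unique solution of a system with smooth positive definite
  coefficients; the system itself is the coordinate form of the Koszul formula.\<close>

lemma christoffel_smooth_and_koszul:
  assumes c: "c \<in> A"
  shows "smooth_bilinear (snd c ` fst c) (\<Gamma> c)"
    and "z \<in> snd c ` fst c \<Longrightarrow> 2 * gc c z (\<Gamma> c z a b) w =
      FD (\<lambda>z. gc c z b w) z a + FD (\<lambda>z. gc c z a w) z b - FD (\<lambda>z. gc c z a b) z w"
proof -
  let ?S = "snd c ` fst c"
  interpret gb: smooth_bilinear ?S "gc c" by (rule gc_smooth_bilinear[OF c])
  let ?k = "\<lambda>i j l z. 1/2 * (FD (metric_coeff A g c j l) z i + FD (metric_coeff A g c i l) z j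
      - FD (metric_coeff A g c i j) z l)"
  have sol: "smooth_on ?S (\<lambda>z. \<Gamma> c z i j) \<and> (\<forall>z\<in>?S. \<forall>l\<in>Basis. gc c z (\<Gamma> c z i j) l = ?k i j l z)"
    if ij: "i \<in> Basis" "j \<in> Basis" for i j
  proof -
    have "smooth_on ?S (?k i j l)" for l
      by (intro smooth_on_mult smooth_on_diff smooth_on_add smooth_on_const smooth_on_FD gb.smooth_const gb.dom)
    then obtain v where v: "smooth_on ?S v" "\<And>z l. z \<in> ?S \<Longrightarrow> l \<in> Basis \<Longrightarrow> gc c z (v z) l = ?k i j l z"
      using gc_solution[OF c, of "?k i j"] by blast
    have e: "v z = \<Gamma> c z i j" if "z \<in> ?S" for z
    proof -
      have "\<Gamma> c z i j = (\<Sum>k\<in>Basis. (v z \<bullet> k) *\<^sub>R k)"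
        unfolding christoffel_basis[OF ij]
        by (rule sum.cong) (simp_all add: christoffel_solution[OF c that _ v(2)[OF that]])
      then show ?thesis by (simp add: euclidean_representation)
    qed
    show ?thesis using smooth_on_cong[OF gb.dom v(1) e] v(2) e by simp
  qed
  show "smooth_bilinear ?S (\<Gamma> c)"
    by (rule smooth_bilinear.intro) (use sol christoffel_linear gb.dom in blast)+
  show "2 * gc c z (\<Gamma> c z a b) w =
      FD (\<lambda>z. gc c z b w) z a + FD (\<lambda>z. gc c z a w) z b - FD (\<lambda>z. gc c z a b) z w" if z: "z \<in> ?S"
  proof (rule linear3_eqI[of "\<lambda>a b w. 2 * gc c z (\<Gamma> c z a b) w"
        "\<lambda>a b w. FD (\<lambda>z. gc c z b w) z a + FD (\<lambda>z. gc c z a w) z b - FD (\<lambda>z. gc c z a b) z w"])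
    show "linear (\<lambda>a. 2 * gc c z (\<Gamma> c z a b) w)" for b w
      using linear_compose[OF linear_compose[OF christoffel_linear(1) gc_rules(2)[OF c z]] linear_times[of 2]]
      by (simp add: o_def)
    show "linear (\<lambda>b. 2 * gc c z (\<Gamma> c z a b) w)" for a w
      using linear_compose[OF linear_compose[OF christoffel_linear(2) gc_rules(2)[OF c z]] linear_times[of 2]]
      by (simp add: o_def)
    show "linear (\<lambda>w. 2 * gc c z (\<Gamma> c z a b) w)" for a b
      using linear_compose[OF gc_rules(3)[OF c z] linear_times[of 2]]
      by (simp add: o_def)
    show "2 * gc c z (\<Gamma> c z i j) l =
      FD (\<lambda>z. gc c z j l) z i + FD (\<lambda>z. gc c z i l) z j - FD (\<lambda>z. gc c z i j) z l"
      if "i \<in> Basis" "j \<in> Basis" "l \<in> Basis" for i j l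
      using bspec[OF bspec[OF conjunct2[OF sol[OF that(1,2)]] z] that(3)] by simp
  qed (intro linear_compose_sub linear_compose_add gb.linear_FD0 gb.linear_FD1 gb.linear_FD2 z)+
qed

lemma FD_gc_sym:
  assumes "c \<in> A" "z \<in> snd c ` fst c"
  shows "FD (\<lambda>z. gc c z a b) z v = FD (\<lambda>z. gc c z b a) z v"
  using FD_cong[OF chart_image_open[OF assms(1)] assms(2), of "\<lambda>z. gc c z a b" "\<lambda>z. gc c z b a"]
    gc_rules(1)[OF assms(1)] by simp

lemma christoffel_sym:
  assumes "c \<in> A" "z \<in> snd c ` fst c"
  shows "\<Gamma> c z a b = \<Gamma> c z b a"
proof (rule gc_nondegenerate[OF assms])
  fix w
  show "gc c z (\<Gamma> c z a b) w = gc c z (\<Gamma> c z b a) w"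
    using christoffel_smooth_and_koszul(2)[OF assms, of a b w] christoffel_smooth_and_koszul(2)[OF assms, of b a w]
      FD_gc_sym[OF assms, of a b w] by simp
qed

lemma christoffel_metric:
  assumes "c \<in> A" "z \<in> snd c ` fst c"
  shows "FD (\<lambda>z. gc c z a b) z v = gc c z (\<Gamma> c z v a) b + gc c z a (\<Gamma> c z v b)"
  using christoffel_smooth_and_koszul(2)[OF assms, of v a b] christoffel_smooth_and_koszul(2)[OF assms, of v b a]
    FD_gc_sym[OF assms, of a b v] gc_rules(1)[OF assms, of a "\<Gamma> c z v b"] by simp

end

locale riemannian_connection = riemannian T A g
  for T :: "'a topology" and A :: "('a, 'e::euclidean_space) atlas" and g :: "('a, 'e) metric" +
  fixes D :: "('a, 'e) connection"
  assumes lc: "levi_civita A g D"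
begin

lemma D_in_vector_fields: "X \<in> vector_fields A \<Longrightarrow> Y \<in> vector_fields A \<Longrightarrow> D X Y \<in> vector_fields A"
  using lc by (simp add: levi_civita_def affine_connection_def)

lemma D_torsion_free:
  "X \<in> vector_fields A \<Longrightarrow> Y \<in> vector_fields A \<Longrightarrow> x \<in> carrier A \<Longrightarrow>
    D X Y x - D Y X x = lie_bracket A X Y x"
  using lc by (simp add: levi_civita_def)

lemma D_metric:
  "X \<in> vector_fields A \<Longrightarrow> Y \<in> vector_fields A \<Longrightarrow> Z \<in> vector_fields A \<Longrightarrow> x \<in> carrier A \<Longrightarrow>
    tderiv A (\<lambda>y. g y (Y y) (Z y)) x (X x) = g x (D X Y x) (Z x) + g x (Y x) (D X Z x)"
  using lc by (simp add: levi_civita_def)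

lemma has_derivative_metric_fields:
  assumes Y: "Y \<in> vector_fields A" and Z: "Z \<in> vector_fields A" and c: "c \<in> charts_at A x"
  shows "(((\<lambda>y. g y (Y y) (Z y)) \<circ> cinv c) has_derivative (\<lambda>v.
    gc c (snd c x) (\<Gamma> c (snd c x) v (Y x c) + FD (\<lambda>z. Y (cinv c z) c) (snd c x) v) (Z x c) +
    gc c (snd c x) (Y x c) (\<Gamma> c (snd c x) v (Z x c) + FD (\<lambda>z. Z (cinv c z) c) (snd c x) v))) (at (snd c x))"
proof -
  have cA: "c \<in> A" "x \<in> fst c" using c by (auto simp: charts_at_iff)
  let ?S = "snd c ` fst c" and ?z = "snd c x"
  interpret gb: smooth_bilinear ?S "gc c" by (rule gc_smooth_bilinear[OF cA(1)])
  have z: "?z \<in> ?S" using cA by simp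
  have "((\<lambda>z. gc c z (Y (cinv c z) c) (Z (cinv c z) c)) has_derivative (\<lambda>v.
    gc c ?z (\<Gamma> c ?z v (Y x c) + FD (\<lambda>z. Y (cinv c z) c) ?z v) (Z x c) +
    gc c ?z (Y x c) (\<Gamma> c ?z v (Z x c) + FD (\<lambda>z. Z (cinv c z) c) ?z v))) (at ?z)"
    using gb.has_derivative[OF z has_FD[OF field_differentiable[OF Y c]] has_FD[OF field_differentiable[OF Z c]]]
      cA christoffel_metric[OF cA(1) z]
    by (simp add: linear_add[OF gc_rules(2)[OF cA(1) z]] linear_add[OF gc_rules(3)[OF cA(1) z]] algebra_simps)
  then show ?thesis
  proof (rule has_derivative_transform_within_open[OF _ gb.dom z])
    fix y assume "y \<in> ?S"
    then obtain q where "q \<in> fst c" "y = snd c q" by auto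
    then show "gc c y (Y (cinv c y) c) (Z (cinv c y) c) = ((\<lambda>y. g y (Y y) (Z y)) \<circ> cinv c) y"
      using cA gc_eq[of c q "Y q" "Z q"] vector_fieldsD(4)[OF Y, of c q] vector_fieldsD(4)[OF Z, of c q]
      by (simp add: charts_at_iff)
  qed
qed

text \<open>The difference \<open>N\<close> between \<open>D\<close> and its coordinate expression is symmetric (no torsion), and skew
  in the last two arguments after lowering its index (metric); such an \<open>N\<close> vanishes.\<close>

lemma D_chart:
  assumes X: "X \<in> vector_fields A" and Y: "Y \<in> vector_fields A" and c: "c \<in> charts_at A x"
  shows "D X Y x c = FD (\<lambda>z. Y (cinv c z) c) (snd c x) (X x c) + \<Gamma> c (snd c x) (X x c) (Y x c)"
proof -
  have cA: "c \<in> A" "x \<in> fst c" using c by (auto simp: charts_at_iff)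
  have xA: "x \<in> carrier A" by (rule charts_at_carrier[OF c])
  let ?S = "snd c ` fst c" and ?z = "snd c x"
  have z: "?z \<in> ?S" using cA by simp
  define N where "N = (\<lambda>X Y. D X Y x c - FD (\<lambda>z. Y (cinv c z) c) ?z (X x c) - \<Gamma> c ?z (X x c) (Y x c))"
  note lin = linear_diff[OF gc_rules(2)[OF cA(1) z]] linear_diff[OF gc_rules(3)[OF cA(1) z]]
    linear_add[OF gc_rules(2)[OF cA(1) z]] linear_add[OF gc_rules(3)[OF cA(1) z]]
  have sym: "N X Y = N Y X" if "X \<in> vector_fields A" "Y \<in> vector_fields A" for X Y
    using D_torsion_free[OF that xA] fun_cong[OF D_torsion_free[OF that xA], of c] c
      christoffel_sym[OF cA(1) z, of "X x c" "Y x c"]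
    by (simp add: N_def lie_bracket_def algebra_simps)
  have skew: "gc c ?z (N X Y) (Z x c) + gc c ?z (N X Z) (Y x c) = 0"
    if X: "X \<in> vector_fields A" and Y: "Y \<in> vector_fields A" and Z: "Z \<in> vector_fields A" for X Y Z
  proof -
    note d = has_derivative_metric_fields[OF Y Z c]
    have "tderiv A (\<lambda>y. g y (Y y) (Z y)) x (X x)
        = FD ((\<lambda>y. g y (Y y) (Z y)) \<circ> cinv c) ?z (X x c)"
      by (rule tderiv_chart[OF c vector_fieldsD(4)[OF X c] differentiableI[OF d]])
    moreover have "g x (D X Y x) (Z x) = gc c ?z (D X Y x c) (Z x c)"
      "g x (Y x) (D X Z x) = gc c ?z (Y x c) (D X Z x c)"
      using X Y Z c by (auto intro!: gc_eq D_in_vector_fields intro: vector_fieldsD(4)[OF _ c])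
    ultimately show ?thesis
      using D_metric[OF X Y Z xA] FD_eqI[OF d] gc_rules(1)[OF cA(1) z, of "N X Z" "Y x c"]
      by (simp add: N_def lin)
  qed
  \<comment> \<open>The three skew symmetries, cyclically permuted, force \<open>g(N(X, Y), Z)\<close> to equal its negative.\<close>
  have 0: "gc c ?z (N X Y) (Z x c) = 0" if Z: "Z \<in> vector_fields A" for Z
    using skew[OF X Y Z] skew[OF Z X Y] skew[OF Y Z X] sym[OF X Y] sym[OF Y Z] sym[OF Z X] by simp
  have "N X Y = 0"
  proof (rule ccontr)
    assume ne: "N X Y \<noteq> 0"
    obtain Z where "Z \<in> vector_fields A" "Z x = coord_vec A c x (N X Y)"
      using extend_tangent_vector[OF xA coord_vec_in_tangent_space[OF c]] by metis
    with 0[of Z] gc_rules(4)[OF cA(1) z ne] c show False by simp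
  qed
  then show ?thesis by (simp add: N_def algebra_simps)
qed

text \<open>The two sides compare the components of the tangent vector \<open>\<nabla>\<^sub>X Y\<close> in two charts. The inhomogeneous
  second-order term comes from differentiating the identity \<open>Y\<^sub>d \<circ> \<tau> = D\<tau>(Y\<^sub>c)\<close>, where \<open>\<tau>\<close> is the
  coordinate change.\<close>

lemma christoffel_transform:
  assumes c: "c \<in> charts_at A x" and d: "d \<in> charts_at A x"
    and v: "v \<in> tangent_space A x" and w: "w \<in> tangent_space A x"
  shows "\<Gamma> d (snd d x) (v d) (w d) = jac c d x (\<Gamma> c (snd c x) (v c) (w c))
    - FD (\<lambda>z. FD (snd d \<circ> cinv c) z (w c)) (snd c x) (v c)"
proof -
  have cA: "c \<in> A" "x \<in> fst c" "d \<in> A" "x \<in> fst d" using c d by (auto simp: charts_at_iff)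
  have xA: "x \<in> carrier A" by (rule charts_at_carrier[OF c])
  let ?F = "snd d \<circ> cinv c" and ?S = "snd c ` (fst c \<inter> fst d)"
  have S: "open ?S" "snd c x \<in> ?S" using cA overlap_open by auto
  obtain X where X: "X \<in> vector_fields A" "X x = v" using extend_tangent_vector[OF xA v] .
  obtain Y where Y: "Y \<in> vector_fields A" "Y x = w" using extend_tangent_vector[OF xA w] .
  have DXY: "D X Y x \<in> tangent_space A x"
    by (rule vector_fieldsD(4)[OF D_in_vector_fields[OF X(1) Y(1)] c])
  let ?Y = "\<lambda>e z. Y (cinv e z) e"
  have d1: "((\<lambda>z. FD ?F z (?Y c z)) has_derivative
      (\<lambda>a. FD (\<lambda>z. FD ?F z (?Y c (snd c x))) (snd c x) a + jac c d x (FD (?Y c) (snd c x) a))) (at (snd c x))"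
    by (rule has_derivative_FD_apply[OF S(1) transition_smooth[OF cA(1,3)] S(2) field_differentiable[OF Y(1) c]])
  have d2: "((\<lambda>z. FD ?F z (?Y c z)) has_derivative (\<lambda>a. FD (?Y d) (snd d x) (jac c d x a))) (at (snd c x))"
  proof (rule has_derivative_transform_within_open[OF _ S])
    show "((\<lambda>z. ?Y d (?F z)) has_derivative (\<lambda>a. FD (?Y d) (snd d x) (jac c d x a))) (at (snd c x))"
      by (rule has_derivative_compose[OF has_FD[OF transition_differentiable[OF c d]]])
         (use has_FD[OF field_differentiable[OF Y(1) d]] cA in simp)
    fix z assume "z \<in> ?S"
    then obtain q where q: "q \<in> fst c" "q \<in> fst d" "z = snd c q" by auto
    then have "c \<in> charts_at A q" "d \<in> charts_at A q" using cA by (auto simp: charts_at_iff)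
    then show "?Y d (?F z) = FD ?F z (?Y c z)"
      using tangent_space_jac[OF vector_fieldsD(4)[OF Y(1)], of c q c d] q cA by simp
  qed
  have e: "FD (?Y d) (snd d x) (jac c d x a)
      = FD (\<lambda>z. FD ?F z (w c)) (snd c x) a + jac c d x (FD (?Y c) (snd c x) a)" for a
    using fun_cong[OF has_derivative_unique[OF d2 d1], of a] cA Y by simp
  have "D X Y x d = jac c d x (D X Y x c)" by (rule tangent_space_jac[OF DXY c d])
  then show ?thesis
    using e[of "v c"] X Y tangent_space_jac[OF v c d]
    by (simp add: D_chart[OF X(1) Y(1) c] D_chart[OF X(1) Y(1) d] linear_add[OF linear_jac[OF c d]] algebra_simps)
qed

end

section \<open>Curvature and gradient\<close>

text \<open>The classical expression for the components of \<open>R(a, b)w\<close> through the Christoffel symbols.\<close>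

definition curvature_coord ::
    "('a, 'e::euclidean_space) atlas \<Rightarrow> ('a, 'e) metric \<Rightarrow> ('a, 'e) chart \<Rightarrow> 'e \<Rightarrow> 'e \<Rightarrow> 'e \<Rightarrow> 'e \<Rightarrow> 'e"
  where "curvature_coord A g c z a b w =
    FD (\<lambda>z. christoffel_map A g c z b w) z a - FD (\<lambda>z. christoffel_map A g c z a w) z b
    + christoffel_map A g c z a (christoffel_map A g c z b w) - christoffel_map A g c z b (christoffel_map A g c z a w)"

context smooth_atlas
begin

lemma diff_in_vector_fields:
  assumes X: "X \<in> vector_fields A" and Y: "Y \<in> vector_fields A"
  shows "X - Y \<in> vector_fields A"
  unfolding vector_fields_def
proof (intro CollectI conjI ballI allI impI)
  show "(X - Y) x \<in> tangent_space A x" if "x \<in> carrier A" for x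
    using diff_in_tangent_space vector_fieldsD(1)[OF X that] vector_fieldsD(1)[OF Y that] by simp
  show "(X - Y) x = 0" if "x \<notin> carrier A" for x
    using vector_fieldsD(2)[OF X that] vector_fieldsD(2)[OF Y that] by simp
  show "smooth_on (snd c ` fst c) (\<lambda>z. (X - Y) (cinv c z) c)" if "c \<in> A" for c
    using smooth_on_diff[OF chart_image_open vector_fieldsD(3)[OF X] vector_fieldsD(3)[OF Y]] that by simp
qed

end

context riemannian
begin

abbreviation Rc :: "('a, 'e) chart \<Rightarrow> 'e \<Rightarrow> 'e \<Rightarrow> 'e \<Rightarrow> 'e \<Rightarrow> 'e"
  where "Rc \<equiv> curvature_coord A g"

lemma christoffel_bilinear: "c \<in> A \<Longrightarrow> smooth_bilinear (snd c ` fst c) (\<Gamma> c)"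
  by (rule christoffel_smooth_and_koszul(1))

lemma FD_christoffel_sym:
  assumes "c \<in> A" "z \<in> snd c ` fst c"
  shows "FD (\<lambda>z. \<Gamma> c z a b) z v = FD (\<lambda>z. \<Gamma> c z b a) z v"
  using FD_cong[OF chart_image_open[OF assms(1)] assms(2), of "\<lambda>z. \<Gamma> c z a b" "\<lambda>z. \<Gamma> c z b a"]
    christoffel_sym[OF assms(1)] by simp

text \<open>The cyclic sum cancels in pairs because \<open>\<Gamma>\<close> is symmetric in its two arguments.\<close>

lemma Rc_bianchi:
  assumes "c \<in> A" "z \<in> snd c ` fst c"
  shows "Rc c z a b w + Rc c z b w a + Rc c z w a b = 0"
  using FD_christoffel_sym[OF assms, of b w a] FD_christoffel_sym[OF assms, of a w b] FD_christoffel_sym[OF assms, of a b w]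
    christoffel_sym[OF assms, of b w] christoffel_sym[OF assms, of a w] christoffel_sym[OF assms, of a b]
  by (simp add: curvature_coord_def)

text \<open>Compatibility with the metric is differentiated once more; the second derivatives of the metric
  coefficients are symmetric.\<close>

lemma Rc_skew:
  assumes c: "c \<in> A" and z: "z \<in> snd c ` fst c"
  shows "gc c z (Rc c z a b v) w + gc c z v (Rc c z a b w) = 0"
proof -
  let ?S = "snd c ` fst c"
  interpret gb: smooth_bilinear ?S "gc c" by (rule gc_smooth_bilinear[OF c])
  interpret Gb: smooth_bilinear ?S "\<Gamma> c" by (rule christoffel_bilinear[OF c])
  have e: "FD (\<lambda>y. FD (\<lambda>z. gc c z v w) y a) z b =
      gc c z (\<Gamma> c z b (\<Gamma> c z a v)) w + gc c z (\<Gamma> c z a v) (\<Gamma> c z b w)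
      + gc c z (\<Gamma> c z b v) (\<Gamma> c z a w) + gc c z v (\<Gamma> c z b (\<Gamma> c z a w))
      + gc c z (FD (\<lambda>y. \<Gamma> c y a v) z b) w + gc c z v (FD (\<lambda>y. \<Gamma> c y a w) z b)" for a b
  proof -
    have "FD (\<lambda>y. FD (\<lambda>z. gc c z v w) y a) z
        = FD (\<lambda>y. gc c y (\<Gamma> c y a v) w + gc c y v (\<Gamma> c y a w)) z"
      by (rule FD_cong[OF gb.dom z]) (rule christoffel_metric[OF c])
    also have "\<dots> = (\<lambda>b. (FD (\<lambda>y. gc c y (\<Gamma> c z a v) w) z b + gc c z (FD (\<lambda>y. \<Gamma> c y a v) z b) w
          + gc c z (\<Gamma> c z a v) 0)
        + (FD (\<lambda>y. gc c y v (\<Gamma> c z a w)) z b + gc c z 0 (\<Gamma> c z a w)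
          + gc c z v (FD (\<lambda>y. \<Gamma> c y a w) z b)))"
      by (intro FD_eqI has_derivative_add gb.has_derivative[OF z] Gb.has_FD_const z has_derivative_const)
    finally show ?thesis
      using linear_0[OF gc_rules(2)[OF c z]] linear_0[OF gc_rules(3)[OF c z]]
      by (simp add: christoffel_metric[OF c z])
  qed
  have "FD (\<lambda>y. FD (\<lambda>z. gc c z v w) y a) z b = FD (\<lambda>y. FD (\<lambda>z. gc c z v w) y b) z a"
    by (rule symmetric_second_derivative_real[OF gb.dom gb.smooth_const z])
  then show ?thesis unfolding e
    by (simp add: curvature_coord_def linear_add[OF gc_rules(2)[OF c z]] linear_add[OF gc_rules(3)[OF c z]]
        linear_diff[OF gc_rules(2)[OF c z]] linear_diff[OF gc_rules(3)[OF c z]])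
qed

text \<open>A purely algebraic consequence of the two skew symmetries and of the Bianchi identity, used for all four
  choices of the argument that is left out of the cyclic sum.\<close>

lemma Rc_pair_symmetry:
  assumes c: "c \<in> A" and z: "z \<in> snd c ` fst c"
  shows "gc c z (Rc c z a b w) v = gc c z (Rc c z w v a) b"
proof -
  define K where "K = (\<lambda>a b w v. gc c z (Rc c z a b w) v)"
  have 1: "K a b w v = - K b a w v" for a b w v
  proof -
    have "Rc c z a b w = - Rc c z b a w" by (simp add: curvature_coord_def)
    then show ?thesis using linear_neg[OF gc_rules(2)[OF c z]] by (simp add: K_def)
  qed
  have 2: "K a b w v = - K a b v w" for a b w v
    using Rc_skew[OF c z, of a b w v] gc_rules(1)[OF c z, of w "Rc c z a b v"] by (simp add: K_def)
  have 3: "K a b w v + K b w a v + K w a b v = 0" for a b w v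
    using Rc_bianchi[OF c z, of a b w] linear_add[OF gc_rules(2)[OF c z]] linear_0[OF gc_rules(2)[OF c z]]
    unfolding K_def by metis
  have "K a b w v = K w v a b"
    using 3[of a b w v] 3[of b w v a] 3[of w v a b] 3[of v a b w]
      1[of b w a v] 1[of w a b v] 1[of a v b w] 1[of v b w a] 1[of a b v w] 1[of v w a b] 1[of w v b a]
      2[of a b w v] 2[of b w a v] 2[of w a b v] 2[of v a b w] 2[of b v w a] 2[of v w a b] 2[of w v a b]
      2[of b w v a] 2[of v b w a] 2[of a b v w] 2[of w v b a] 2[of v a w b] 2[of a w v b] 1[of a w v b] 1[of b v a w] 
    by linarith
  then show ?thesis by (simp add: K_def)
qed

end

context riemannian_connection
begin

lemma lie_bracket_in_vector_fields:
  assumes X: "X \<in> vector_fields A" and Y: "Y \<in> vector_fields A"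
  shows "lie_bracket A X Y \<in> vector_fields A"
proof -
  have "lie_bracket A X Y = D X Y - D Y X"
  proof
    fix x show "lie_bracket A X Y x = (D X Y - D Y X) x"
    proof (cases "x \<in> carrier A")
      case True
      then show ?thesis using D_torsion_free[OF X Y] by simp
    next
      case False
      then have "c \<notin> charts_at A x" for c using charts_at_carrier by blast
      then show ?thesis
        using vector_fieldsD(2)[OF D_in_vector_fields[OF X Y] False]
          vector_fieldsD(2)[OF D_in_vector_fields[OF Y X] False]
        by (simp add: lie_bracket_def fun_eq_iff)
    qed
  qed
  then show ?thesis using diff_in_vector_fields D_in_vector_fields X Y by simp
qed

text \<open>The second derivatives of \<open>Z\<close> cancel by their symmetry, the derivatives of \<open>X\<close> and \<open>Y\<close> cancel against
  \<open>\<nabla>\<^bsub>[X,Y]\<^esub> Z\<close>, and the remaining first derivatives of \<open>Z\<close> are symmetric in \<open>X\<close> and \<open>Y\<close>. Only the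
  values of the three fields at the point are left.\<close>

lemma curvature_chart:
  assumes X: "X \<in> vector_fields A" and Y: "Y \<in> vector_fields A" and Z: "Z \<in> vector_fields A"
    and c: "c \<in> charts_at A x"
  shows "curvature A D X Y Z x c = Rc c (snd c x) (X x c) (Y x c) (Z x c)"
proof -
  have cA: "c \<in> A" "x \<in> fst c" using c by (auto simp: charts_at_iff)
  let ?S = "snd c ` fst c" and ?z = "snd c x"
  have z: "?z \<in> ?S" using cA by simp
  interpret Gb: smooth_bilinear ?S "\<Gamma> c" by (rule christoffel_bilinear[OF cA(1)])
  let ?r = "\<lambda>Z z. Z (cinv c z) c"
  have DD: "D X (D Y Z) x c =
      FD (\<lambda>y. FD (?r Z) y (Y x c)) ?z (X x c) + FD (?r Z) ?z (FD (?r Y) ?z (X x c))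
      + FD (\<lambda>z. \<Gamma> c z (Y x c) (Z x c)) ?z (X x c) + \<Gamma> c ?z (FD (?r Y) ?z (X x c)) (Z x c)
      + \<Gamma> c ?z (Y x c) (FD (?r Z) ?z (X x c)) + \<Gamma> c ?z (X x c) (FD (?r Z) ?z (Y x c))
      + \<Gamma> c ?z (X x c) (\<Gamma> c ?z (Y x c) (Z x c))"
    if X: "X \<in> vector_fields A" and Y: "Y \<in> vector_fields A" for X Y
  proof -
    have "FD (?r (D Y Z)) ?z = FD (\<lambda>z. FD (?r Z) z (?r Y z) + \<Gamma> c z (?r Y z) (?r Z z)) ?z"
    proof (rule FD_cong[OF Gb.dom z])
      fix y assume "y \<in> ?S"
      then obtain q where "q \<in> fst c" "y = snd c q" by auto
      then show "?r (D Y Z) y = FD (?r Z) y (?r Y y) + \<Gamma> c y (?r Y y) (?r Z y)"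
        using D_chart[OF Y Z, of c q] cA by (simp add: charts_at_iff)
    qed
    also have "\<dots> = (\<lambda>a. (FD (\<lambda>y. FD (?r Z) y (?r Y ?z)) ?z a + FD (?r Z) ?z (FD (?r Y) ?z a))
       + (FD (\<lambda>y. \<Gamma> c y (?r Y ?z) (?r Z ?z)) ?z a + \<Gamma> c ?z (FD (?r Y) ?z a) (?r Z ?z)
         + \<Gamma> c ?z (?r Y ?z) (FD (?r Z) ?z a)))"
      by (intro FD_eqI has_derivative_add has_derivative_FD_apply[OF Gb.dom vector_fieldsD(3)[OF Z cA(1)] z]
          Gb.has_derivative[OF z] has_FD field_differentiable[OF Y c] field_differentiable[OF Z c])
    finally show ?thesis
      using cA by (simp add: D_chart[OF X D_in_vector_fields[OF Y Z] c] D_chart[OF Y Z c]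
          linear_add[OF christoffel_linear(2)])
  qed
  have L: "lie_bracket A X Y x c = FD (?r Y) ?z (X x c) - FD (?r X) ?z (Y x c)"
    using c by (simp add: lie_bracket_def)
  have "FD (\<lambda>y. FD (?r Z) y (Y x c)) ?z (X x c) = FD (\<lambda>y. FD (?r Z) y (X x c)) ?z (Y x c)"
    by (rule symmetric_second_derivative[OF Gb.dom vector_fieldsD(3)[OF Z cA(1)] z])
  then show ?thesis
    using D_chart[OF lie_bracket_in_vector_fields[OF X Y] Z c]
      linear_diff[OF linear_frechet_derivative[OF field_differentiable[OF Z c]]]
    by (simp add: curvature_def DD[OF X Y] DD[OF Y X] L curvature_coord_def linear_diff[OF christoffel_linear(1)])
qed

text \<open>The coordinate expression involves the fields through their values at \<open>x\<close> only. So the curvature does not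
  depend on the extensions, and the definite description denotes its value.\<close>

lemma curvature_at_tensor:
  assumes x: "x \<in> carrier A"
    and abw: "a \<in> tangent_space A x" "b \<in> tangent_space A x" "w \<in> tangent_space A x"
  shows "curvature_at A D x a b w \<in> tangent_space A x"
    and "\<And>c. c \<in> charts_at A x \<Longrightarrow> curvature_at A D x a b w c = Rc c (snd c x) (a c) (b c) (w c)"
proof -
  obtain X where X: "X \<in> vector_fields A" "X x = a" using extend_tangent_vector[OF x abw(1)] .
  obtain Y where Y: "Y \<in> vector_fields A" "Y x = b" using extend_tangent_vector[OF x abw(2)] .
  obtain Z where Z: "Z \<in> vector_fields A" "Z x = w" using extend_tangent_vector[OF x abw(3)] .
  have T: "curvature A D X Y Z x \<in> tangent_space A x"
    if "X \<in> vector_fields A" "Y \<in> vector_fields A" "Z \<in> vector_fields A" for X Y Z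
    unfolding curvature_def
    by (rule vector_fieldsD(1)[OF _ x])
       (intro diff_in_vector_fields D_in_vector_fields lie_bracket_in_vector_fields that)
  obtain c where c: "c \<in> charts_at A x" using x carrier_iff by blast
  have "curvature_at A D x a b w = curvature A D X Y Z x"
    unfolding curvature_at_def
  proof (rule the_equality)
    fix r assume "\<exists>X\<in>vector_fields A. \<exists>Y\<in>vector_fields A. \<exists>Z\<in>vector_fields A.
       X x = a \<and> Y x = b \<and> Z x = w \<and> r = curvature A D X Y Z x"
    then obtain X' Y' Z' where *: "X' \<in> vector_fields A" "Y' \<in> vector_fields A" "Z' \<in> vector_fields A"
      "X' x = a" "Y' x = b" "Z' x = w" "r = curvature A D X' Y' Z' x" by blast
    show "r = curvature A D X Y Z x"
      by (rule tangent_vector_eqI[OF _ T[OF X(1) Y(1) Z(1)] c])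
         (use * T[OF *(1-3)] curvature_chart[OF *(1-3) c] curvature_chart[OF X(1) Y(1) Z(1) c] X Y Z in auto)
  qed (use X Y Z in blast)
  then show "curvature_at A D x a b w \<in> tangent_space A x"
    and "\<And>c. c \<in> charts_at A x \<Longrightarrow> curvature_at A D x a b w c = Rc c (snd c x) (a c) (b c) (w c)"
    using T[OF X(1) Y(1) Z(1)] curvature_chart[OF X(1) Y(1) Z(1)] X Y Z by auto
qed

lemma curvature_pair_symmetry:
  assumes x: "x \<in> carrier A"
    and "a \<in> tangent_space A x" "b \<in> tangent_space A x" "w \<in> tangent_space A x" "v \<in> tangent_space A x"
  shows "g x (curvature_at A D x a b w) v = g x (curvature_at A D x w v a) b"
proof -
  obtain c where c: "c \<in> charts_at A x" using x carrier_iff by blast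
  then have "c \<in> A" "snd c x \<in> snd c ` fst c" by (auto simp: charts_at_iff)
  from Rc_pair_symmetry[OF this] show ?thesis
    using assms c by (simp add: gc_eq curvature_at_tensor)
qed

end

locale riemannian_function = riemannian_connection T A g D
  for T :: "'a topology" and A :: "('a, 'e::euclidean_space) atlas" and g :: "('a, 'e) metric"
    and D :: "('a, 'e) connection" +
  fixes f :: "'a \<Rightarrow> real"
  assumes smooth_f: "smooth_function A f"
begin

abbreviation grad :: "'a \<Rightarrow> ('a, 'e) tvec"
  where "grad \<equiv> gradient A g f"

lemma f_chart: "c \<in> A \<Longrightarrow> smooth_on (snd c ` fst c) (f \<circ> cinv c)"
  using smooth_f by (simp add: smooth_function_def)

lemma f_differentiable:
  assumes "c \<in> charts_at A x"
  shows "(f \<circ> cinv c) differentiable (at (snd c x))"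
  using assms by (intro smooth_on_differentiable[OF f_chart]) (auto simp: charts_at_iff)

lemma df_chart:
  "c \<in> charts_at A x \<Longrightarrow> v \<in> tangent_space A x \<Longrightarrow> tderiv A f x v = FD (f \<circ> cinv c) (snd c x) (v c)"
  by (rule tderiv_chart[OF _ _ f_differentiable])

text \<open>The gradient is the differential with its index raised, that is, the solution of a linear system
  with the matrix of the metric.\<close>

lemma gradient_solution:
  assumes c: "c \<in> charts_at A x"
    and v: "\<And>j. j \<in> Basis \<Longrightarrow> gc c (snd c x) v j = FD (f \<circ> cinv c) (snd c x) j"
  shows "grad x = coord_vec A c x v"
    and "w \<in> tangent_space A x \<Longrightarrow> g x (grad x) w = tderiv A f x w"
proof -
  have cA: "c \<in> A" "snd c x \<in> snd c ` fst c" using c by (auto simp: charts_at_iff)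
  have x: "x \<in> carrier A" by (rule charts_at_carrier[OF c])
  let ?v = "coord_vec A c x v"
  note vT = coord_vec_in_tangent_space[OF c, of v]
  have "(\<lambda>w. gc c (snd c x) v w) = FD (f \<circ> cinv c) (snd c x)"
    by (rule linear_eq_stdbasis[OF gc_rules(3)[OF cA] linear_frechet_derivative[OF f_differentiable[OF c]] v])
  then have g: "g x ?v w = tderiv A f x w" if "w \<in> tangent_space A x" for w
    using gc_eq[OF c vT that] df_chart[OF c that] c by (metis coord_vec_self)
  have "(THE v. v \<in> tangent_space A x \<and> (\<forall>w\<in>tangent_space A x. g x v w = tderiv A f x w)) = ?v"
  proof (rule the_equality)
    fix v' assume v': "v' \<in> tangent_space A x \<and> (\<forall>w\<in>tangent_space A x. g x v' w = tderiv A f x w)"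
    have "v' c = ?v c"
    proof (rule gc_nondegenerate[OF cA])
      fix j
      show "gc c (snd c x) (v' c) j = gc c (snd c x) (?v c) j"
        using g[OF coord_vec_in_tangent_space[OF c, of j]] v' coord_vec_in_tangent_space[OF c, of j] c
          gc_eq[OF c _ coord_vec_in_tangent_space[OF c, of j], of v']
          gc_eq[OF c vT coord_vec_in_tangent_space[OF c, of j]] by simp
    qed
    then show "v' = ?v" using v' vT c by (intro tangent_vector_eqI) auto
  qed (use g vT in blast)
  then show e: "grad x = ?v" using x by (simp add: gradient_def)
  show "g x (grad x) w = tderiv A f x w" if "w \<in> tangent_space A x"
    unfolding e by (rule g[OF that])
qed

lemma gradient_chart_solution:
  assumes c: "c \<in> A"
  obtains v where "smooth_on (snd c ` fst c) v"
    "\<And>z j. z \<in> snd c ` fst c \<Longrightarrow> j \<in> Basis \<Longrightarrow> gc c z (v z) j = FD (f \<circ> cinv c) z j"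
  using gc_solution[OF c smooth_on_FD[OF f_chart[OF c]], of "\<lambda>j. j"] by blast

lemma gradient_in_vector_fields: "grad \<in> vector_fields A"
  unfolding vector_fields_def
proof (intro CollectI conjI ballI allI impI)
  have sol: "\<exists>v. grad x = coord_vec A c x v" if c: "c \<in> charts_at A x" for c x
  proof -
    have cA: "c \<in> A" "snd c x \<in> snd c ` fst c" using c by (auto simp: charts_at_iff)
    show ?thesis
      using gradient_chart_solution[OF cA(1)] gradient_solution(1)[OF c] cA(2) by metis
  qed
  show "grad x \<in> tangent_space A x" if "x \<in> carrier A" for x
    using that sol coord_vec_in_tangent_space carrier_iff by metis
  show "grad x = 0" if "x \<notin> carrier A" for x using that by (simp add: gradient_def)
  show "smooth_on (snd c ` fst c) (\<lambda>z. grad (cinv c z) c)" if c: "c \<in> A" for c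
  proof -
    obtain v where v: "smooth_on (snd c ` fst c) v"
      "\<And>z j. z \<in> snd c ` fst c \<Longrightarrow> j \<in> Basis \<Longrightarrow> gc c z (v z) j = FD (f \<circ> cinv c) z j"
      using gradient_chart_solution[OF c] by blast
    show ?thesis
    proof (rule smooth_on_cong[OF chart_image_open[OF c] v(1)])
      fix z assume z: "z \<in> snd c ` fst c"
      then obtain q where q: "q \<in> fst c" "z = snd c q" by auto
      then have cq: "c \<in> charts_at A q" using c by (simp add: charts_at_iff)
      have "grad q = coord_vec A c q (v z)"
        by (rule gradient_solution(1)[OF cq]) (use v(2)[OF z] q in simp)
      then show "v z = grad (cinv c z) c" using q c cq by simp
    qed
  qed
qed

lemma gradient_metric:
  assumes x: "x \<in> carrier A" and w: "w \<in> tangent_space A x"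
  shows "g x (grad x) w = tderiv A f x w"
proof -
  obtain c where c: "c \<in> charts_at A x" using x carrier_iff by blast
  then have cA: "c \<in> A" "snd c x \<in> snd c ` fst c" by (auto simp: charts_at_iff)
  show ?thesis
    using gradient_chart_solution[OF cA(1)] gradient_solution(2)[OF c _ w] cA(2) by metis
qed

lemma has_derivative_df_field:
  assumes Z: "Z \<in> vector_fields A" and c: "c \<in> charts_at A x"
  shows "(((\<lambda>y. tderiv A f y (Z y)) \<circ> cinv c) has_derivative
    (\<lambda>a. FD (\<lambda>y. FD (f \<circ> cinv c) y (Z x c)) (snd c x) a
      + FD (f \<circ> cinv c) (snd c x) (FD (\<lambda>z. Z (cinv c z) c) (snd c x) a))) (at (snd c x))"
proof -
  have cA: "c \<in> A" "x \<in> fst c" "snd c x \<in> snd c ` fst c" using c by (auto simp: charts_at_iff)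
  have "((\<lambda>z. FD (f \<circ> cinv c) z (Z (cinv c z) c)) has_derivative
    (\<lambda>a. FD (\<lambda>y. FD (f \<circ> cinv c) y (Z x c)) (snd c x) a
      + FD (f \<circ> cinv c) (snd c x) (FD (\<lambda>z. Z (cinv c z) c) (snd c x) a))) (at (snd c x))"
    using has_derivative_FD_apply[OF chart_image_open[OF cA(1)] f_chart[OF cA(1)] cA(3) field_differentiable[OF Z c]]
      cA by simp
  then show ?thesis
  proof (rule has_derivative_transform_within_open[OF _ chart_image_open[OF cA(1)] cA(3)])
    fix y assume "y \<in> snd c ` fst c"
    then obtain q where q: "q \<in> fst c" "y = snd c q" by auto
    then have cq: "c \<in> charts_at A q" using cA by (simp add: charts_at_iff)
    show "FD (f \<circ> cinv c) y (Z (cinv c y) c) = ((\<lambda>y. tderiv A f y (Z y)) \<circ> cinv c) y"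
      using df_chart[OF cq vector_fieldsD(4)[OF Z cq]] q cA by simp
  qed
qed

text \<open>Differentiate \<open>g(grad f, Z) = Z(f)\<close> along \<open>X\<close>; the derivatives of \<open>Z\<close> cancel against \<open>(\<nabla>\<^sub>X Z)(f)\<close>.
  The remaining expression is visibly symmetric, by symmetry of second derivatives and of \<open>\<Gamma>\<close>.\<close>

lemma hessian_chart:
  assumes X: "X \<in> vector_fields A" and Z: "Z \<in> vector_fields A" and c: "c \<in> charts_at A x"
  shows "g x (D X grad x) (Z x) = FD (\<lambda>y. FD (f \<circ> cinv c) y (Z x c)) (snd c x) (X x c)
    - FD (f \<circ> cinv c) (snd c x) (\<Gamma> c (snd c x) (X x c) (Z x c))"
proof -
  have cA: "c \<in> A" "x \<in> fst c" "snd c x \<in> snd c ` fst c" using c by (auto simp: charts_at_iff)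
  have x: "x \<in> carrier A" by (rule charts_at_carrier[OF c])
  note d = has_derivative_df_field[OF Z c] and XT = vector_fieldsD(4)[OF X c]
  note DXZ = D_in_vector_fields[OF X Z]
  note lin = linear_add[OF linear_frechet_derivative[OF f_differentiable[OF c]]]
  have e: "FD ((\<lambda>y. g y (grad y) (Z y)) \<circ> cinv c) (snd c x) = FD ((\<lambda>y. tderiv A f y (Z y)) \<circ> cinv c) (snd c x)"
  proof (rule FD_cong[OF chart_image_open[OF cA(1)] cA(3)])
    fix y assume "y \<in> snd c ` fst c"
    then obtain q where q: "q \<in> fst c" "y = snd c q" by auto
    then have cq: "c \<in> charts_at A q" using cA by (simp add: charts_at_iff)
    show "((\<lambda>y. g y (grad y) (Z y)) \<circ> cinv c) y = ((\<lambda>y. tderiv A f y (Z y)) \<circ> cinv c) y"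
      using gradient_metric[OF charts_at_carrier[OF cq] vector_fieldsD(4)[OF Z cq]] q cA by simp
  qed
  have "tderiv A (\<lambda>y. g y (grad y) (Z y)) x (X x) = FD ((\<lambda>y. g y (grad y) (Z y)) \<circ> cinv c) (snd c x) (X x c)"
    by (rule tderiv_chart[OF c XT differentiableI[OF has_derivative_metric_fields[OF gradient_in_vector_fields Z c]]])
  then show ?thesis
    using D_metric[OF X gradient_in_vector_fields Z x] gradient_metric[OF x vector_fieldsD(4)[OF DXZ c]]
      df_chart[OF c vector_fieldsD(4)[OF DXZ c]] lin
    by (simp add: e FD_eqI[OF d] D_chart[OF X Z c])
qed

lemma hessian_sym:
  assumes X: "X \<in> vector_fields A" and Z: "Z \<in> vector_fields A" and x: "x \<in> carrier A"
  shows "g x (D X grad x) (Z x) = g x (D Z grad x) (X x)"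
proof -
  obtain c where c: "c \<in> charts_at A x" using x carrier_iff by blast
  then have cA: "c \<in> A" "snd c x \<in> snd c ` fst c" by (auto simp: charts_at_iff)
  show ?thesis
    using symmetric_second_derivative_real[OF chart_image_open[OF cA(1)] f_chart[OF cA(1)] cA(2), of "Z x c" "X x c"]
      christoffel_sym[OF cA, of "X x c" "Z x c"]
    by (simp add: hessian_chart[OF X Z c] hessian_chart[OF Z X c])
qed

lemma derivative_df_field:
  assumes X: "X \<in> vector_fields A" and Z: "Z \<in> vector_fields A" and c: "c \<in> charts_at A x"
  shows "FD ((\<lambda>y. tderiv A f y (Z y)) \<circ> cinv c) (snd c x) (X x c)
    = g x (D X grad x) (Z x) + tderiv A f x (D X Z x)"
  using linear_add[OF linear_frechet_derivative[OF f_differentiable[OF c]]]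
    df_chart[OF c vector_fieldsD(4)[OF D_in_vector_fields[OF X Z] c]]
  by (simp add: FD_eqI[OF has_derivative_df_field[OF Z c]] hessian_chart[OF X Z c] D_chart[OF X Z c])

lemma tderiv_norm_gradient:
  assumes X: "X \<in> vector_fields A" and x: "x \<in> carrier A"
  shows "tderiv A (\<lambda>y. 1 + g y (grad y) (grad y)) x (X x) = 2 * tderiv A f x (D X grad x)"
proof -
  obtain c where c: "c \<in> charts_at A x" using x carrier_iff by blast
  note G = gradient_in_vector_fields and DG = D_in_vector_fields[OF X gradient_in_vector_fields]
  note d = has_derivative_metric_fields[OF G G c]
  have d1: "((\<lambda>y. 1 + g y (grad y) (grad y)) \<circ> cinv c has_derivative
      FD ((\<lambda>y. g y (grad y) (grad y)) \<circ> cinv c) (snd c x)) (at (snd c x))"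
    using has_derivative_add[OF has_derivative_const[of 1] has_FD[OF differentiableI[OF d]]] by (simp add: o_def)
  have "tderiv A (\<lambda>y. 1 + g y (grad y) (grad y)) x (X x) = tderiv A (\<lambda>y. g y (grad y) (grad y)) x (X x)"
    using tderiv_chart[OF c vector_fieldsD(4)[OF X c] differentiableI[OF d1]]
      tderiv_chart[OF c vector_fieldsD(4)[OF X c] differentiableI[OF d]] FD_eqI[OF d1] by simp
  also have "\<dots> = 2 * g x (grad x) (D X grad x)"
    using D_metric[OF X G G x] metric_sym[OF metric x vector_fieldsD(4)[OF DG c] vector_fieldsD(4)[OF G c]]
    by simp
  also have "g x (grad x) (D X grad x) = tderiv A f x (D X grad x)"
    by (rule gradient_metric[OF x vector_fieldsD(4)[OF DG c]])
  finally show ?thesis .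
qed

end

section \<open>The Koszul formula\<close>

context smooth_atlas
begin

text \<open>Expand all three derivatives by compatibility with the metric, and the brackets by torsion-freeness;
  all terms but two equal ones cancel.\<close>

lemma koszul:
  assumes g: "riemannian_metric A g" and lc: "levi_civita A g D"
    and X: "X \<in> vector_fields A" and Y: "Y \<in> vector_fields A" and Z: "Z \<in> vector_fields A"
    and x: "x \<in> carrier A"
  shows "2 * g x (D X Y x) (Z x) =
      tderiv A (\<lambda>y. g y (Y y) (Z y)) x (X x) + tderiv A (\<lambda>y. g y (X y) (Z y)) x (Y x)
    - tderiv A (\<lambda>y. g y (X y) (Y y)) x (Z x)
    + g x (lie_bracket A X Y x) (Z x) - g x (lie_bracket A X Z x) (Y x) - g x (lie_bracket A Y Z x) (X x)"
proof -
  have m: "tderiv A (\<lambda>y. g y (Y y) (Z y)) x (X x) = g x (D X Y x) (Z x) + g x (Y x) (D X Z x)"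
    and t: "lie_bracket A X Y x = D X Y x - D Y X x"
    and T: "D X Y x \<in> tangent_space A x"
    if "X \<in> vector_fields A" "Y \<in> vector_fields A" "Z \<in> vector_fields A" for X Y Z
    using lc that x vector_fieldsD(1)[of "D X Y"] by (auto simp: levi_civita_def affine_connection_def)
  note XT = vector_fieldsD(1)[OF X x] and YT = vector_fieldsD(1)[OF Y x] and ZT = vector_fieldsD(1)[OF Z x]
  show ?thesis
    using metric_sym[OF g x XT T[OF Z Y X]] metric_sym[OF g x XT T[OF Y Z X]]
      metric_sym[OF g x YT T[OF X Z Y]] metric_sym[OF g x YT T[OF Z X Y]]
    by (simp add: m[OF X Y Z] m[OF Y X Z] m[OF Z X Y] t[OF X Y Z] t[OF X Z Y] t[OF Y Z X]
        metric_diff[OF g x T[OF X Y Z] T[OF Y X Z] ZT] metric_diff[OF g x T[OF X Z Y] T[OF Z X Y] YT]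
        metric_diff[OF g x T[OF Y Z X] T[OF Z Y X] XT])
qed

end

section \<open>Horizontal and vertical lifts\<close>

context riemannian_connection
begin

abbreviation TA where "TA \<equiv> tangent_atlas A"
abbreviation tc where "tc \<equiv> tangent_chart A"

sublocale TM: smooth_atlas "tangent_atlas A"
  by (rule tangent_atlas_smooth_atlas)

lemma tc_charts_at: "c \<in> charts_at A x \<Longrightarrow> u \<in> tangent_space A x \<Longrightarrow> tc c \<in> charts_at TA (x, u)"
  by (simp add: charts_at_tangent_atlas)

text \<open>With vanishing base component, the second-order term in the Jacobian of \<open>TM\<close> disappears.\<close>

lemma vlift:
  assumes u: "u \<in> tangent_space A x" and x: "x \<in> carrier A" and v: "v \<in> tangent_space A x"
  shows "vlift A (x, u) v \<in> tangent_space TA (x, u)"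
    and "\<And>c. c \<in> charts_at A x \<Longrightarrow> vlift A (x, u) v (tc c) = (0, v c)"
proof -
  have "(0, v d) = (jac c d x (fst (0, v c)),
      FD (\<lambda>z. FD (snd d \<circ> cinv c) z (u c)) (snd c x) (fst (0, v c)) + jac c d x (snd (0, v c)))"
    if c: "c \<in> charts_at A x" and d: "d \<in> charts_at A x" for c d
  proof -
    have cA: "c \<in> A" "d \<in> A" "snd c x \<in> snd c ` (fst c \<inter> fst d)"
      using c d by (auto simp: charts_at_iff)
    have "linear (FD (\<lambda>z. FD (snd d \<circ> cinv c) z (u c)) (snd c x))"
      by (intro linear_frechet_derivative smooth_on_differentiable[OF smooth_on_FD[OF transition_smooth[OF cA(1,2)]]] cA)
    then show ?thesis
      using linear_0[OF linear_jac[OF c d]] tangent_space_jac[OF v c d] by (simp add: linear_0)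
  qed
  from bundle_vector_THE[OF x u, of "\<lambda>c. (0, v c)", OF this]
  show "vlift A (x, u) v \<in> tangent_space TA (x, u)"
    and "\<And>c. c \<in> charts_at A x \<Longrightarrow> vlift A (x, u) v (tc c) = (0, v c)"
    unfolding vlift_def fst_conv by auto
qed

text \<open>The transformation law of the Christoffel symbols is precisely what makes the components of a
  horizontal lift transform by the Jacobian of \<open>TM\<close>.\<close>

lemma hlift:
  assumes u: "u \<in> tangent_space A x" and x: "x \<in> carrier A" and v: "v \<in> tangent_space A x"
  shows "hlift A g (x, u) v \<in> tangent_space TA (x, u)"
    and "\<And>c. c \<in> charts_at A x \<Longrightarrow> hlift A g (x, u) v (tc c) = (v c, - \<Gamma> c (snd c x) (v c) (u c))"
proof -
  have "(v d, - \<Gamma> d (snd d x) (v d) (u d)) = (jac c d x (fst (v c, - \<Gamma> c (snd c x) (v c) (u c))),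
      FD (\<lambda>z. FD (snd d \<circ> cinv c) z (u c)) (snd c x) (fst (v c, - \<Gamma> c (snd c x) (v c) (u c)))
      + jac c d x (snd (v c, - \<Gamma> c (snd c x) (v c) (u c))))"
    if c: "c \<in> charts_at A x" and d: "d \<in> charts_at A x" for c d
    using christoffel_transform[OF c d v u] tangent_space_jac[OF v c d] linear_neg[OF linear_jac[OF c d]] by simp
  from bundle_vector_THE[OF x u, of "\<lambda>c. (v c, - \<Gamma> c (snd c x) (v c) (u c))", OF this]
  show "hlift A g (x, u) v \<in> tangent_space TA (x, u)"
    and "\<And>c. c \<in> charts_at A x \<Longrightarrow> hlift A g (x, u) v (tc c) = (v c, - \<Gamma> c (snd c x) (v c) (u c))"
    unfolding hlift_def fst_conv snd_conv christoffel_map_def by auto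
qed

lemma lift_field_eq:
  assumes "x \<in> carrier A" "u \<in> tangent_space A x"
  shows "hlift_field A g X (x, u) = hlift A g (x, u) (X x)" "vlift_field A X (x, u) = vlift A (x, u) (X x)"
  using assms by (simp_all add: hlift_field_def vlift_field_def carrier_tangent_atlas)

lemma lift_field_chart:
  assumes X: "X \<in> vector_fields A" and c: "c \<in> A" and z: "z \<in> snd c ` fst c"
  shows "hlift_field A g X (cinv (tc c) (z, w)) (tc c) = (X (cinv c z) c, - \<Gamma> c z (X (cinv c z) c) w)"
    and "vlift_field A X (cinv (tc c) (z, w)) (tc c) = (0, X (cinv c z) c)"
proof -
  obtain q where q: "q \<in> fst c" "z = snd c q" using z by auto
  then have cq: "c \<in> charts_at A q" using c by (simp add: charts_at_iff)
  note qA = charts_at_carrier[OF cq] and cv = coord_vec_in_tangent_space[OF cq, of w]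
    and XT = vector_fieldsD(4)[OF X cq]
  show "hlift_field A g X (cinv (tc c) (z, w)) (tc c) = (X (cinv c z) c, - \<Gamma> c z (X (cinv c z) c) w)"
    using q c cq by (simp add: cinv_tangent_chart lift_field_eq[OF qA cv] hlift(2)[OF cv qA XT cq])
  show "vlift_field A X (cinv (tc c) (z, w)) (tc c) = (0, X (cinv c z) c)"
    using q c cq by (simp add: cinv_tangent_chart lift_field_eq[OF qA cv] vlift(2)[OF cv qA XT cq])
qed

lemma smooth_on_fst_compose:
  assumes "open S" "smooth_on S K"
  shows "smooth_on (S \<times> (UNIV :: 'e set)) (\<lambda>p::'e\<times>'e. K (fst p))"
  by (rule smooth_on_compose[OF _ assms smooth_on_bounded_linear[OF bounded_linear_fst]])
     (use assms in \<open>auto simp: open_Times\<close>)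

lemma lift_fields_in_vector_fields:
  assumes X: "X \<in> vector_fields A"
  shows "hlift_field A g X \<in> vector_fields TA" "vlift_field A X \<in> vector_fields TA"
proof -
  have 1: "hlift_field A g X p \<in> tangent_space TA p" "vlift_field A X p \<in> tangent_space TA p"
    if "p \<in> carrier TA" for p
    using that hlift(1) vlift(1) vector_fieldsD(1)[OF X]
    by (cases p; force simp: carrier_tangent_atlas lift_field_eq)+
  have 2: "hlift_field A g X p = 0" "vlift_field A X p = 0" if "p \<notin> carrier TA" for p
    using that by (simp_all add: hlift_field_def vlift_field_def)
  have 3: "smooth_on (snd C ` fst C) (\<lambda>p. hlift_field A g X (cinv C p) C)"
    "smooth_on (snd C ` fst C) (\<lambda>p. vlift_field A X (cinv C p) C)" if C: "C \<in> TA" for C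
  proof -
    obtain c where c: "c \<in> A" "C = tc c" using C unfolding tangent_atlas_def by blast
    let ?S = "snd c ` fst c"
    have S: "open ?S" by (rule chart_image_open[OF c(1)])
    then have o: "open (?S \<times> (UNIV::'e set))" by (simp add: open_Times)
    interpret Gb: smooth_bilinear ?S "\<Gamma> c" by (rule christoffel_bilinear[OF c(1)])
    interpret Gf: smooth_bilinear "?S \<times> (UNIV::'e set)" "\<lambda>p. \<Gamma> c (fst p)" by (rule Gb.smooth_bilinear_fst)
    note sX = smooth_on_fst_compose[OF S vector_fieldsD(3)[OF X c(1)]]
    show "smooth_on (snd C ` fst C) (\<lambda>p. hlift_field A g X (cinv C p) C)"
      unfolding c(2) tangent_chart_image[OF c(1)]
      by (rule smooth_on_cong[OF o smooth_on_Pair[OF o sX smooth_on_minus[OF o Gf.smooth[OF sX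
                smooth_on_bounded_linear[OF bounded_linear_snd]]]]])
         (auto simp: lift_field_chart[OF X c(1)] c(1))
    show "smooth_on (snd C ` fst C) (\<lambda>p. vlift_field A X (cinv C p) C)"
      unfolding c(2) tangent_chart_image[OF c(1)]
      by (rule smooth_on_cong[OF o smooth_on_Pair[OF o smooth_on_const sX]])
         (auto simp: lift_field_chart[OF X c(1)] c(1))
  qed
  show "hlift_field A g X \<in> vector_fields TA" "vlift_field A X \<in> vector_fields TA"
    unfolding vector_fields_def using 1 2 3 by blast+
qed

lemma FD_lift_fields:
  assumes X: "X \<in> vector_fields A" and c: "c \<in> charts_at A x"
  shows "FD (\<lambda>p. hlift_field A g X (cinv (tc c) p) (tc c)) (snd c x, w) (a, b)
    = (FD (\<lambda>z. X (cinv c z) c) (snd c x) a,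
       - (FD (\<lambda>z. \<Gamma> c z (X x c) w) (snd c x) a + \<Gamma> c (snd c x) (FD (\<lambda>z. X (cinv c z) c) (snd c x) a) w
          + \<Gamma> c (snd c x) (X x c) b))"
    and "FD (\<lambda>p. vlift_field A X (cinv (tc c) p) (tc c)) (snd c x, w) (a, b)
    = (0, FD (\<lambda>z. X (cinv c z) c) (snd c x) a)"
proof -
  let ?S = "snd c ` fst c" and ?X = "\<lambda>z. X (cinv c z) c"
  have cA: "c \<in> A" "x \<in> fst c" "snd c x \<in> ?S" using c by (auto simp: charts_at_iff)
  have S: "open ?S" by (rule chart_image_open[OF cA(1)])
  then have o: "open (?S \<times> (UNIV::'e set))" by (simp add: open_Times)
  have p: "(snd c x, w) \<in> ?S \<times> UNIV" using cA by simp
  interpret Gb: smooth_bilinear ?S "\<Gamma> c" by (rule christoffel_bilinear[OF cA(1)])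
  interpret Gf: smooth_bilinear "?S \<times> (UNIV::'e set)" "\<lambda>p. \<Gamma> c (fst p)" by (rule Gb.smooth_bilinear_fst)
  have dX: "((\<lambda>p::'e\<times>'e. ?X (fst p)) has_derivative (\<lambda>q. FD ?X (snd c x) (fst q))) (at (snd c x, w))"
    by (rule has_derivative_compose[of fst fst _ _ ?X])
       (use has_FD[OF field_differentiable[OF X c]] has_derivative_fst[OF has_derivative_ident] in auto)
  have ds: "(snd has_derivative snd) (at (snd c x, w))"
    by (rule has_derivative_snd[OF has_derivative_ident])
  have "FD (\<lambda>p. hlift_field A g X (cinv (tc c) p) (tc c)) (snd c x, w)
      = FD (\<lambda>p. (?X (fst p), - \<Gamma> c (fst p) (?X (fst p)) (snd p))) (snd c x, w)"
    by (rule FD_cong[OF o p]) (auto simp: lift_field_chart[OF X cA(1)] cA(1))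
  also have "\<dots> = (\<lambda>q. (FD ?X (snd c x) (fst q),
      - (FD (\<lambda>p. \<Gamma> c (fst p) (?X (fst (snd c x, w))) (snd (snd c x, w))) (snd c x, w) q
        + \<Gamma> c (fst (snd c x, w)) (FD ?X (snd c x) (fst q)) (snd (snd c x, w))
        + \<Gamma> c (fst (snd c x, w)) (?X (fst (snd c x, w))) (snd q))))"
    by (intro FD_eqI has_derivative_Pair dX has_derivative_minus Gf.has_derivative[OF p dX ds])
  finally show "FD (\<lambda>p. hlift_field A g X (cinv (tc c) p) (tc c)) (snd c x, w) (a, b)
    = (FD ?X (snd c x) a, - (FD (\<lambda>z. \<Gamma> c z (X x c) w) (snd c x) a
      + \<Gamma> c (snd c x) (FD ?X (snd c x) a) w + \<Gamma> c (snd c x) (X x c) b))"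
    using cA by (simp add: Gb.FD_fst[OF cA(3)])
  have "FD (\<lambda>p. vlift_field A X (cinv (tc c) p) (tc c)) (snd c x, w) = FD (\<lambda>p. (0, ?X (fst p))) (snd c x, w)"
    by (rule FD_cong[OF o p]) (auto simp: lift_field_chart[OF X cA(1)] cA(1))
  also have "\<dots> = (\<lambda>q. (0, FD ?X (snd c x) (fst q)))"
    by (intro FD_eqI has_derivative_Pair dX has_derivative_const)
  finally show "FD (\<lambda>p. vlift_field A X (cinv (tc c) p) (tc c)) (snd c x, w) (a, b)
    = (0, FD ?X (snd c x) a)" by simp
qed

context
  fixes x u
  assumes x: "x \<in> carrier A" and u: "u \<in> tangent_space A x"
begin

text \<open>In a chart \<open>X\<^sup>H = (X, - \<Gamma>(X, w))\<close> and \<open>X\<^sup>V = (0, X)\<close>. For two horizontal lifts, differentiating \<open>\<Gamma>\<close> in the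
  base direction gives the terms \<open>D\<Gamma>\<close> of the curvature, and in the fibre direction, along
  \<open>- \<Gamma>(X, w)\<close>, its quadratic terms.\<close>

lemma lie_bracket_lifts_component:
  assumes X: "X \<in> vector_fields A" and Y: "Y \<in> vector_fields A" and c: "c \<in> charts_at A x"
  shows "lie_bracket TA (hlift_field A g X) (hlift_field A g Y) (x, u) (tc c)
      = (hlift A g (x, u) (D X Y x - D Y X x) - vlift A (x, u) (curvature_at A D x (X x) (Y x) u)) (tc c)"
    and "lie_bracket TA (hlift_field A g X) (vlift_field A Y) (x, u) (tc c) = vlift A (x, u) (D X Y x) (tc c)"
    and "lie_bracket TA (vlift_field A X) (vlift_field A Y) (x, u) (tc c) = 0"
proof -
  have cA: "c \<in> A" "snd c x \<in> snd c ` fst c" using c by (auto simp: charts_at_iff)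
  note XT = vector_fieldsD(4)[OF X c] and YT = vector_fieldsD(4)[OF Y c]
  note DXY = vector_fieldsD(4)[OF D_in_vector_fields[OF X Y] c]
    and DYX = vector_fieldsD(4)[OF D_in_vector_fields[OF Y X] c]
  note H = hlift[OF u x] and V = vlift[OF u x] and L = lift_field_eq[OF x u]
  note R = curvature_at_tensor[OF x XT YT u]
  note F = FD_lift_fields[OF X c] FD_lift_fields[OF Y c]
  note gs = christoffel_sym[OF cA]
  have neg: "\<Gamma> c z a (- b) = - \<Gamma> c z a b" for z a b by (rule linear_neg[OF christoffel_linear(2)])
  have diff: "\<Gamma> c z (a - a') b = \<Gamma> c z a b - \<Gamma> c z a' b" for z a a' b by (rule linear_diff[OF christoffel_linear(1)])
  have FX0: "FD (\<lambda>z. X (cinv c z) c) (snd c x) 0 = 0" and FY0: "FD (\<lambda>z. Y (cinv c z) c) (snd c x) 0 = 0"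
    by (intro linear_0 linear_frechet_derivative field_differentiable[OF _ c] X Y)+
  interpret Gb: smooth_bilinear "snd c ` fst c" "\<Gamma> c" by (rule christoffel_bilinear[OF cA(1)])
  have G0: "FD (\<lambda>z. \<Gamma> c z a b) (snd c x) 0 = 0" for a b by (rule linear_0[OF Gb.linear_FD0[OF cA(2)]])
  show "lie_bracket TA (hlift_field A g X) (hlift_field A g Y) (x, u) (tc c)
      = (hlift A g (x, u) (D X Y x - D Y X x) - vlift A (x, u) (curvature_at A D x (X x) (Y x) u)) (tc c)"
    using gs[of "X x c" "Y x c"]
    by (simp add: lie_bracket_def tc_charts_at[OF c u] L H(2)[OF XT c] H(2)[OF YT c]
        H(2)[OF diff_in_tangent_space[OF DXY DYX] c] V(2)[OF R(1) c] R(2)[OF c] F curvature_coord_def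
        D_chart[OF X Y c] D_chart[OF Y X c] neg diff)
  show "lie_bracket TA (hlift_field A g X) (vlift_field A Y) (x, u) (tc c) = vlift A (x, u) (D X Y x) (tc c)"
    by (simp add: lie_bracket_def tc_charts_at[OF c u] L H(2)[OF XT c] V(2)[OF YT c] V(2)[OF DXY c] F
        D_chart[OF X Y c] FX0 G0 linear_0[OF christoffel_linear(1)])
  show "lie_bracket TA (vlift_field A X) (vlift_field A Y) (x, u) (tc c) = 0"
    by (simp add: lie_bracket_def tc_charts_at[OF c u] L V(2)[OF XT c] V(2)[OF YT c] F FX0 FY0 zero_prod_def)
qed

text \<open>The base components of \<open>\<xi>\<close> determine the horizontal part, and what the latter leaves over is vertical.\<close>

lemma bundle_vector_split:
  assumes \<xi>: "\<xi> \<in> tangent_space TA (x, u)"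
  obtains v w where "v \<in> tangent_space A x" "w \<in> tangent_space A x"
    "\<xi> = hlift A g (x, u) v + vlift A (x, u) w"
proof -
  obtain c where c: "c \<in> charts_at A x" using x carrier_iff by blast
  note H = hlift[OF u x] and V = vlift[OF u x] and cv = coord_vec_in_tangent_space[OF c]
  let ?v = "coord_vec A c x (fst (\<xi> (tc c)))"
  let ?w = "coord_vec A c x (snd (\<xi> (tc c)) + \<Gamma> c (snd c x) (fst (\<xi> (tc c))) (u c))"
  have "\<xi> = hlift A g (x, u) ?v + vlift A (x, u) ?w"
    by (rule TM.tangent_vector_eqI[OF \<xi> TM.add_in_tangent_space[OF H(1)[OF cv] V(1)[OF cv]] tc_charts_at[OF c u]])
       (use c in \<open>simp add: H(2)[OF cv c] V(2)[OF cv c]\<close>)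
  with cv that show thesis by blast
qed

text \<open>All products of lifts of vector fields under \<open>g\<^sup>f\<close> are functions \<open>k\<close> of this kind.\<close>

lemma tderiv_lifts:
  assumes v: "v \<in> tangent_space A x" and c: "c \<in> charts_at A x"
    and k: "\<And>y w. (y, w) \<in> carrier TA \<Longrightarrow> k (y, w) = h y"
    and h: "(h \<circ> cinv c) differentiable (at (snd c x))"
  shows "tderiv TA k (x, u) (hlift A g (x, u) v) = tderiv A h x v"
    and "tderiv TA k (x, u) (vlift A (x, u) v) = 0"
  using tderiv_pullback[OF u c hlift(1)[OF u x v] k h] hlift(2)[OF u x v c] tderiv_chart[OF c v h]
    tderiv_pullback[OF u c vlift(1)[OF u x v] k h] vlift(2)[OF u x v c]
    linear_0[OF linear_frechet_derivative[OF h]] by simp_all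

end

end

section \<open>The Levi-Civita connection of the Mus-gradient metric\<close>

locale mus_gradient = riemannian_function T A g D f
  for T :: "'a topology" and A :: "('a, 'e::euclidean_space) atlas" and g :: "('a, 'e) metric"
    and D :: "('a, 'e) connection" and f :: "'a \<Rightarrow> real" +
  fixes gf :: "('a \<times> ('a, 'e) tvec, 'e \<times> 'e) metric"
    and Df :: "('a \<times> ('a, 'e) tvec, 'e \<times> 'e) connection"
  assumes mus: "mus_gradient_metric A g f gf"
    and lcf: "levi_civita (tangent_atlas A) gf Df"
begin

lemma gf_metric: "riemannian_metric TA gf"
  using mus by (simp add: mus_gradient_metric_def)

lemma Df_in_vector_fields:
  "\<xi> \<in> vector_fields TA \<Longrightarrow> \<eta> \<in> vector_fields TA \<Longrightarrow> Df \<xi> \<eta> \<in> vector_fields TA"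
  using lcf by (simp add: levi_civita_def affine_connection_def)

lemma Df_torsion_free:
  "\<xi> \<in> vector_fields TA \<Longrightarrow> \<eta> \<in> vector_fields TA \<Longrightarrow> p \<in> carrier TA \<Longrightarrow>
    Df \<xi> \<eta> p - Df \<eta> \<xi> p = lie_bracket TA \<xi> \<eta> p"
  using lcf by (simp add: levi_civita_def)

abbreviation hess :: "'a \<Rightarrow> ('a \<Rightarrow> ('a, 'e) tvec) \<Rightarrow> ('a, 'e) tvec \<Rightarrow> real"
  where "hess x X v \<equiv> g x (D X grad x) v"

lemma gf_lift_fields:
  assumes "X \<in> vector_fields A" "Y \<in> vector_fields A" "(y, w) \<in> carrier TA"
  shows "gf (y, w) (hlift_field A g X (y, w)) (hlift_field A g Y (y, w)) = g y (X y) (Y y)"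
    and "gf (y, w) (hlift_field A g X (y, w)) (vlift_field A Y (y, w)) = 0"
    and "gf (y, w) (vlift_field A Y (y, w)) (hlift_field A g X (y, w)) = 0"
    and "gf (y, w) (vlift_field A X (y, w)) (vlift_field A Y (y, w))
      = g y (X y) (Y y) + tderiv A f y (X y) * tderiv A f y (Y y)"
proof -
  have *: "gf (y, w) (hlift_field A g X (y, w)) (hlift_field A g Y (y, w)) = g y (X y) (Y y) \<and>
      gf (y, w) (hlift_field A g X (y, w)) (vlift_field A Y (y, w)) = 0 \<and>
      gf (y, w) (vlift_field A X (y, w)) (vlift_field A Y (y, w))
        = g y (X y) (Y y) + tderiv A f y (X y) * tderiv A f y (Y y)"
    using mus assms unfolding mus_gradient_metric_def by blast
  then show "gf (y, w) (hlift_field A g X (y, w)) (hlift_field A g Y (y, w)) = g y (X y) (Y y)"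
    and hv: "gf (y, w) (hlift_field A g X (y, w)) (vlift_field A Y (y, w)) = 0"
    and "gf (y, w) (vlift_field A X (y, w)) (vlift_field A Y (y, w))
      = g y (X y) (Y y) + tderiv A f y (X y) * tderiv A f y (Y y)" by auto
  show "gf (y, w) (vlift_field A Y (y, w)) (hlift_field A g X (y, w)) = 0"
    using TM.metric_sym[OF gf_metric assms(3) TM.vector_fieldsD(1)[OF _ assms(3)] TM.vector_fieldsD(1)[OF _ assms(3)]]
      hv lift_fields_in_vector_fields assms(1,2) by metis
qed

context
  fixes x u
  assumes x: "x \<in> carrier A" and u: "u \<in> tangent_space A x"
begin

abbreviation H where "H \<equiv> hlift A g (x, u)"
abbreviation V where "V \<equiv> vlift A (x, u)"
abbreviation R where "R \<equiv> curvature_at A D x"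
abbreviation df where "df \<equiv> tderiv A f x"

lemma bundle_point: "(x, u) \<in> carrier TA"
  using x u by (simp add: carrier_tangent_atlas)

lemmas HT = hlift(1)[OF u x] and VT = vlift(1)[OF u x]

text \<open>Lifts of single vectors, by extending them to vector fields, for which \<open>g\<^sup>f\<close> is prescribed.\<close>

lemma gf_lifts:
  assumes v: "v \<in> tangent_space A x" and w: "w \<in> tangent_space A x"
  shows "gf (x, u) (H v) (H w) = g x v w" "gf (x, u) (H v) (V w) = 0" "gf (x, u) (V v) (H w) = 0"
    "gf (x, u) (V v) (V w) = g x v w + df v * df w"
proof -
  obtain X where X: "X \<in> vector_fields A" "X x = v" using extend_tangent_vector[OF x v] .
  obtain Y where Y: "Y \<in> vector_fields A" "Y x = w" using extend_tangent_vector[OF x w] .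
  show "gf (x, u) (H v) (H w) = g x v w" "gf (x, u) (H v) (V w) = 0" "gf (x, u) (V v) (H w) = 0"
    "gf (x, u) (V v) (V w) = g x v w + df v * df w"
    using gf_lift_fields[OF X(1) Y(1) bundle_point] gf_lift_fields(3)[OF Y(1) X(1) bundle_point] X Y
    by (simp_all add: lift_field_eq[OF x u])
qed

text \<open>The difference of \<open>\<xi>\<close> and \<open>\<eta>\<close> is itself a sum of lifts, so it is orthogonal to itself, and \<open>g\<^sup>f\<close>
  is positive definite.\<close>

lemma bundle_vector_eqI:
  assumes \<xi>: "\<xi> \<in> tangent_space TA (x, u)" and \<eta>: "\<eta> \<in> tangent_space TA (x, u)"
    and hor: "\<And>Z. Z \<in> vector_fields A \<Longrightarrow> gf (x, u) \<xi> (H (Z x)) = gf (x, u) \<eta> (H (Z x))"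
    and ver: "\<And>Z. Z \<in> vector_fields A \<Longrightarrow> gf (x, u) \<xi> (V (Z x)) = gf (x, u) \<eta> (V (Z x))"
  shows "\<xi> = \<eta>"
proof (rule ccontr)
  assume ne: "\<xi> \<noteq> \<eta>"
  note d = TM.diff_in_tangent_space[OF \<xi> \<eta>]
  obtain v w where v: "v \<in> tangent_space A x" and w: "w \<in> tangent_space A x" and e: "\<xi> - \<eta> = H v + V w"
    using bundle_vector_split[OF x u d] .
  obtain X where X: "X \<in> vector_fields A" "X x = v" using extend_tangent_vector[OF x v] .
  obtain Y where Y: "Y \<in> vector_fields A" "Y x = w" using extend_tangent_vector[OF x w] .
  have "gf (x, u) (\<xi> - \<eta>) (H v + V w) = 0"
    using hor[OF X(1)] ver[OF Y(1)] X Y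
    by (simp add: TM.metric_add(2)[OF gf_metric bundle_point HT[OF v] VT[OF w] d]
        TM.metric_diff(1)[OF gf_metric bundle_point \<xi> \<eta> HT[OF v]] TM.metric_diff(1)[OF gf_metric bundle_point \<xi> \<eta> VT[OF w]])
  then have "gf (x, u) (\<xi> - \<eta>) (\<xi> - \<eta>) = 0" by (simp only: e)
  then show False using TM.metric_pos[OF gf_metric bundle_point d] ne by simp
qed

lemma lie_bracket_lifts:
  assumes X: "X \<in> vector_fields A" and Y: "Y \<in> vector_fields A"
  shows "lie_bracket TA (hlift_field A g X) (hlift_field A g Y) (x, u)
      = H (D X Y x - D Y X x) - V (R (X x) (Y x) u)"
    and "lie_bracket TA (hlift_field A g X) (vlift_field A Y) (x, u) = V (D X Y x)"
    and "lie_bracket TA (vlift_field A X) (hlift_field A g Y) (x, u) = - V (D Y X x)"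
    and "lie_bracket TA (vlift_field A X) (vlift_field A Y) (x, u) = 0"
proof -
  obtain c where c: "c \<in> charts_at A x" using x carrier_iff by blast
  note t = tc_charts_at[OF c u] and l = lie_bracket_lifts_component[OF x u _ _ c]
  note XT = vector_fieldsD(4)[OF X c] and YT = vector_fieldsD(4)[OF Y c]
  note DXY = vector_fieldsD(4)[OF D_in_vector_fields[OF X Y] c]
    and DYX = vector_fieldsD(4)[OF D_in_vector_fields[OF Y X] c]
  have b: "lie_bracket TA \<xi> \<eta> (x, u) \<in> tangent_space TA (x, u)"
    if "\<xi> \<in> vector_fields TA" "\<eta> \<in> vector_fields TA" for \<xi> \<eta>
    using Df_torsion_free[OF that bundle_point] TM.diff_in_tangent_space Df_in_vector_fields TM.vector_fieldsD(1)[OF _ bundle_point] that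
    by metis
  note L = lift_fields_in_vector_fields
  show "lie_bracket TA (hlift_field A g X) (hlift_field A g Y) (x, u)
      = H (D X Y x - D Y X x) - V (R (X x) (Y x) u)"
    by (rule TM.tangent_vector_eqI[OF b[OF L(1)[OF X] L(1)[OF Y]] TM.diff_in_tangent_space[OF
            HT[OF diff_in_tangent_space[OF DXY DYX]] VT[OF curvature_at_tensor(1)[OF x XT YT u]]] t l(1)[OF X Y]])
  have hv: "lie_bracket TA (hlift_field A g X) (vlift_field A Y) (x, u) = V (D X Y x)"
    if X: "X \<in> vector_fields A" and Y: "Y \<in> vector_fields A" for X Y
    by (rule TM.tangent_vector_eqI[OF b[OF L(1)[OF X] L(2)[OF Y]] VT[OF vector_fieldsD(4)[OF D_in_vector_fields[OF X Y] c]] t l(2)[OF X Y]])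
  show "lie_bracket TA (hlift_field A g X) (vlift_field A Y) (x, u) = V (D X Y x)" by (rule hv[OF X Y])
  show "lie_bracket TA (vlift_field A X) (hlift_field A g Y) (x, u) = - V (D Y X x)"
    using Df_torsion_free[OF L(2)[OF X] L(1)[OF Y] bundle_point] Df_torsion_free[OF L(1)[OF Y] L(2)[OF X] bundle_point] hv[OF Y X]
    by (metis minus_diff_eq)
  show "lie_bracket TA (vlift_field A X) (vlift_field A Y) (x, u) = 0"
    by (rule TM.tangent_vector_eqI[OF b[OF L(2)[OF X] L(2)[OF Y]] TM.zero_in_tangent_space t])
       (simp add: l(3)[OF X Y])
qed

lemma tderiv_gf_lifts:
  assumes X: "X \<in> vector_fields A" and Y: "Y \<in> vector_fields A" and Z: "Z \<in> vector_fields A"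
  shows "tderiv TA (\<lambda>q. gf q (hlift_field A g Y q) (hlift_field A g Z q)) (x, u) (H (X x))
      = g x (D X Y x) (Z x) + g x (Y x) (D X Z x)"
    and "tderiv TA (\<lambda>q. gf q (hlift_field A g Y q) (hlift_field A g Z q)) (x, u) (V (X x)) = 0"
    and "tderiv TA (\<lambda>q. gf q (hlift_field A g Y q) (vlift_field A Z q)) (x, u) (H (X x)) = 0"
    and "tderiv TA (\<lambda>q. gf q (hlift_field A g Y q) (vlift_field A Z q)) (x, u) (V (X x)) = 0"
    and "tderiv TA (\<lambda>q. gf q (vlift_field A Z q) (hlift_field A g Y q)) (x, u) (H (X x)) = 0"
    and "tderiv TA (\<lambda>q. gf q (vlift_field A Z q) (hlift_field A g Y q)) (x, u) (V (X x)) = 0"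
    and "tderiv TA (\<lambda>q. gf q (vlift_field A Y q) (vlift_field A Z q)) (x, u) (H (X x))
      = g x (D X Y x) (Z x) + g x (Y x) (D X Z x)
        + (hess x X (Y x) + df (D X Y x)) * df (Z x) + df (Y x) * (hess x X (Z x) + df (D X Z x))"
    and "tderiv TA (\<lambda>q. gf q (vlift_field A Y q) (vlift_field A Z q)) (x, u) (V (X x)) = 0"
proof -
  obtain c where c: "c \<in> charts_at A x" using x carrier_iff by blast
  note XT = vector_fieldsD(4)[OF X c]
  note d1 = has_derivative_metric_fields[OF Y Z c]
  note 1 = tderiv_lifts[OF x u XT c, where h = "\<lambda>y. g y (Y y) (Z y)", OF gf_lift_fields(1)[OF Y Z] differentiableI[OF d1]]
  show "tderiv TA (\<lambda>q. gf q (hlift_field A g Y q) (hlift_field A g Z q)) (x, u) (H (X x))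
      = g x (D X Y x) (Z x) + g x (Y x) (D X Z x)"
    using 1(1) D_metric[OF X Y Z x] by simp
  show "tderiv TA (\<lambda>q. gf q (hlift_field A g Y q) (hlift_field A g Z q)) (x, u) (V (X x)) = 0"
    by (rule 1(2))
  have d0: "((\<lambda>_. 0::real) \<circ> cinv c) differentiable (at (snd c x))" by (simp add: o_def)
  have 0: "tderiv A (\<lambda>_. 0) x (X x) = 0"
    using tderiv_chart[OF c XT d0] by (simp add: o_def)
  note 2 = tderiv_lifts[OF x u XT c, where h = "\<lambda>y. 0"
      and k = "\<lambda>q. gf q (hlift_field A g Y q) (vlift_field A Z q)", OF gf_lift_fields(2)[OF Y Z] d0]
  note 3 = tderiv_lifts[OF x u XT c, where h = "\<lambda>y. 0"
      and k = "\<lambda>q. gf q (vlift_field A Z q) (hlift_field A g Y q)", OF gf_lift_fields(3)[OF Y Z] d0]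
  show "tderiv TA (\<lambda>q. gf q (hlift_field A g Y q) (vlift_field A Z q)) (x, u) (H (X x)) = 0"
    and "tderiv TA (\<lambda>q. gf q (hlift_field A g Y q) (vlift_field A Z q)) (x, u) (V (X x)) = 0"
    and "tderiv TA (\<lambda>q. gf q (vlift_field A Z q) (hlift_field A g Y q)) (x, u) (H (X x)) = 0"
    and "tderiv TA (\<lambda>q. gf q (vlift_field A Z q) (hlift_field A g Y q)) (x, u) (V (X x)) = 0"
    using 2 3 0 by simp_all
  let ?h = "\<lambda>y. g y (Y y) (Z y) + tderiv A f y (Y y) * tderiv A f y (Z y)"
  let ?Y = "(\<lambda>y. tderiv A f y (Y y)) \<circ> cinv c" and ?Z = "(\<lambda>y. tderiv A f y (Z y)) \<circ> cinv c"
  have dY: "(?Y has_derivative FD ?Y (snd c x)) (at (snd c x))"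
    and dZ: "(?Z has_derivative FD ?Z (snd c x)) (at (snd c x))"
    and dg: "(((\<lambda>y. g y (Y y) (Z y)) \<circ> cinv c) has_derivative FD ((\<lambda>y. g y (Y y) (Z y)) \<circ> cinv c) (snd c x)) (at (snd c x))"
    using has_derivative_df_field[OF Y c] has_derivative_df_field[OF Z c] d1 by (auto intro!: has_FD differentiableI)
  have dh: "(?h \<circ> cinv c has_derivative (\<lambda>a. FD ((\<lambda>y. g y (Y y) (Z y)) \<circ> cinv c) (snd c x) a
      + (?Y (snd c x) * FD ?Z (snd c x) a + FD ?Y (snd c x) a * ?Z (snd c x)))) (at (snd c x))"
    using has_derivative_add[OF dg has_derivative_mult[OF dY dZ]] by (simp add: o_def)
  note 4 = tderiv_lifts[OF x u XT c, where h = ?h, OF gf_lift_fields(4)[OF Y Z] differentiableI[OF dh]]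
  have "tderiv A (\<lambda>y. g y (Y y) (Z y)) x (X x) = FD ((\<lambda>y. g y (Y y) (Z y)) \<circ> cinv c) (snd c x) (X x c)"
    by (rule tderiv_chart[OF c XT differentiableI[OF dg]])
  moreover have "c \<in> A" "x \<in> fst c" using c by (auto simp: charts_at_iff)
  ultimately show "tderiv TA (\<lambda>q. gf q (vlift_field A Y q) (vlift_field A Z q)) (x, u) (H (X x))
      = g x (D X Y x) (Z x) + g x (Y x) (D X Z x)
        + (hess x X (Y x) + df (D X Y x)) * df (Z x) + df (Y x) * (hess x X (Z x) + df (D X Z x))"
    using 4(1) tderiv_chart[OF c XT differentiableI[OF dh]] D_metric[OF X Y Z x]
    by (simp add: FD_eqI[OF dh] derivative_df_field[OF X Y c] derivative_df_field[OF X Z c] del: o_apply)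
       (simp add: algebra_simps)
  show "tderiv TA (\<lambda>q. gf q (vlift_field A Y q) (vlift_field A Z q)) (x, u) (V (X x)) = 0"
    by (rule 4(2))
qed

lemma curvature_tangent:
  "a \<in> tangent_space A x \<Longrightarrow> b \<in> tangent_space A x \<Longrightarrow> w \<in> tangent_space A x \<Longrightarrow> R a b w \<in> tangent_space A x"
  by (rule curvature_at_tensor(1)[OF x])

lemma tangent_D: "X \<in> vector_fields A \<Longrightarrow> Y \<in> vector_fields A \<Longrightarrow> D X Y x \<in> tangent_space A x"
  using vector_fieldsD(1)[OF D_in_vector_fields x] .

lemma tangent_grad: "grad x \<in> tangent_space A x"
  by (rule vector_fieldsD(1)[OF gradient_in_vector_fields x])

lemmas tangent = vector_fieldsD(1)[OF _ x] tangent_D tangent_grad curvature_tangent u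
  gradient_in_vector_fields diff_in_tangent_space scaleR_in_tangent_space add_in_tangent_space

lemmas TM_tangent = HT VT TM.diff_in_tangent_space TM.scaleR_in_tangent_space TM.add_in_tangent_space
  TM.minus_in_tangent_space

lemmas base_metric = metric_add[OF metric x] metric_diff[OF metric x] metric_scaleR[OF metric x]
lemmas bundle_metric = TM.metric_minus[OF gf_metric bundle_point] TM.metric_add[OF gf_metric bundle_point]
  TM.metric_diff[OF gf_metric bundle_point] TM.metric_scaleR[OF gf_metric bundle_point]

lemma Df_tangent:
  "\<xi> \<in> vector_fields TA \<Longrightarrow> \<eta> \<in> vector_fields TA \<Longrightarrow> Df \<xi> \<eta> (x, u) \<in> tangent_space TA (x, u)"
  using TM.vector_fieldsD(1)[OF Df_in_vector_fields bundle_point] .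

lemmas koszul_gf = TM.koszul[OF gf_metric lcf _ _ _ bundle_point]

lemma Df_HH:
  assumes X: "X \<in> vector_fields A" and Y: "Y \<in> vector_fields A"
  shows "Df (hlift_field A g X) (hlift_field A g Y) (x, u) = H (D X Y x) - (1/2) *\<^sub>R V (R (X x) (Y x) u)"
proof (rule bundle_vector_eqI)
  note L = lift_fields_in_vector_fields
  show "Df (hlift_field A g X) (hlift_field A g Y) (x, u) \<in> tangent_space TA (x, u)"
    by (intro Df_tangent L X Y)
  show "H (D X Y x) - (1/2) *\<^sub>R V (R (X x) (Y x) u) \<in> tangent_space TA (x, u)"
    by (intro TM_tangent tangent X Y)
  fix Z assume Z: "Z \<in> vector_fields A"
  show "gf (x, u) (Df (hlift_field A g X) (hlift_field A g Y) (x, u)) (H (Z x))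
      = gf (x, u) (H (D X Y x) - (1/2) *\<^sub>R V (R (X x) (Y x) u)) (H (Z x))"
    using koszul_gf[OF L(1)[OF X] L(1)[OF Y] L(1)[OF Z]]
      metric_sym[OF metric x, of "Y x" "D X Z x"] metric_sym[OF metric x, of "X x" "D Y Z x"]
      metric_sym[OF metric x, of "X x" "D Z Y x"]
    by (simp add: lift_field_eq[OF x u] tderiv_gf_lifts lie_bracket_lifts bundle_metric gf_lifts
        TM_tangent tangent X Y Z base_metric)
  show "gf (x, u) (Df (hlift_field A g X) (hlift_field A g Y) (x, u)) (V (Z x))
      = gf (x, u) (H (D X Y x) - (1/2) *\<^sub>R V (R (X x) (Y x) u)) (V (Z x))"
    using koszul_gf[OF L(1)[OF X] L(1)[OF Y] L(2)[OF Z]]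
    by (simp add: lift_field_eq[OF x u] tderiv_gf_lifts lie_bracket_lifts bundle_metric gf_lifts
        TM_tangent tangent X Y Z field_simps)
qed

text \<open>The product with \<open>Z\<^sup>H\<close> is half of \<open>(g + df \<otimes> df)(R(X, Z)u, Y)\<close>, which the pair symmetry of the
  curvature rewrites as a product of a fixed vector with \<open>Z\<close>.
  The vertical part is \<open>\<nabla>\<^sub>X Y\<close> plus half of the derivative of \<open>g + df \<otimes> df\<close> along \<open>X\<close>, with its index raised by
  \<open>g + df \<otimes> df\<close>; the coefficient of \<open>grad f\<close> is adjusted so that the product with \<open>Z\<^sup>V\<close> is right.\<close>

lemma Df_HV:
  assumes X: "X \<in> vector_fields A" and Y: "Y \<in> vector_fields A"
  defines "\<alpha> \<equiv> \<lambda>y. 1 + g y (grad y) (grad y)"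
  shows "Df (hlift_field A g X) (vlift_field A Y) (x, u) =
           (1/2) *\<^sub>R H (R u (Y x) (X x))
           + (1/2 * df (Y x)) *\<^sub>R H (R u (grad x) (X x))
           + (1/2 * df (Y x)) *\<^sub>R V (D X grad x)
           + V (D X Y x)
           + (1 / (2 * \<alpha> x) * (g x (Y x) (D X grad x) - 1/2 * tderiv A \<alpha> x (X x) * df (Y x))) *\<^sub>R V (grad x)"
    (is "_ = ?rhs")
proof (rule bundle_vector_eqI)
  note L = lift_fields_in_vector_fields
  define \<kappa> where "\<kappa> = 1 / (2 * \<alpha> x) * (g x (Y x) (D X grad x) - 1/2 * tderiv A \<alpha> x (X x) * df (Y x))"
  show "Df (hlift_field A g X) (vlift_field A Y) (x, u) \<in> tangent_space TA (x, u)"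
    by (intro Df_tangent L X Y)
  show "?rhs \<in> tangent_space TA (x, u)"
    by (intro TM_tangent tangent X Y)
  fix Z assume Z: "Z \<in> vector_fields A"
  have G: "df v = g x (grad x) v" if "v \<in> tangent_space A x" for v
    using gradient_metric[OF x that] by simp
  show "gf (x, u) (Df (hlift_field A g X) (vlift_field A Y) (x, u)) (H (Z x)) = gf (x, u) ?rhs (H (Z x))"
  proof -
    have "g x (R (X x) (Z x) u) (Y x) = g x (R u (Y x) (X x)) (Z x)"
      and "g x (R (X x) (Z x) u) (grad x) = g x (R u (grad x) (X x)) (Z x)"
      by (intro curvature_pair_symmetry x tangent X Y Z)+
    moreover have "df (R (X x) (Z x) u) = g x (R (X x) (Z x) u) (grad x)"
      using G metric_sym[OF metric x] by (simp add: tangent X Y Z)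
    ultimately show ?thesis
      using koszul_gf[OF L(1)[OF X] L(2)[OF Y] L(1)[OF Z]]
      by (simp add: lift_field_eq[OF x u] tderiv_gf_lifts lie_bracket_lifts bundle_metric gf_lifts
          TM_tangent tangent X Y Z field_simps)
  qed
  show "gf (x, u) (Df (hlift_field A g X) (vlift_field A Y) (x, u)) (V (Z x)) = gf (x, u) ?rhs (V (Z x))"
  proof -
    have \<alpha>: "\<alpha> x > 0"
    proof -
      have "g x (grad x) (grad x) \<ge> 0"
        using metric_pos[OF metric x tangent_grad] metric_scaleR(1)[OF metric x tangent_grad tangent_grad, of 0]
        by (cases "grad x = 0") auto
      then show ?thesis by (simp add: \<alpha>_def)
    qed
    have d\<alpha>: "tderiv A \<alpha> x (X x) = 2 * df (D X grad x)"
      unfolding \<alpha>_def by (rule tderiv_norm_gradient[OF X x])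
    have k: "2 * \<alpha> x * \<kappa> = g x (Y x) (D X grad x) - df (D X grad x) * df (Y x)"
      using \<alpha> by (simp add: \<kappa>_def d\<alpha> field_simps)
    \<comment> \<open>Lowering the index of \<open>grad f\<close> by \<open>g + df \<otimes> df\<close> multiplies its differential by \<open>\<alpha>\<close>.\<close>
    have gr: "g x (grad x) (Z x) + df (grad x) * df (Z x) = \<alpha> x * df (Z x)"
      by (simp add: G tangent Z \<alpha>_def algebra_simps)
    have s: "g x (Y x) (D X grad x) = hess x X (Y x)" "g x (Y x) (D X Z x) = g x (D X Z x) (Y x)"
      using metric_sym[OF metric x] by (simp_all add: tangent X Y Z)
    have "2 * gf (x, u) (Df (hlift_field A g X) (vlift_field A Y) (x, u)) (V (Z x))
        = 2 * (g x (D X Y x) (Z x) + df (D X Y x) * df (Z x)) + hess x X (Y x) * df (Z x) + df (Y x) * hess x X (Z x)"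
      using koszul_gf[OF L(1)[OF X] L(2)[OF Y] L(2)[OF Z]] s
      by (simp add: lift_field_eq[OF x u] tderiv_gf_lifts lie_bracket_lifts bundle_metric gf_lifts
          TM_tangent tangent X Y Z TM.metric_scaleR[OF gf_metric bundle_point TM.zero_in_tangent_space, of _ 0, simplified] algebra_simps)
    also have "\<dots> = 2 * gf (x, u) ?rhs (V (Z x))"
    proof -
      have "2 * (\<kappa> * (g x (grad x) (Z x) + df (grad x) * df (Z x))) = (2 * \<alpha> x * \<kappa>) * df (Z x)"
        unfolding gr by simp
      then have kk: "2 * (\<kappa> * (g x (grad x) (Z x) + df (grad x) * df (Z x)))
          = (hess x X (Y x) - df (D X grad x) * df (Y x)) * df (Z x)"
        unfolding k s .
      show ?thesis unfolding \<kappa>_def[symmetric]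
        by (simp only: bundle_metric gf_lifts TM_tangent tangent X Y Z ring_distribs)
           (use kk in \<open>simp add: algebra_simps\<close>)
    qed
    finally show ?thesis by simp
  qed
qed

text \<open>Torsion-freeness reduces this to the previous case: the bracket \<open>[Y\<^sup>H, X\<^sup>V] = (\<nabla>\<^sub>Y X)\<^sup>V\<close> removes the term
  \<open>(\<nabla>\<^sub>Y X)\<^sup>V\<close>.\<close>

lemma Df_VH:
  assumes X: "X \<in> vector_fields A" and Y: "Y \<in> vector_fields A"
  defines "\<alpha> \<equiv> \<lambda>y. 1 + g y (grad y) (grad y)"
  shows "Df (vlift_field A X) (hlift_field A g Y) (x, u) =
           (1/2) *\<^sub>R H (R u (X x) (Y x))
           + (1/2 * df (X x)) *\<^sub>R H (R u (grad x) (Y x))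
           + (1/2 * df (X x)) *\<^sub>R V (D Y grad x)
           + (1 / (2 * \<alpha> x) * (g x (X x) (D Y grad x) - 1/2 * tderiv A \<alpha> x (Y x) * df (X x))) *\<^sub>R V (grad x)"
proof -
  note L = lift_fields_in_vector_fields
  have "Df (vlift_field A X) (hlift_field A g Y) (x, u)
      = Df (hlift_field A g Y) (vlift_field A X) (x, u) - V (D Y X x)"
    using Df_torsion_free[OF L(2)[OF X] L(1)[OF Y] bundle_point] lie_bracket_lifts(3)[OF X Y]
    by (simp add: algebra_simps)
  then show ?thesis unfolding Df_HV[OF Y X] \<alpha>_def by (simp add: algebra_simps)
qed

text \<open>Products of lifts are constant on the fibres, and vertical lifts commute, so the vertical part vanishes.
  In the horizontal part only the derivative of \<open>g + df \<otimes> df\<close> along \<open>Z\<close> survives; the symmetry of the Hessian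
  moves \<open>Z\<close> out of the differentiating position.\<close>

lemma Df_VV:
  assumes X: "X \<in> vector_fields A" and Y: "Y \<in> vector_fields A"
  shows "Df (vlift_field A X) (vlift_field A Y) (x, u) =
           - (1/2 * df (X x)) *\<^sub>R H (D Y grad x) - (1/2 * df (Y x)) *\<^sub>R H (D X grad x)" (is "_ = ?rhs")
proof (rule bundle_vector_eqI)
  note L = lift_fields_in_vector_fields
  show "Df (vlift_field A X) (vlift_field A Y) (x, u) \<in> tangent_space TA (x, u)"
    by (intro Df_tangent L X Y)
  show "?rhs \<in> tangent_space TA (x, u)"
    by (intro TM_tangent tangent X Y)
  fix Z assume Z: "Z \<in> vector_fields A"
  note z = TM.metric_scaleR[OF gf_metric bundle_point TM.zero_in_tangent_space, of _ 0, simplified]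
  show "gf (x, u) (Df (vlift_field A X) (vlift_field A Y) (x, u)) (H (Z x)) = gf (x, u) ?rhs (H (Z x))"
  proof -
    have s: "g x (X x) (D Z Y x) = g x (D Z Y x) (X x)" using metric_sym[OF metric x] by (simp add: tangent X Y Z)
    show ?thesis
      using koszul_gf[OF L(2)[OF X] L(2)[OF Y] L(1)[OF Z]] s hessian_sym[OF X Z x] hessian_sym[OF Y Z x]
      by (simp add: lift_field_eq[OF x u] tderiv_gf_lifts lie_bracket_lifts bundle_metric gf_lifts
          TM_tangent tangent X Y Z z algebra_simps)
  qed
  show "gf (x, u) (Df (vlift_field A X) (vlift_field A Y) (x, u)) (V (Z x)) = gf (x, u) ?rhs (V (Z x))"
    using koszul_gf[OF L(2)[OF X] L(2)[OF Y] L(2)[OF Z]]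
    by (simp add: lift_field_eq[OF x u] tderiv_gf_lifts lie_bracket_lifts bundle_metric gf_lifts
        TM_tangent tangent X Y Z z)
qed

end

end

theorem theorem3p5:
  fixes T :: "'a topology" and A :: "('a, 'e::euclidean_space) atlas"
    and g :: "('a, 'e) metric" and f :: "'a \<Rightarrow> real"
    and gf :: "('a \<times> ('a, 'e) tvec, 'e \<times> 'e) metric"
    and D :: "('a, 'e) connection"
    and Df :: "('a \<times> ('a, 'e) tvec, 'e \<times> 'e) connection"
    and X Y :: "'a \<Rightarrow> ('a, 'e) tvec" and x :: 'a and u :: "('a, 'e) tvec"
  defines "grad \<equiv> gradient A g f"
  defines "\<alpha> \<equiv> \<lambda>y. 1 + g y (grad y) (grad y)"
  defines "R \<equiv> curvature_at A D x"
  defines "d \<equiv> \<lambda>h. tderiv A h x"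
  defines "H \<equiv> hlift A g (x, u)"
  defines "V \<equiv> vlift A (x, u)"
  assumes "riemannian_manifold T A g"
    and "smooth_function A f" and "\<forall>y\<in>carrier A. f y > 0"
    and "mus_gradient_metric A g f gf"
    and "levi_civita A g D"
    and "levi_civita (tangent_atlas A) gf Df"
    and "X \<in> vector_fields A" and "Y \<in> vector_fields A"
    and "x \<in> carrier A" and "u \<in> tangent_space A x"
  shows "  Df (hlift_field A g X) (hlift_field A g Y) (x, u) =
           H (D X Y x) - (1/2) *\<^sub>R V (R (X x) (Y x) u)
        \<and> Df (hlift_field A g X) (vlift_field A Y) (x, u) =
           (1/2) *\<^sub>R H (R u (Y x) (X x))
           + (1/2 * d f (Y x)) *\<^sub>R H (R u (grad x) (X x))
           + (1/2 * d f (Y x)) *\<^sub>R V (D X grad x)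
           + V (D X Y x)
           + (1 / (2 * \<alpha> x) * (g x (Y x) (D X grad x) - 1/2 * d \<alpha> (X x) * d f (Y x))) *\<^sub>R V (grad x)
        \<and> Df (vlift_field A X) (hlift_field A g Y) (x, u) =
           (1/2) *\<^sub>R H (R u (X x) (Y x))
           + (1/2 * d f (X x)) *\<^sub>R H (R u (grad x) (Y x))
           + (1/2 * d f (X x)) *\<^sub>R V (D Y grad x)
           + (1 / (2 * \<alpha> x) * (g x (X x) (D Y grad x) - 1/2 * d \<alpha> (Y x) * d f (X x))) *\<^sub>R V (grad x)
        \<and> Df (vlift_field A X) (vlift_field A Y) (x, u) =
           - (1/2 * d f (X x)) *\<^sub>R H (D Y grad x)
           - (1/2 * d f (Y x)) *\<^sub>R H (D X grad x)"
proof -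
  interpret mus_gradient T A g D f gf Df
    using assms(7-12)
    by unfold_locales (auto simp: riemannian_manifold_def)
  note XY = assms(13,14) and xu = assms(15,16)
  show ?thesis
    unfolding grad_def \<alpha>_def R_def d_def H_def V_def
    by (intro conjI Df_HH[OF xu XY] Df_HV[OF xu XY] Df_VH[OF xu XY] Df_VV[OF xu XY])
qed

end
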